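(* Let $a,b,c\in\mathbb{R}$ and $1\leq p<\infty$ be given. Then $\widetilde{W}_{\{a,b\}}^{1,(\infty,p)}\hookrightarrow L^p(\mathbb{R}^N;|x|^c dx)$ if and only if $a\neq 0$ and one of the following three conditions holds: (i) $ap-N\neq b-p$ are on the same side of $-N$ (including $b-p=-N$) and $c$ is in the open interval with endpoints $ap-N$ and $b-p$. (ii) $ap-N$ and $b-p$ are strictly on opposite sides of $-N$ and $c$ is in the open interval with endpoints $ap-N$ and $-N$. (iii) $a(b-p+N)>0$ and $c=b-p$ (it is not assumed here that $ap-N\neq b-p$). If so, there is a constant $C>0$ such that $$\|u\|_{b-p,p}\leq C\,\|\partial_\rho u\|_{b,p},\qquad \forall u\in\widetilde{W}_{\{a,b\}}^{1,(\infty,p)}.$$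
   Context: $N\geq 1$ is an integer and $\mathbb{R}_*^N:=\mathbb{R}^N\setminus\{0\}$. For $d\in\mathbb{R}$, $|x|^d dx$ is regarded as a measure on $\mathbb{R}^N$ for which $\{0\}$ has measure $0$. For $0<s<\infty$, $L^s(\mathbb{R}^N;|x|^d dx)$ is the space of Lebesgue measurable functions $u$ such that $|x|^{d/s}u\in L^s(\mathbb{R}^N)$, with (quasi-)norm $\|u\|_{d,s}:=\|\,|x|^{d/s}u\|_s$. For a distribution $u$ on $\mathbb{R}_*^N$, $\partial_\rho u:=\nabla u\cdot\frac{x}{|x|}$ is its radial derivative. For $a,b\in\mathbb{R}$ and $1\leq p<\infty$, $$\widetilde{W}_{\{a,b\}}^{1,(\infty,p)}:=\{u\in L^1_{loc}(\mathbb{R}_*^N): |x|^a u\in L^\infty(\mathbb{R}^N),\ \partial_\rho u\in L^p(\mathbb{R}^N;|x|^b dx)\},$$ with norm $\|\,|x|^a u\|_\infty+\|\partial_\rho u\|_{b,p}$. The symbol $\hookrightarrow$ denotes continuous embedding. The interval with two given endpoints is meant irrespective of which endpoint is larger. "On the same side of $-N$ (including $b-p=-N$)" means that both numbers are $\geq -N$ or both are $\leq -N$; equivalently $a(b-p+N)\geq 0$. "Strictly on opposite sides of $-N$" means one number is $<-N$ and the other is $>-N$; equivalently $a(b-p+N)<0$. *)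

theory Defs
  imports "HOL-Probability.Essential_Supremum"
begin

(* R^N is an arbitrary Euclidean space of dimension N = DIM('a) >= 1.  All functions are
   real-valued and total on R^N; since {0} is a Lebesgue null set, a function on R^N minus the
   origin is represented by an arbitrary total extension.  Almost-everywhere classes are not
   formed: the spaces below are sets of functions closed under almost-everywhere equality, and
   the norms do not distinguish almost-everywhere equal functions. *)

definition Lp :: "real \<Rightarrow> ('a::euclidean_space \<Rightarrow> real) set" where
  "Lp s = {u \<in> borel_measurable lebesgue. integrable lebesgue (\<lambda>x. \<bar>u x\<bar> powr s)}"

definition Lp_norm :: "real \<Rightarrow> ('a::euclidean_space \<Rightarrow> real) \<Rightarrow> real" where
  "Lp_norm s u = (LINT x|lebesgue. \<bar>u x\<bar> powr s) powr (1 / s)"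

(* The weight takes the value 0 powr _ = 0 at the origin, which is irrelevant up to a null set. *)

definition weighted_Lp :: "real \<Rightarrow> real \<Rightarrow> ('a::euclidean_space \<Rightarrow> real) set" where
  "weighted_Lp d s = {u \<in> borel_measurable lebesgue. (\<lambda>x. norm x powr (d / s) * u x) \<in> Lp s}"

definition weighted_Lp_norm :: "real \<Rightarrow> real \<Rightarrow> ('a::euclidean_space \<Rightarrow> real) \<Rightarrow> real" where
  "weighted_Lp_norm d s u = Lp_norm s (\<lambda>x. norm x powr (d / s) * u x)"

definition Linf :: "('a::euclidean_space \<Rightarrow> real) set" where
  "Linf = {u \<in> borel_measurable lebesgue. \<exists>C. AE x in lebesgue. \<bar>u x\<bar> \<le> C}"

definition Linf_norm :: "('a::euclidean_space \<Rightarrow> real) \<Rightarrow> real" where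
  "Linf_norm u = real_of_ereal (esssup lebesgue (\<lambda>x. ereal \<bar>u x\<bar>))"

definition L1_loc :: "'a::euclidean_space set \<Rightarrow> ('a \<Rightarrow> real) set" where
  "L1_loc \<Omega> = {u. \<forall>K. compact K \<and> K \<subseteq> \<Omega> \<longrightarrow> u absolutely_integrable_on K}"

definition partial_deriv :: "'a::euclidean_space \<Rightarrow> ('a \<Rightarrow> real) \<Rightarrow> 'a \<Rightarrow> real" where
  "partial_deriv i f x = frechet_derivative f (at x) i"

primrec Ck :: "nat \<Rightarrow> ('a::euclidean_space \<Rightarrow> real) \<Rightarrow> bool" where
  "Ck 0 f \<longleftrightarrow> continuous_on UNIV f"
| "Ck (Suc k) f \<longleftrightarrow> f differentiable_on UNIV \<and> (\<forall>i\<in>Basis. Ck k (partial_deriv i f))"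

(* Test functions on an open set, extended by 0 to the whole space. *)

definition test_functions :: "'a::euclidean_space set \<Rightarrow> ('a \<Rightarrow> real) set" where
  "test_functions \<Omega> = {\<phi>. (\<forall>k. Ck k \<phi>) \<and> compact (closure {x. \<phi> x \<noteq> 0})
      \<and> closure {x. \<phi> x \<noteq> 0} \<subseteq> \<Omega>}"

(* Distributions are represented by functionals that are only ever compared on test functions. *)

type_synonym 'a functional = "('a \<Rightarrow> real) \<Rightarrow> real"

definition distr_of :: "('a::euclidean_space \<Rightarrow> real) \<Rightarrow> 'a functional" where
  "distr_of u = (\<lambda>\<phi>. LINT x|lebesgue. u x * \<phi> x)"

definition distr_partial :: "'a::euclidean_space \<Rightarrow> 'a functional \<Rightarrow> 'a functional" where
  "distr_partial i T = (\<lambda>\<phi>. - T (partial_deriv i \<phi>))"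

definition distr_mult :: "('a::euclidean_space \<Rightarrow> real) \<Rightarrow> 'a functional \<Rightarrow> 'a functional" where
  "distr_mult \<psi> T = (\<lambda>\<phi>. T (\<lambda>x. \<psi> x * \<phi> x))"

(* The product of the gradient of T with x / |x|.  The multipliers are smooth away from the
   origin, and test functions on the punctured space vanish near the origin. *)

definition distr_radial :: "'a::euclidean_space functional \<Rightarrow> 'a functional" where
  "distr_radial T = (\<lambda>\<phi>. \<Sum>i\<in>Basis. distr_mult (\<lambda>x. (x \<bullet> i) / norm x) (distr_partial i T) \<phi>)"

definition has_radial_deriv :: "('a::euclidean_space \<Rightarrow> real) \<Rightarrow> ('a \<Rightarrow> real) \<Rightarrow> bool" where
  "has_radial_deriv u g \<longleftrightarrow> g \<in> L1_loc (UNIV - {0}) \<and>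
     (\<forall>\<phi>\<in>test_functions (UNIV - {0}). distr_radial (distr_of u) \<phi> = distr_of g \<phi>)"

(* A function representing the distributional radial derivative is unique up to
   almost-everywhere equality, so the choice made here does not matter. *)

definition radial_deriv :: "('a::euclidean_space \<Rightarrow> real) \<Rightarrow> 'a \<Rightarrow> real" where
  "radial_deriv u = (SOME g. has_radial_deriv u g)"

definition W_tilde :: "real \<Rightarrow> real \<Rightarrow> real \<Rightarrow> ('a::euclidean_space \<Rightarrow> real) set" where
  "W_tilde a b p = {u \<in> L1_loc (UNIV - {0}). (\<lambda>x. norm x powr a * u x) \<in> Linf \<and>
     (\<exists>g\<in>weighted_Lp b p. has_radial_deriv u g)}"

definition W_tilde_norm :: "real \<Rightarrow> real \<Rightarrow> real \<Rightarrow> ('a::euclidean_space \<Rightarrow> real) \<Rightarrow> real" where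
  "W_tilde_norm a b p u =
     Linf_norm (\<lambda>x. norm x powr a * u x) + weighted_Lp_norm b p (radial_deriv u)"

definition continuously_embedded ::
  "'f set \<Rightarrow> ('f \<Rightarrow> real) \<Rightarrow> 'f set \<Rightarrow> ('f \<Rightarrow> real) \<Rightarrow> bool" where
  "continuously_embedded X nX Y nY \<longleftrightarrow> X \<subseteq> Y \<and> (\<exists>C>0. \<forall>u\<in>X. nY u \<le> C * nX u)"

definition open_interval :: "real \<Rightarrow> real \<Rightarrow> real set" where
  "open_interval x y = {min x y<..<max x y}"

end

theory Submission
  imports Defs
begin

text \<open>Write \<open>N = DIM('a)\<close>, \<open>\<alpha> = c + N\<close> and \<open>\<beta> = b - p + N\<close>.  The three alternatives of the theorem
amount to one condition: \<open>a * \<alpha> > 0\<close>, and \<open>\<alpha> = \<beta>\<close> or \<open>\<alpha>\<close> lies strictly between \<open>a * p\<close> and \<open>\<beta>\<close>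
(\<open>exponent_conditions_iff\<close>).

Sufficiency.  Polar coordinates and absolute continuity on rays are replaced by the dilations
\<open>x \<mapsto> exp t *\<^sub>R x\<close>, which commute with \<open>\<rho> \<partial>\<^sub>\<rho>\<close>.  Testing the weak equation against dilated test functions
and integrating over the dilation parameter gives, for almost every \<open>y\<close> (\<open>dilation_increment\<close>),
\<open>u (exp (l * T) *\<^sub>R y) - u y = l * \<integral>\<^sub>0\<^sup>T h (exp (l * \<tau>) *\<^sub>R y) d\<tau>\<close> with \<open>h x = norm x * \<partial>\<^sub>\<rho> u x\<close>.
The choice \<open>l = a\<close> moves \<open>y\<close> towards the end of the half-line at which the a priori bound
\<open>\<bar>u x\<bar> \<le> M * norm x powr (- a)\<close> decays, whatever the sign of \<open>a\<close>; so \<open>\<bar>u y\<bar>\<close> is at most the integral of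
\<open>\<bar>a * h\<bar>\<close> along the orbit of \<open>y\<close>, or \<open>M\<close> plus the part of that integral up to a time shortly after the orbit has
left the region \<open>norm x powr a \<le> 1\<close>.  Hardy's inequality for orbit integrals (\<open>Hardy_dilation\<close>) bounds their weighted
norm because \<open>a * \<alpha> > 0\<close>.  The space is split into \<open>norm x powr a \<le> 1\<close> and its complement.  On each
piece either the power \<open>norm x powr (\<alpha> - \<beta>)\<close> is bounded, and Hardy's inequality applies, or the bound by
\<open>M * norm x powr (- a)\<close> alone is \<open>p\<close>-integrable for the weight (\<open>Lp_mass_inner_le\<close>,
\<open>Lp_mass_outer_le\<close>).  For \<open>\<alpha> = \<beta>\<close> no splitting is needed and \<open>M\<close> does not enter, which is the
inequality in the last part (\<open>Hardy_global\<close>).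

Necessity.  If the condition fails, some radial function
\<open>norm x powr \<mu> * (1 + norm x powr m) powr (- k)\<close> lies in the first space and not in the second
(\<open>not_embedded_if_exponents\<close>): \<open>\<mu> = 0\<close> if \<open>a * \<alpha> \<le> 0\<close>, and \<open>\<mu> = - \<alpha> / p\<close> otherwise.  Here \<open>norm x powr m\<close> is
small at the end, zero or infinity, where the \<open>p\<close>-integral diverges.\<close>

section \<open>Smooth functions on open sets\<close>

text \<open>\<open>k\<close>-fold continuous differentiability on an open set, by the recursion of \<open>Ck\<close> localized to \<open>S\<close>;
the two notions agree on \<open>UNIV\<close>.  Localization lets powers of the norm, smooth off the origin only, multiply test functions.\<close>

primrec Ck_on :: "'a::euclidean_space set \<Rightarrow> nat \<Rightarrow> ('a \<Rightarrow> real) \<Rightarrow> bool" where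
  "Ck_on S 0 f \<longleftrightarrow> continuous_on S f"
| "Ck_on S (Suc k) f \<longleftrightarrow> (\<forall>x\<in>S. f differentiable at x) \<and> (\<forall>i\<in>Basis. Ck_on S k (partial_deriv i f))"

lemma Ck_on_UNIV: "Ck_on UNIV k f \<longleftrightarrow> Ck k f"
  by (induction k arbitrary: f) (auto simp: differentiable_on_def)

lemma partial_deriv_eq:
  assumes "(f has_derivative f') (at x)"
  shows "partial_deriv i f x = f' i"
  using frechet_derivative_at[OF assms] by (simp add: partial_deriv_def)

lemma has_derivative_frechet:
  "f differentiable at x \<Longrightarrow> (f has_derivative frechet_derivative f (at x)) (at x)"
  by (simp add: frechet_derivative_works)

lemma Ck_on_cong:
  assumes "open S" "\<And>x. x \<in> S \<Longrightarrow> f x = g x" "Ck_on S k f"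
  shows "Ck_on S k g"
  using assms(2,3)
proof (induction k arbitrary: f g)
  case 0
  then show ?case by (auto cong: continuous_on_cong)
next
  case (Suc k)
  have D: "(g has_derivative frechet_derivative f (at x)) (at x)" if "x \<in> S" for x
    using has_derivative_transform_within_open[OF has_derivative_frechet \<open>open S\<close> that] that Suc.prems
    by auto
  have "partial_deriv i f x = partial_deriv i g x" if "x \<in> S" for i x
    using partial_deriv_eq[OF D[OF that]] by (simp add: partial_deriv_def)
  then have "Ck_on S k (partial_deriv i g)" if "i \<in> Basis" for i
    using Suc that by (metis Ck_on.simps(2))
  with D show ?case by (auto simp: differentiable_def)
qed

lemma Ck_on_Suc: "Ck_on S (Suc k) f \<Longrightarrow> Ck_on S k f"
proof (induction k arbitrary: f)
  case 0
  then show ?case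
    by (auto intro!: continuous_at_imp_continuous_on differentiable_imp_continuous_within)
next
  case (Suc k)
  then show ?case by (metis Ck_on.simps(2))
qed

lemma Ck_on_subset: "Ck_on S k f \<Longrightarrow> T \<subseteq> S \<Longrightarrow> Ck_on T k f"
  by (induction k arbitrary: f) (auto intro: continuous_on_subset)

lemma Ck_on_Un: "open S \<Longrightarrow> open T \<Longrightarrow> Ck_on S k f \<Longrightarrow> Ck_on T k f \<Longrightarrow> Ck_on (S \<union> T) k f"
  by (induction k arbitrary: f) (auto intro: continuous_on_open_Un)

lemma Ck_on_const: "Ck_on S k (\<lambda>x. c)"
proof (induction k arbitrary: c)
  case (Suc k)
  have "partial_deriv i (\<lambda>x. c) = (\<lambda>x. 0)" for i :: 'a
    by (intro ext partial_deriv_eq) auto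
  with Suc show ?case by simp
qed simp

lemma Ck_on_inner: "Ck_on S k (\<lambda>x. x \<bullet> v)"
proof (cases k)
  case (Suc j)
  have "partial_deriv i (\<lambda>x. x \<bullet> v) = (\<lambda>x. i \<bullet> v)" for i :: 'a
    by (intro ext partial_deriv_eq) (auto intro!: derivative_eq_intros)
  with Suc show ?thesis by (auto intro!: Ck_on_const derivative_intros)
qed (auto intro!: continuous_intros)

lemma Ck_on_add:
  assumes "open S" "Ck_on S k f" "Ck_on S k g"
  shows "Ck_on S k (\<lambda>x. f x + g x)"
  using assms(2,3)
proof (induction k arbitrary: f g)
  case 0
  then show ?case by (auto intro!: continuous_intros)
next
  case (Suc k)
  have "partial_deriv i f x + partial_deriv i g x = partial_deriv i (\<lambda>x. f x + g x) x" if "x \<in> S" for x i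
    using that Suc.prems
    by (subst partial_deriv_eq[OF has_derivative_add[OF has_derivative_frechet has_derivative_frechet]])
       (auto simp: partial_deriv_def)
  moreover have "Ck_on S k (\<lambda>x. partial_deriv i f x + partial_deriv i g x)" if "i \<in> Basis" for i
    using Suc that by auto
  ultimately have "Ck_on S k (partial_deriv i (\<lambda>x. f x + g x))" if "i \<in> Basis" for i
    using Ck_on_cong[OF \<open>open S\<close>] that by (metis (no_types, lifting))
  then show ?case using Suc.prems by auto
qed

lemma Ck_on_mult:
  assumes "open S" "Ck_on S k f" "Ck_on S k g"
  shows "Ck_on S k (\<lambda>x. f x * g x)"
  using assms(2,3)
proof (induction k arbitrary: f g)
  case 0
  then show ?case by (auto intro!: continuous_intros)
next
  case (Suc k)
  have "f x * partial_deriv i g x + partial_deriv i f x * g x = partial_deriv i (\<lambda>x. f x * g x) x"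
    if "x \<in> S" for x i
    using that Suc.prems
    by (subst partial_deriv_eq[OF has_derivative_mult[OF has_derivative_frechet has_derivative_frechet]])
       (auto simp: partial_deriv_def)
  moreover have "Ck_on S k (\<lambda>x. f x * partial_deriv i g x + partial_deriv i f x * g x)" if "i \<in> Basis" for i
    using Suc.prems that Ck_on_Suc[OF Suc.prems(1)] Ck_on_Suc[OF Suc.prems(2)]
    by (intro Ck_on_add[OF \<open>open S\<close>] Suc.IH) simp_all
  ultimately have "Ck_on S k (partial_deriv i (\<lambda>x. f x * g x))" if "i \<in> Basis" for i
    using Ck_on_cong[OF \<open>open S\<close>] that by (metis (no_types, lifting))
  then show ?case using Suc.prems by auto
qed

text \<open>Chain rule for an outer function of one variable, given through the sequence \<open>D\<close> of all its derivatives.\<close>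

lemma Ck_on_compose:
  fixes D :: "nat \<Rightarrow> real \<Rightarrow> real"
  assumes "open S" and D: "\<And>n t. t \<in> T \<Longrightarrow> (D n has_real_derivative D (Suc n) t) (at t)"
    and T: "\<And>x. x \<in> S \<Longrightarrow> f x \<in> T" and "Ck_on S k f"
  shows "Ck_on S k (\<lambda>x. D n (f x))"
  using assms(4)
proof (induction k arbitrary: n)
  case 0
  have "continuous_on T (D n)"
    using D by (meson DERIV_continuous continuous_at_imp_continuous_on)
  then show ?case using 0 T by (auto intro: continuous_on_compose2)
next
  case (Suc k)
  have d: "((\<lambda>x. D n (f x)) has_derivative (\<lambda>h. D (Suc n) (f x) * frechet_derivative f (at x) h)) (at x)"
    if "x \<in> S" for x
  proof -
    have "f differentiable at x" using Suc.prems that by auto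
    from has_derivative_compose[OF has_derivative_frechet[OF this], of "D n", OF D[OF T[OF that], unfolded has_field_derivative_def]]
    show ?thesis .
  qed
  have "D (Suc n) (f x) * partial_deriv i f x = partial_deriv i (\<lambda>x. D n (f x)) x" if "x \<in> S" for x i
    using partial_deriv_eq[OF d[OF that]] by (simp add: partial_deriv_def)
  moreover have "Ck_on S k (\<lambda>x. D (Suc n) (f x) * partial_deriv i f x)" if "i \<in> Basis" for i
    using Suc.prems that Ck_on_Suc[OF Suc.prems]
    by (intro Ck_on_mult[OF \<open>open S\<close>] Suc.IH) simp_all
  ultimately have "Ck_on S k (partial_deriv i (\<lambda>x. D n (f x)))" if "i \<in> Basis" for i
    using Ck_on_cong[OF \<open>open S\<close>] that by (metis (no_types, lifting))
  then show ?case using d by (auto simp: differentiable_def)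
qed

lemma Ck_on_prod:
  assumes "open S" "\<And>i. i \<in> I \<Longrightarrow> Ck_on S k (f i)"
  shows "Ck_on S k (\<lambda>x. \<Prod>i\<in>I. f i x)"
  using assms(2) by (induction I rule: infinite_finite_induct)
     (auto intro: Ck_on_const Ck_on_mult[OF \<open>open S\<close>])

lemma Ck_on_inner_self:
  assumes "open (S :: 'a::euclidean_space set)" shows "Ck_on S k (\<lambda>x. x \<bullet> x)"
proof (cases k)
  case (Suc j)
  have "partial_deriv i (\<lambda>x. x \<bullet> x) = (\<lambda>x. 2 * (x \<bullet> i))" for i :: 'a
    by (intro ext partial_deriv_eq) (auto intro!: derivative_eq_intros simp: inner_commute)
  with Suc assms show ?thesis
    by (auto intro!: Ck_on_const Ck_on_mult Ck_on_inner derivative_intros)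
qed (auto intro!: continuous_intros)

lemma Ck_on_norm_powr: "Ck_on (UNIV - {0}) k (\<lambda>x. norm x powr s)"
proof -
  define D where "D = (\<lambda>n t::real. (\<Prod>j<n. s / 2 - real j) * t powr (s / 2 - real n))"
  have "(D n has_real_derivative D (Suc n) t) (at t)" if "t \<in> {0<..}" for n t
    using DERIV_cmult[OF has_real_derivative_powr[of t "s / 2 - real n"], of "\<Prod>j<n. s / 2 - real j"] that unfolding D_def
    by (auto simp: algebra_simps)
  then have "Ck_on (UNIV - {0::'a}) k (\<lambda>x. D 0 (x \<bullet> x))"
    using Ck_on_inner_self[OF open_delete[OF open_UNIV], of 0 k]
    by (intro Ck_on_compose[where T="{0<..}" and D=D and n=0 and f="\<lambda>x. x \<bullet> x"]) auto
  moreover have "D 0 (x \<bullet> x) = norm x powr s" if "x \<noteq> 0" for x :: 'a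
    using that by (simp add: D_def norm_eq_sqrt_inner powr_half_sqrt[symmetric] powr_powr)
  ultimately show ?thesis
    using Ck_on_cong[of "UNIV - {0::'a}" "\<lambda>x. D 0 (x \<bullet> x)" "\<lambda>x. norm x powr s" k]
    by (simp add: open_delete)
qed

section \<open>A smooth function that vanishes on a half-line\<close>

text \<open>The standard flat function \<open>exp (- 1 / t)\<close>, extended by zero to \<open>t \<le> 0\<close>.\<close>

definition flat :: "real \<Rightarrow> real" where
  "flat t = (if t > 0 then exp (- (1 / t)) else 0)"

lemma flat_bounds: "0 \<le> flat t" "flat t \<le> 1"
  by (auto simp: flat_def)

lemma flat_pos_iff: "0 < flat t \<longleftrightarrow> 0 < t"
  by (auto simp: flat_def)

text \<open>The polynomials \<open>P\<^sub>n\<close> for which the \<open>n\<close>-th derivative of \<open>flat\<close> at \<open>t > 0\<close> is \<open>P\<^sub>n (1 / t) * exp (- 1 / t)\<close>.\<close>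

primrec flat_poly :: "nat \<Rightarrow> real poly" where
  "flat_poly 0 = 1"
| "flat_poly (Suc n) = [:0, 0, 1:] * (flat_poly n - pderiv (flat_poly n))"

text \<open>The \<open>n\<close>-th derivative of \<open>flat\<close>.\<close>

definition flat_deriv :: "nat \<Rightarrow> real \<Rightarrow> real" where
  "flat_deriv n t = (if t > 0 then poly (flat_poly n) (1 / t) * exp (- (1 / t)) else 0)"

lemma poly_exp_tendsto_0: "((\<lambda>s. poly q s * exp (- s)) \<longlongrightarrow> 0) at_top" for q :: "real poly"
proof -
  have "((\<lambda>s::real. \<Sum>i\<le>degree q. coeff q i * (s ^ i / exp s)) \<longlongrightarrow> (\<Sum>i\<le>degree q. coeff q i * 0)) at_top"
    by (intro tendsto_sum tendsto_mult tendsto_const tendsto_power_div_exp_0)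
  then show ?thesis
    by (simp add: poly_altdef sum_distrib_right exp_minus divide_inverse mult.assoc)
qed

lemma flat_deriv_has_derivative: "(flat_deriv n has_real_derivative flat_deriv (Suc n) t) (at t)"
proof -
  consider "t > 0" | "t < 0" | "t = 0" by linarith
  then show ?thesis
  proof cases
    case 1
    have "((\<lambda>t. poly (flat_poly n) (1 / t) * exp (- (1 / t))) has_real_derivative flat_deriv (Suc n) t) (at t)"
      using 1 unfolding flat_deriv_def
      by (auto intro!: derivative_eq_intros DERIV_chain2[OF poly_DERIV] simp: field_simps power2_eq_square)
    then show ?thesis
      by (rule has_field_derivative_transform_within_open[where S="{0<..}"])
         (use 1 in \<open>auto simp: flat_deriv_def\<close>)
  next
    case 2
    have "((\<lambda>t. 0) has_real_derivative flat_deriv (Suc n) t) (at t)"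
      using 2 by (auto simp: flat_deriv_def)
    then show ?thesis
      by (rule has_field_derivative_transform_within_open[where S="{..<0}"])
         (use 2 in \<open>auto simp: flat_deriv_def\<close>)
  next
    case 3
    \<comment> \<open>With \<open>s = 1 / t\<close> the difference quotient at the origin is a polynomial times \<open>exp (- s)\<close>.\<close>
    have "((\<lambda>s. poly ([:0, 1:] * flat_poly n) s * exp (- s)) \<longlongrightarrow> 0) at_top"
      by (rule poly_exp_tendsto_0)
    then have "((\<lambda>t. poly ([:0, 1:] * flat_poly n) (inverse t) * exp (- inverse t)) \<longlongrightarrow> 0) (at_right 0)"
      by (rule filterlim_compose[OF _ filterlim_inverse_at_top_right])
    then have "((\<lambda>t. flat_deriv n t / t) \<longlongrightarrow> 0) (at_right 0)"
      by (rule Lim_transform_eventually)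
         (auto simp: eventually_at_filter flat_deriv_def field_simps)
    moreover have "((\<lambda>t. flat_deriv n t / t) \<longlongrightarrow> 0) (at_left 0)"
      by (rule Lim_transform_eventually[OF tendsto_const])
         (auto simp: eventually_at_filter flat_deriv_def)
    ultimately have "((\<lambda>t. flat_deriv n t / t) \<longlongrightarrow> 0) (at 0)"
      by (simp add: filterlim_at_split)
    then show ?thesis
      using 3 by (simp add: has_field_derivative_iff flat_deriv_def)
  qed
qed

lemma Ck_on_flat:
  assumes "open S" "Ck_on S k f"
  shows "Ck_on S k (\<lambda>x. flat (f x))"
proof -
  have "Ck_on S k (\<lambda>x. flat_deriv 0 (f x))"
    using assms flat_deriv_has_derivative by (intro Ck_on_compose[where T=UNIV and D=flat_deriv and n=0 and f=f]) auto
  moreover have "flat_deriv 0 = flat" by (auto simp: flat_deriv_def flat_def)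
  ultimately show ?thesis by simp
qed

section \<open>Test functions on the punctured space\<close>

lemma Ck_test: "\<psi> \<in> test_functions \<Omega> \<Longrightarrow> Ck k \<psi>"
  by (simp add: test_functions_def)

lemma test_differentiable: "\<psi> \<in> test_functions \<Omega> \<Longrightarrow> \<psi> differentiable at x"
  using Ck_test[of \<psi> \<Omega> "Suc 0"] by (simp add: differentiable_on_def)

lemma test_continuous_partial: "\<psi> \<in> test_functions \<Omega> \<Longrightarrow> i \<in> Basis \<Longrightarrow> continuous_on UNIV (partial_deriv i \<psi>)"
  using Ck_test[of \<psi> \<Omega> "Suc 0"] by simp

lemma test_continuous: "\<psi> \<in> test_functions \<Omega> \<Longrightarrow> continuous_on UNIV \<psi>"
  using Ck_test[of \<psi> \<Omega> 0] by simp

lemma test_functions_mult: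
  assumes "\<psi> \<in> test_functions (UNIV - {0})" "\<And>k. Ck_on (UNIV - {0}) k w"
  shows "(\<lambda>x. w x * \<psi> x) \<in> test_functions (UNIV - {0})"
proof -
  define K where "K = closure {x. \<psi> x \<noteq> 0}"
  have K: "compact K" "K \<subseteq> UNIV - {0}"
    using assms(1) by (auto simp: test_functions_def K_def)
  have zero: "\<psi> x = 0" if "x \<notin> K" for x
    using that closure_subset[of "{x. \<psi> x \<noteq> 0}"] by (auto simp: K_def)
  have "Ck k (\<lambda>x. w x * \<psi> x)" for k
  proof -
    have "Ck_on (UNIV - {0}) k \<psi>"
      using Ck_test[OF assms(1)] by (auto simp: Ck_on_UNIV[symmetric] intro: Ck_on_subset)
    then have "Ck_on (UNIV - {0}) k (\<lambda>x. w x * \<psi> x)"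
      using assms(2) by (intro Ck_on_mult) auto
    moreover have "Ck_on (- K) k (\<lambda>x. w x * \<psi> x)"
      using K zero
      by (intro Ck_on_cong[OF _ _ Ck_on_const[of _ _ 0]]) (auto simp: open_Compl compact_imp_closed)
    moreover have "(UNIV - {0}) \<union> (- K) = UNIV" using K by auto
    moreover have "open (- K)" using K by (simp add: compact_imp_closed open_Compl)
    ultimately show ?thesis
      using Ck_on_Un[of "UNIV - {0}" "- K" k "\<lambda>x. w x * \<psi> x"]
      by (simp add: Ck_on_UNIV open_delete)
  qed
  moreover have sub: "closure {x. w x * \<psi> x \<noteq> 0} \<subseteq> K"
    unfolding K_def by (intro closure_mono) auto
  moreover have "compact (closure {x. w x * \<psi> x \<noteq> 0})"
    using compact_Int_closed[OF K(1) closed_closure, of "{x. w x * \<psi> x \<noteq> 0}"] sub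
    by (simp add: Int_absorb1)
  ultimately show ?thesis using K by (auto simp: test_functions_def)
qed

lemma Ck_dilate: "Ck k f \<Longrightarrow> Ck k (\<lambda>x. f (c *\<^sub>R x))"
proof (induction k arbitrary: f)
  case 0
  then show ?case
    using continuous_on_compose2[of UNIV f UNIV "\<lambda>x. c *\<^sub>R x"]
    by (simp add: continuous_on_scaleR)
next
  case (Suc k)
  have d: "((\<lambda>x. f (c *\<^sub>R x)) has_derivative (\<lambda>h. frechet_derivative f (at (c *\<^sub>R x)) (c *\<^sub>R h))) (at x)" for x
  proof -
    have "f differentiable at (c *\<^sub>R x)" using Suc.prems by (auto simp: differentiable_on_def)
    from has_derivative_compose[OF has_derivative_scaleR_right[OF has_derivative_ident] has_derivative_frechet[OF this]]
    show ?thesis .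
  qed
  have lin: "linear (frechet_derivative f (at x))" for x
    using Suc.prems by (auto simp: differentiable_on_def intro: linear_frechet_derivative)
  have eq: "partial_deriv i (\<lambda>x. f (c *\<^sub>R x)) = (\<lambda>x. c * partial_deriv i f (c *\<^sub>R x))" for i
    using partial_deriv_eq[OF d] linear_cmul[OF lin] by (auto simp: partial_deriv_def)
  have "Ck k (\<lambda>x. c * partial_deriv i f (c *\<^sub>R x))" if "i \<in> Basis" for i
    using that Suc by (auto simp: Ck_on_UNIV[symmetric] intro!: Ck_on_mult Ck_on_const)
  with d show ?case by (auto simp: eq differentiable_on_def differentiable_def)
qed

lemma test_functions_dilate:
  fixes \<psi> :: "'a::euclidean_space \<Rightarrow> real"
  assumes "\<psi> \<in> test_functions (UNIV - {0})" "c \<noteq> 0"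
  shows "(\<lambda>x. \<psi> (c *\<^sub>R x)) \<in> test_functions (UNIV - {0})"
proof -
  define K where "K = closure {x. \<psi> x \<noteq> 0}"
  define K' where "K' = (\<lambda>x. (1 / c) *\<^sub>R x) ` K"
  have K: "compact K" "K \<subseteq> UNIV - {0}"
    using assms(1) by (auto simp: test_functions_def K_def)
  then have K': "compact K'" "K' \<subseteq> UNIV - {0}"
    using assms(2) by (auto simp: K'_def intro!: compact_scaling)
  have "x \<in> K'" if "\<psi> (c *\<^sub>R x) \<noteq> 0" for x
  proof -
    have "c *\<^sub>R x \<in> K" using that closure_subset[of "{x. \<psi> x \<noteq> 0}"] by (auto simp: K_def)
    then show ?thesis unfolding K'_def using assms(2) by (intro image_eqI[of _ _ "c *\<^sub>R x"]) auto
  qed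
  then have sub: "closure {x. \<psi> (c *\<^sub>R x) \<noteq> 0} \<subseteq> K'"
    using K' by (intro closure_minimal) (auto intro: compact_imp_closed)
  moreover have "compact (closure {x. \<psi> (c *\<^sub>R x) \<noteq> 0})"
    using compact_Int_closed[OF K'(1) closed_closure, of "{x. \<psi> (c *\<^sub>R x) \<noteq> 0}"] sub
    by (simp add: Int_absorb1)
  ultimately show ?thesis
    using K' Ck_dilate[OF Ck_test[OF assms(1)]] by (auto simp: test_functions_def)
qed

section \<open>Compactly supported functions and the generator of dilations\<close>

text \<open>The closed annulus; for \<open>0 < r\<close> it is a compact subset of the punctured space, and every compact subset lies in one.\<close>

definition annulus :: "real \<Rightarrow> real \<Rightarrow> 'a::euclidean_space set" where
  "annulus r R = {x. r \<le> norm x \<and> norm x \<le> R}"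

lemma compact_annulus: "compact (annulus r R :: 'a::euclidean_space set)"
proof -
  have "annulus r R = cball 0 R \<inter> {x::'a. r \<le> norm x}" by (auto simp: annulus_def)
  moreover have "closed {x::'a. r \<le> norm x}"
    by (intro closed_Collect_le continuous_intros)
  ultimately show ?thesis by (auto intro: compact_Int_closed)
qed

lemma annulus_measurable [measurable]: "annulus r R \<in> sets borel"
  using compact_annulus by (blast intro: borel_closed compact_imp_closed)

lemma test_functions_annulus:
  fixes \<psi> :: "'a::euclidean_space \<Rightarrow> real"
  assumes "\<psi> \<in> test_functions (UNIV - {0})"
  obtains r R where "0 < r" "r < R"
    "\<And>x. x \<notin> annulus r R \<Longrightarrow> \<psi> x = 0" "\<And>i x. x \<notin> annulus r R \<Longrightarrow> partial_deriv i \<psi> x = 0"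
proof -
  define K where "K = closure {x. \<psi> x \<noteq> 0}"
  have K: "compact K" "0 \<notin> K"
    using assms by (auto simp: test_functions_def K_def)
  have opn: "open (- K)" using K by (simp add: compact_imp_closed open_Compl)
  obtain r where r: "r > 0" "ball 0 r \<subseteq> - K"
    using opn K(2) by (meson ComplI open_contains_ball)
  obtain R where R: "\<forall>x\<in>K. norm x \<le> R"
    using K(1) compact_imp_bounded bounded_iff by blast
  have out: "x \<notin> K" if "x \<notin> annulus r (max R (r + 1))" for x
    using that r(2) R by (auto simp: annulus_def subset_eq not_le dist_norm)
  have zero: "\<psi> x = 0" if "x \<notin> K" for x
    using that closure_subset[of "{x. \<psi> x \<noteq> 0}"] by (auto simp: K_def)
  have "partial_deriv i \<psi> x = 0" if "x \<notin> K" for x i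
  proof -
    have "((\<lambda>x. 0) has_derivative (\<lambda>h. 0)) (at x)" by simp
    then have "(\<psi> has_derivative (\<lambda>h. 0)) (at x)"
      by (rule has_derivative_transform_within_open[OF _ opn]) (use that zero in auto)
    then show ?thesis by (simp add: partial_deriv_eq)
  qed
  with out zero r show thesis by (intro that[of r "max R (r + 1)"]) auto
qed

text \<open>The divergence of the vector field \<open>x \<mapsto> \<psi> x *\<^sub>R x\<close>, that is \<open>x \<bullet> \<nabla>\<psi> + N * \<psi>\<close>.  The weak equation for
the radial derivative is a statement about this operator, which is also the generator of the dilations below.\<close>

definition div_field :: "('a::euclidean_space \<Rightarrow> real) \<Rightarrow> 'a \<Rightarrow> real" where
  "div_field \<psi> x = (\<Sum>i\<in>Basis. (x \<bullet> i) * partial_deriv i \<psi> x) + real DIM('a) * \<psi> x"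

lemma continuous_div_field:
  assumes "\<psi> \<in> test_functions \<Omega>" shows "continuous_on UNIV (div_field \<psi>)"
  unfolding div_field_def
  by (intro continuous_intros test_continuous[OF assms] test_continuous_partial[OF assms])

lemma div_field_eq_0:
  assumes "\<psi> x = 0" "\<And>i. partial_deriv i \<psi> x = 0"
  shows "div_field \<psi> x = 0"
  using assms by (simp add: div_field_def)

lemma frechet_derivative_radial:
  assumes "\<psi> differentiable at x"
  shows "frechet_derivative \<psi> (at x) v = (\<Sum>i\<in>Basis. (v \<bullet> i) * partial_deriv i \<psi> x)"
proof -
  have lin: "linear (frechet_derivative \<psi> (at x))"
    using assms by (rule linear_frechet_derivative)
  have "frechet_derivative \<psi> (at x) v = frechet_derivative \<psi> (at x) (\<Sum>i\<in>Basis. (v \<bullet> i) *\<^sub>R i)"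
    by (simp add: euclidean_representation)
  also have "\<dots> = (\<Sum>i\<in>Basis. (v \<bullet> i) * partial_deriv i \<psi> x)"
    by (simp add: linear_sum[OF lin] linear_cmul[OF lin] partial_deriv_def)
  finally show ?thesis .
qed

text \<open>\<open>div_field\<close> generates the group \<open>\<psi> \<mapsto> exp (N * t) * \<psi> (exp t *\<^sub>R x)\<close> of dilations that preserve integrals.\<close>

lemma has_derivative_dilation:
  fixes \<psi> :: "'a::euclidean_space \<Rightarrow> real"
  assumes "\<And>x. x \<noteq> 0 \<Longrightarrow> \<psi> differentiable at x" "x \<noteq> 0"
  shows "((\<lambda>\<tau>. exp (real DIM('a) * (l * \<tau>)) * \<psi> (exp (l * \<tau>) *\<^sub>R x)) has_real_derivative
           l * (exp (real DIM('a) * (l * \<tau>)) * div_field \<psi> (exp (l * \<tau>) *\<^sub>R x))) (at \<tau>)"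
proof -
  let ?y = "exp (l * \<tau>) *\<^sub>R x"
  have diff: "\<psi> differentiable at ?y" using assms by auto
  have lin: "linear (frechet_derivative \<psi> (at ?y))"
    using diff by (rule linear_frechet_derivative)
  have "((\<lambda>\<tau>. exp (l * \<tau>) *\<^sub>R x) has_derivative (\<lambda>h. h *\<^sub>R (l *\<^sub>R ?y))) (at \<tau>)"
    by (auto intro!: derivative_eq_intros)
  from has_derivative_compose[OF this has_derivative_frechet[OF diff]]
  have "((\<lambda>\<tau>. \<psi> (exp (l * \<tau>) *\<^sub>R x)) has_derivative (\<lambda>h. frechet_derivative \<psi> (at ?y) (h *\<^sub>R (l *\<^sub>R ?y)))) (at \<tau>)" .
  then have d: "((\<lambda>\<tau>. \<psi> (exp (l * \<tau>) *\<^sub>R x)) has_real_derivative (l * frechet_derivative \<psi> (at ?y) ?y)) (at \<tau>)"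
    unfolding has_field_derivative_def using linear_cmul[OF lin]
    by (elim has_derivative_eq_rhs) (auto simp: fun_eq_iff)
  have div: "div_field \<psi> ?y = frechet_derivative \<psi> (at ?y) ?y + real DIM('a) * \<psi> ?y"
    by (simp only: div_field_def frechet_derivative_radial[OF diff])
  show ?thesis
    by (rule derivative_eq_intros d refl)+
       (simp only: div, simp add: algebra_simps)
qed

section \<open>Local integrability away from the origin\<close>

text \<open>Borel functions that are integrable over every annulus away from the origin: the Borel representatives of the
locally integrable functions on the punctured space.\<close>

definition loc_int :: "('a::euclidean_space \<Rightarrow> real) \<Rightarrow> bool" where
  "loc_int u \<longleftrightarrow> u \<in> borel_measurable borel \<and>
     (\<forall>r R. 0 < r \<longrightarrow> integrable lborel (\<lambda>x. indicator (annulus r R) x * u x))"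

lemma loc_int_measurable [measurable_dest]: "loc_int u \<Longrightarrow> u \<in> borel_measurable borel"
  by (simp add: loc_int_def)

lemma integrable_times_bounded:
  fixes f g :: "'b \<Rightarrow> real"
  assumes "integrable M f" "g \<in> borel_measurable M" "\<And>x. \<bar>g x\<bar> \<le> C"
  shows "integrable M (\<lambda>x. f x * g x)"
proof (rule Bochner_Integration.integrable_bound[where f="\<lambda>x. C * f x"])
  show "AE x in M. norm (f x * g x) \<le> norm (C * f x)"
  proof (rule AE_I2)
    fix x show "norm (f x * g x) \<le> norm (C * f x)"
      using mult_left_mono[OF order_trans[OF assms(3)[of x] abs_ge_self], of "\<bar>f x\<bar>"]
      by (simp add: abs_mult mult.commute)
  qed
qed (use assms in auto)

lemma continuous_bounded_annulus:
  assumes "continuous_on UNIV (F :: 'a::euclidean_space \<Rightarrow> real)" "\<And>x. x \<notin> annulus r R \<Longrightarrow> F x = 0"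
  shows "\<exists>C. \<forall>x. \<bar>F x\<bar> \<le> C"
proof -
  have "bounded (F ` annulus r R)"
    using assms(1) by (intro compact_imp_bounded compact_continuous_image compact_annulus)
       (auto intro: continuous_on_subset)
  then obtain B where "\<forall>x\<in>annulus r R. norm (F x) \<le> B"
    unfolding bounded_iff by auto
  then have "\<bar>F x\<bar> \<le> max 0 B" for x
    using assms(2) by (fastforce simp: le_max_iff_disj)
  then show ?thesis by blast
qed

lemma loc_int_times_bounded:
  assumes "loc_int u" "0 < r" "F \<in> borel_measurable borel" "\<And>x. x \<notin> annulus r R \<Longrightarrow> F x = 0"
    "\<And>x. \<bar>F x\<bar> \<le> C"
  shows "integrable lborel (\<lambda>x. u x * F x)"
proof -
  have "integrable lborel (\<lambda>x. (indicator (annulus r R) x * u x) * F x)"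
    using assms(1,2,3) by (intro integrable_times_bounded[OF _ _ assms(5)]) (auto simp: loc_int_def)
  moreover have "(\<lambda>x. (indicator (annulus r R) x * u x) * F x) = (\<lambda>x. u x * F x)"
    using assms(4) by (fastforce simp: indicator_def)
  ultimately show ?thesis by simp
qed

lemma loc_int_times_continuous:
  fixes u F :: "'a::euclidean_space \<Rightarrow> real"
  assumes u: "loc_int u" and F: "continuous_on UNIV F"
    and r: "0 < r" and off: "\<And>x. x \<notin> annulus r R \<Longrightarrow> F x = 0"
  shows "integrable lborel (\<lambda>x. u x * F x)"
proof -
  obtain C where C: "\<And>x. \<bar>F x\<bar> \<le> C" using continuous_bounded_annulus[OF F off] by blast
  show ?thesis
    by (rule loc_int_times_bounded[OF u r borel_measurable_continuous_onI[OF F] off C])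
qed

lemma L1_loc_annulus:
  assumes "u \<in> L1_loc (UNIV - {0})" "0 < r"
  shows "integrable lebesgue (\<lambda>x. indicator (annulus r R) x * u x)"
proof -
  have "annulus r R \<subseteq> UNIV - {0::'a}" using assms(2) by (auto simp: annulus_def)
  then have "u absolutely_integrable_on annulus r R"
    using assms(1) compact_annulus by (auto simp: L1_loc_def)
  then show ?thesis by (simp add: set_integrable_def)
qed

lemma L1_loc_measurable:
  fixes u :: "'a::euclidean_space \<Rightarrow> real"
  assumes "u \<in> L1_loc (UNIV - {0})"
  shows "u \<in> borel_measurable lebesgue"
proof -
  define v where "v = (\<lambda>x::'a. indicator (- {0}) x * u x)"
  have "v \<in> borel_measurable lebesgue"
  proof (rule borel_measurable_LIMSEQ_real)
    fix n :: nat
    show "(\<lambda>x. indicator (annulus (1 / Suc n) (Suc n)) x * u x) \<in> borel_measurable lebesgue"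
      using L1_loc_annulus[OF assms] by (intro borel_measurable_integrable) auto
  next
    fix x :: 'a
    show "(\<lambda>n. indicator (annulus (1 / Suc n) (Suc n)) x * u x) \<longlonglongrightarrow> v x"
    proof (cases "x = 0")
      case True
      then show ?thesis by (simp add: v_def annulus_def)
    next
      case False
      obtain n1 where n1: "norm x \<le> real n1" using real_arch_simple by blast
      obtain n2 where n2: "1 / norm x \<le> real n2" using real_arch_simple by blast
      have "x \<in> annulus (1 / Suc n) (Suc n)" if "n \<ge> max n1 n2" for n
      proof -
        have "1 / norm x \<le> real (Suc n)" "norm x \<le> real (Suc n)"
          using that n1 n2 by auto
        then show ?thesis using False by (auto simp: annulus_def field_simps)
      qed
      then show ?thesis
        using False
        by (intro tendsto_eventually eventually_sequentiallyI[of "max n1 n2"]) (simp add: v_def)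
    qed
  qed
  then have "(\<lambda>x. if x = 0 then u 0 else v x) \<in> borel_measurable lebesgue"
    by (intro measurable_If) auto
  moreover have "(\<lambda>x. if x = 0 then u 0 else v x) = u" by (auto simp: v_def)
  ultimately show ?thesis by simp
qed

lemma L1_loc_borel_representative:
  fixes u :: "'a::euclidean_space \<Rightarrow> real"
  assumes "u \<in> L1_loc (UNIV - {0})"
  obtains v where "loc_int v" "AE x in lborel. u x = v x"
proof -
  obtain v where v: "v \<in> borel_measurable lborel" "AE x in lborel. u x = v x"
    using completion_ex_borel_measurable_real[OF L1_loc_measurable[OF assms]] by auto
  have "integrable lborel (\<lambda>x. indicator (annulus r R) x * v x)" if "0 < r" for r R
  proof -
    have "integrable lebesgue (\<lambda>x. indicator (annulus r R) x * v x)"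
    proof (rule integrable_cong_AE_imp[OF L1_loc_annulus[OF assms that, of R]])
      show "(\<lambda>x. indicator (annulus r R) x * v x) \<in> borel_measurable lebesgue"
        using v(1) by (intro measurable_completion) auto
      show "AE x in lebesgue. indicator (annulus r R) x * u x = indicator (annulus r R) x * v x"
        using AE_completion[OF v(2)] by eventually_elim auto
    qed
    then show ?thesis
      using v(1) by (subst (asm) integrable_completion) auto
  qed
  with v show thesis by (intro that[of v]) (auto simp: loc_int_def)
qed

lemma integral_lebesgue_representative:
  fixes u v F :: "'a::euclidean_space \<Rightarrow> real"
  assumes "AE x in lborel. u x = v x" "v \<in> borel_measurable borel" "F \<in> borel_measurable borel"
    "u \<in> borel_measurable lebesgue"
  shows "(LINT x|lebesgue. u x * F x) = (LINT x|lborel. v x * F x)"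
proof -
  have F: "F \<in> borel_measurable lebesgue" using assms(3) by (intro measurable_completion) auto
  have v: "v \<in> borel_measurable lebesgue" using assms(2) by (intro measurable_completion) auto
  have "(LINT x|lebesgue. u x * F x) = (LINT x|lebesgue. v x * F x)"
    using AE_completion[OF assms(1)] F v assms(4) by (intro integral_cong_AE) auto
  also have "\<dots> = (LINT x|lborel. v x * F x)"
    using assms by (intro integral_completion) auto
  finally show ?thesis .
qed

section \<open>The fundamental lemma of the calculus of variations\<close>

text \<open>The positive and the negative part of \<open>F\<close> have densities that agree on boxes, an intersection-stable generator
of the Borel sets.\<close>

lemma AE_eq_0_if_integral_box_eq_0:
  fixes F :: "'a::euclidean_space \<Rightarrow> real"
  assumes F: "integrable lborel F" and box: "\<And>a b. (LINT x|lborel. F x * indicator (box a b) x) = 0"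
  shows "AE x in lborel. F x = 0"
proof -
  have [measurable]: "F \<in> borel_measurable borel" using F by auto
  let ?M = "density lborel (\<lambda>x. ennreal (F x))" and ?N = "density lborel (\<lambda>x. ennreal (- F x))"
  let ?E = "range (\<lambda>(a, b). box a b :: 'a set)"
  let ?B = "\<lambda>n::nat. box (- (real n *\<^sub>R One)) (real n *\<^sub>R One) :: 'a set"
  have part: "(\<integral>\<^sup>+x. ennreal (s * F x) * indicator A x \<partial>lborel) < \<infinity>" if "\<bar>s\<bar> = 1" for s and A :: "'a set"
  proof -
    have "(\<integral>\<^sup>+x. ennreal (s * F x) * indicator A x \<partial>lborel) \<le> (\<integral>\<^sup>+x. ennreal (norm (F x)) \<partial>lborel)"
      using that by (intro nn_integral_mono) (auto simp: indicator_def abs_if intro!: ennreal_leI split: if_splits)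
    also have "\<dots> < \<infinity>" using F by (simp add: integrable_iff_bounded)
    finally show ?thesis .
  qed
  have eq: "emeasure ?M (box a b) = emeasure ?N (box a b)" for a b
  proof -
    have int: "integrable lborel (\<lambda>x. F x * indicator (box a b) x)"
      using F by (intro integrable_times_bounded[where C=1]) auto
    have "(LINT x|lborel. F x * indicator (box a b) x) =
        enn2real (\<integral>\<^sup>+x. ennreal (F x * indicator (box a b) x) \<partial>lborel)
        - enn2real (\<integral>\<^sup>+x. ennreal (- (F x * indicator (box a b) x)) \<partial>lborel)"
      using int by (rule real_lebesgue_integral_def)
    moreover have "(\<integral>\<^sup>+x. ennreal (F x * indicator (box a b) x) \<partial>lborel) = emeasure ?M (box a b)"
      by (subst emeasure_density) (auto intro!: nn_integral_cong simp: indicator_def)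
    moreover have "(\<integral>\<^sup>+x. ennreal (- (F x * indicator (box a b) x)) \<partial>lborel) = emeasure ?N (box a b)"
      by (subst emeasure_density) (auto intro!: nn_integral_cong simp: indicator_def)
    moreover have "emeasure ?M (box a b) < \<infinity>" "emeasure ?N (box a b) < \<infinity>"
      using part[of 1 "box a b"] part[of "-1" "box a b"] by (simp_all add: emeasure_density)
    ultimately show ?thesis using box[of a b]
      by (metis ennreal_enn2real eq_iff_diff_eq_0 infinity_ennreal_def)
  qed
  have "?M = ?N"
  proof (rule measure_eqI_generator_eq)
    show "Int_stable ?E"
      by (auto simp: Int_stable_def box_Int_box)
    show "emeasure ?M X = emeasure ?N X" if "X \<in> ?E" for X
      using that eq by auto
    show "range ?B \<subseteq> ?E" by auto
    show "(\<Union>n. ?B n) = UNIV"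
      by (rule UN_box_eq_UNIV)
    show "emeasure ?M (?B n) \<noteq> \<infinity>" for n
      using part[of 1 "?B n"] by (simp add: emeasure_density)
  qed (auto simp: borel_eq_box)
  then have "AE x in lborel. ennreal (F x) = ennreal (- F x)"
    by (subst (asm) sigma_finite_measure.density_unique_iff[OF sigma_finite_lborel]) auto
  then show ?thesis
  proof eventually_elim
    case (elim x)
    then show ?case by (cases "F x \<ge> 0") (auto simp: ennreal_neg ennreal_eq_0_iff)
  qed
qed

lemma flat_scaled_tendsto:
  assumes "s > 0" shows "(\<lambda>n. flat (real n * s)) \<longlonglongrightarrow> 1"
proof -
  have "(\<lambda>n. exp (- (1 / (real n * s)))) \<longlonglongrightarrow> exp (- 0)"
  proof (intro tendsto_intros)
    have "(\<lambda>n. (1 / s) * (1 / real n)) \<longlonglongrightarrow> (1 / s) * 0"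
      by (intro tendsto_intros lim_1_over_n)
    then show "(\<lambda>n. 1 / (real n * s)) \<longlonglongrightarrow> 0" by (simp add: field_simps)
  qed
  moreover have "\<forall>\<^sub>F n in sequentially. exp (- (1 / (real n * s))) = flat (real n * s)"
    using eventually_gt_at_top[of 0] by eventually_elim (use assms in \<open>simp add: flat_def\<close>)
  ultimately show ?thesis by (simp add: tendsto_cong)
qed

text \<open>A cut-off \<open>\<eta>\<close>, positive exactly on an open annulus, makes \<open>f\<close> globally integrable.  The functions
\<open>flat (n * q x)\<close>, with \<open>q\<close> smooth and positive exactly on a box, converge to the indicator of the box.\<close>

lemma AE_eq_0_if_test_integral_eq_0:
  fixes f :: "'a::euclidean_space \<Rightarrow> real"
  assumes f: "loc_int f"
    and test: "\<And>\<psi>. \<psi> \<in> test_functions (UNIV - {0}) \<Longrightarrow> (LINT x|lborel. f x * \<psi> x) = 0"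
  shows "AE x in lborel. f x = 0"
proof -
  note [measurable] = loc_int_measurable[OF f]
  have *: "AE x in lborel. r < norm x \<and> norm x < R \<longrightarrow> f x = 0" if r: "0 < r" "r < R" for r R
  proof -
    define \<eta> where "\<eta> x = flat ((x \<bullet> x - r\<^sup>2) * (R\<^sup>2 - x \<bullet> x))" for x :: 'a
    have Ck\<eta>: "Ck_on UNIV k \<eta>" for k
      unfolding \<eta>_def diff_conv_add_uminus minus_mult_commute
      using Ck_on_add[OF open_UNIV Ck_on_inner_self[OF open_UNIV] Ck_on_const, of k "- r\<^sup>2"]
        Ck_on_add[OF open_UNIV Ck_on_const Ck_on_mult[OF open_UNIV Ck_on_const Ck_on_inner_self[OF open_UNIV]], of k "R\<^sup>2" "-1"]
      by (intro Ck_on_flat Ck_on_mult) auto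
    have pos: "\<eta> x > 0 \<longleftrightarrow> r < norm x \<and> norm x < R" for x
    proof -
      have sq: "r\<^sup>2 < x \<bullet> x \<longleftrightarrow> r < norm x" "x \<bullet> x < R\<^sup>2 \<longleftrightarrow> norm x < R"
        using r by (auto simp: dot_square_norm intro: power2_less_imp_less power_strict_mono)
      have "r\<^sup>2 < R\<^sup>2" using r by (intro power_strict_mono) auto
      then have "0 < (x \<bullet> x - r\<^sup>2) * (R\<^sup>2 - x \<bullet> x) \<longleftrightarrow> r\<^sup>2 < x \<bullet> x \<and> x \<bullet> x < R\<^sup>2"
        by (auto simp: zero_less_mult_iff)
      then show ?thesis by (simp add: \<eta>_def flat_pos_iff sq)
    qed
    have \<eta>01: "0 \<le> \<eta> x" "\<eta> x \<le> 1" for x by (auto simp: \<eta>_def flat_bounds)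
    have off: "\<eta> x = 0" if "x \<notin> annulus r R" for x
      using that pos[of x] \<eta>01[of x] by (auto simp: annulus_def)
    have \<eta>T: "\<eta> \<in> test_functions (UNIV - {0})"
    proof -
      have sub: "closure {x. \<eta> x \<noteq> 0} \<subseteq> annulus r R"
        using off compact_annulus by (intro closure_minimal) (auto intro: compact_imp_closed)
      moreover have "annulus r R \<subseteq> UNIV - {0::'a}" using r by (auto simp: annulus_def)
      moreover have "compact (closure {x. \<eta> x \<noteq> 0})"
        using compact_Int_closed[OF compact_annulus closed_closure, of r R "{x. \<eta> x \<noteq> 0}"] sub
        by (simp add: Int_absorb1)
      ultimately show ?thesis using Ck\<eta> by (auto simp: test_functions_def Ck_on_UNIV)
    qed
    have [measurable]: "\<eta> \<in> borel_measurable borel"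
      using test_continuous[OF \<eta>T] by (rule borel_measurable_continuous_onI)
    have int: "integrable lborel (\<lambda>x. f x * \<eta> x)"
      using off \<eta>01 r by (intro loc_int_times_bounded[OF f, where C=1 and r=r and R=R]) auto
    have "AE x in lborel. f x * \<eta> x = 0"
    proof (rule AE_eq_0_if_integral_box_eq_0[OF int])
      fix a b :: 'a
      show "(LINT x|lborel. f x * \<eta> x * indicator (box a b) x) = 0"
      proof (cases "box a b = {}")
        case False
        \<comment> \<open>For an empty box the product \<open>q\<close> below could be positive somewhere.\<close>
        then have ab: "\<And>i. i \<in> Basis \<Longrightarrow> a \<bullet> i < b \<bullet> i" by (simp add: box_ne_empty)
        define q where "q x = (\<Prod>i\<in>Basis. flat ((x \<bullet> i - a \<bullet> i) * (b \<bullet> i - x \<bullet> i)))" for x :: 'a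
        have Ckq: "Ck_on UNIV k q" for k
          unfolding q_def diff_conv_add_uminus
        proof (intro Ck_on_prod Ck_on_flat Ck_on_mult Ck_on_add Ck_on_inner Ck_on_const open_UNIV)
          fix i :: 'a
          have "Ck_on UNIV k (\<lambda>x::'a. x \<bullet> (- i))" by (rule Ck_on_inner)
          then show "Ck_on UNIV k (\<lambda>x::'a. - (x \<bullet> i))" by simp
        qed
        have q0: "0 \<le> q x" for x by (auto simp: q_def flat_bounds intro!: prod_nonneg)
        have qpos: "q x > 0 \<longleftrightarrow> x \<in> box a b" for x
        proof -
          have "q x > 0 \<longleftrightarrow> (\<forall>i\<in>Basis. flat ((x \<bullet> i - a \<bullet> i) * (b \<bullet> i - x \<bullet> i)) > 0)"
            using flat_bounds(1) unfolding q_def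
            by (metis (no_types, lifting) finite_Basis less_le prod_zero_iff prod_nonneg)
          also have "\<dots> \<longleftrightarrow> (\<forall>i\<in>Basis. a \<bullet> i < x \<bullet> i \<and> x \<bullet> i < b \<bullet> i)"
            using ab by (intro ball_cong refl) (auto simp: flat_pos_iff zero_less_mult_iff, fastforce+)
          finally show ?thesis by (simp add: mem_box)
        qed
        define w where "w n x = flat (real n * q x)" for n x
        have Ckw: "Ck_on UNIV k (w n)" for k n
          unfolding w_def by (intro Ck_on_flat Ck_on_mult Ck_on_const Ckq open_UNIV)
        have [measurable]: "w n \<in> borel_measurable borel" for n
          using Ckw[of 0 n] by (auto intro: borel_measurable_continuous_onI)
        have lim: "(\<lambda>n. w n x) \<longlonglongrightarrow> indicator (box a b) x" for x
        proof (cases "x \<in> box a b")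
          case True
          then show ?thesis using flat_scaled_tendsto[of "q x"] qpos by (auto simp: w_def)
        next
          case False
          then have "q x = 0" using qpos[of x] q0[of x] by linarith
          then show ?thesis using False by (simp add: w_def flat_def)
        qed
        have "(\<lambda>n. LINT x|lborel. f x * \<eta> x * w n x) \<longlonglongrightarrow> (LINT x|lborel. f x * \<eta> x * indicator (box a b) x)"
        proof (rule integral_dominated_convergence[where w="\<lambda>x. \<bar>f x * \<eta> x\<bar>"])
          show "AE x in lborel. (\<lambda>n. f x * \<eta> x * w n x) \<longlonglongrightarrow> f x * \<eta> x * indicator (box a b) x"
            by (intro AE_I2 tendsto_intros lim)
          show "AE x in lborel. norm (f x * \<eta> x * w n x) \<le> \<bar>f x * \<eta> x\<bar>" for n
            using flat_bounds
            by (intro AE_I2) (auto simp: abs_mult w_def intro!: mult_left_le)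
        qed (use int in auto)
        moreover have "(LINT x|lborel. f x * \<eta> x * w n x) = 0" for n
        proof -
          have "(\<lambda>x. w n x * \<eta> x) \<in> test_functions (UNIV - {0})"
            by (rule test_functions_mult[OF \<eta>T]) (rule Ck_on_subset[OF Ckw], simp)
          from test[OF this] show ?thesis by (simp add: mult_ac)
        qed
        ultimately show ?thesis by (simp add: LIMSEQ_const_iff)
      qed simp
    qed
    then show ?thesis
    proof eventually_elim
      case (elim x)
      then show ?case using pos[of x] by auto
    qed
  qed
  have "AE x in lborel. \<forall>n::nat. 1 / real (Suc n) < norm x \<and> norm x < real (Suc n) + 1 \<longrightarrow> f x = 0"
    unfolding AE_all_countable by (intro allI *) (auto simp: field_simps add_pos_nonneg)
  moreover have "AE x in lborel. x \<noteq> (0::'a)" by (rule AE_lborel_singleton)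
  ultimately show ?thesis
  proof eventually_elim
    case (elim x)
    obtain n1 where n1: "norm x \<le> real n1" using real_arch_simple by blast
    obtain n2 where n2: "1 / norm x \<le> real n2" using real_arch_simple by blast
    have "1 / norm x < real (Suc (max n1 n2))" "norm x < real (Suc (max n1 n2)) + 1"
      using n1 n2 by auto
    moreover have "norm x > 0" using elim by simp
    ultimately show ?case
      using elim(1)[rule_format, of "max n1 n2"] by (auto simp: field_simps)
  qed
qed

section \<open>Integration along dilations\<close>

lemma borel_measurable_dilation [measurable]:
  fixes f :: "'a::euclidean_space \<Rightarrow> 'b::topological_space"
  assumes "f \<in> borel_measurable borel" shows "(\<lambda>x. f (c *\<^sub>R x)) \<in> borel_measurable borel"
  using assms by measurable

lemma lborel_dilation:
  "(lborel :: 'a::euclidean_space measure) =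
     density (distr lborel borel (\<lambda>x. exp s *\<^sub>R x)) (\<lambda>_. ennreal (exp (real DIM('a) * s)))"
  using lborel_affine[of "exp s" "0 :: 'a"] by (simp add: exp_of_nat_mult ennreal_power)

lemma nn_integral_dilation:
  fixes f :: "'a::euclidean_space \<Rightarrow> ennreal"
  assumes [measurable]: "f \<in> borel_measurable borel"
  shows "(\<integral>\<^sup>+x. f (exp s *\<^sub>R x) \<partial>lborel) = ennreal (exp (- (real DIM('a) * s))) * (\<integral>\<^sup>+x. f x \<partial>lborel)"
proof -
  have "(\<integral>\<^sup>+x. f x \<partial>lborel) = ennreal (exp (real DIM('a) * s)) * (\<integral>\<^sup>+x. f (exp s *\<^sub>R x) \<partial>lborel)"
    by (subst lborel_dilation[of s]) (simp add: nn_integral_density nn_integral_distr nn_integral_cmult)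
  then show ?thesis
    by (simp add: mult.assoc[symmetric] ennreal_mult[symmetric] exp_minus)
qed

lemma integrable_dilation:
  fixes f :: "'a::euclidean_space \<Rightarrow> real"
  assumes "integrable lborel f" shows "integrable lborel (\<lambda>x. f (exp s *\<^sub>R x))"
proof -
  have [measurable]: "f \<in> borel_measurable borel" using assms by auto
  show ?thesis
    using assms nn_integral_dilation[of "\<lambda>x. ennreal (norm (f x))" s]
    by (auto simp: integrable_iff_bounded ennreal_mult_less_top)
qed

lemma integral_dilation:
  fixes f :: "'a::euclidean_space \<Rightarrow> real"
  assumes [measurable]: "f \<in> borel_measurable borel"
  shows "(LINT x|lborel. f (exp s *\<^sub>R x)) = exp (- (real DIM('a) * s)) * (LINT x|lborel. f x)"
proof -
  have "(LINT x|lborel. f x) = exp (real DIM('a) * s) * (LINT x|lborel. f (exp s *\<^sub>R x))"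
    by (subst lborel_dilation[of s]) (simp add: integral_density integral_distr)
  then show ?thesis by (simp add: exp_minus)
qed

lemma AE_dilation:
  fixes P :: "'a::euclidean_space \<Rightarrow> bool"
  assumes "AE x in lborel. P x" shows "AE x in lborel. P (exp s *\<^sub>R x)"
proof -
  obtain N where N: "{x. \<not> P x} \<subseteq> N" "emeasure lborel N = 0" "N \<in> sets borel"
    using assms by (auto elim!: AE_E)
  have "(\<integral>\<^sup>+x. indicator N (exp s *\<^sub>R x) \<partial>(lborel :: 'a measure)) = 0"
    using N nn_integral_dilation[of "indicator N" s] by simp
  then have "AE x in lborel. indicator N (exp s *\<^sub>R x) = (0::ennreal)"
    using N by (subst (asm) nn_integral_0_iff_AE) auto
  then show ?thesis by eventually_elim (use N(1) in \<open>auto simp: indicator_def split: if_splits\<close>)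
qed

text \<open>Dilation by \<open>exp t\<close>, normalized so that it preserves integrals.\<close>

definition dilate :: "real \<Rightarrow> ('a::euclidean_space \<Rightarrow> real) \<Rightarrow> 'a \<Rightarrow> real" where
  "dilate t f x = exp (real DIM('a) * t) * f (exp t *\<^sub>R x)"

lemma dilate_measurable [measurable]:
  "f \<in> borel_measurable borel \<Longrightarrow> dilate t f \<in> borel_measurable borel"
  unfolding dilate_def by measurable

lemma test_functions_dilated:
  "\<psi> \<in> test_functions (UNIV - {0}) \<Longrightarrow> dilate t \<psi> \<in> test_functions (UNIV - {0})"
  using test_functions_mult[OF test_functions_dilate[of \<psi> "exp t"], OF _ _ Ck_on_const]
  unfolding dilate_def by auto

lemma div_field_dilate:
  assumes "\<psi> \<in> test_functions \<Omega>"
  shows "div_field (dilate t \<psi>) = dilate t (div_field \<psi>)"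
proof
  fix x :: 'a
  let ?c = "exp (real DIM('a) * t)"
  have diff: "\<psi> differentiable at (exp t *\<^sub>R x)" using test_differentiable[OF assms] .
  from has_derivative_mult_right[OF has_derivative_compose[OF
      has_derivative_scaleR_right[OF has_derivative_ident] has_derivative_frechet[OF diff]], of ?c]
  have d: "(dilate t \<psi> has_derivative (\<lambda>h. ?c * frechet_derivative \<psi> (at (exp t *\<^sub>R x)) (exp t *\<^sub>R h))) (at x)"
    unfolding dilate_def .
  have "partial_deriv i (dilate t \<psi>) x = ?c * (exp t * partial_deriv i \<psi> (exp t *\<^sub>R x))" for i
    using partial_deriv_eq[OF d] linear_cmul[OF linear_frechet_derivative[OF diff]]
    by (simp add: partial_deriv_def)
  then show "div_field (dilate t \<psi>) x = dilate t (div_field \<psi>) x"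
    by (simp add: div_field_def dilate_def sum_distrib_left algebra_simps)
qed

lemma dilate_annulus:
  fixes F :: "'a::euclidean_space \<Rightarrow> real"
  assumes "\<And>x. x \<notin> annulus r R \<Longrightarrow> F x = 0" "\<bar>t\<bar> \<le> T" "0 < r" "0 < R"
    "x \<notin> annulus (exp (- T) * r) (exp T * R)"
  shows "dilate t F x = 0"
proof -
  have "exp t *\<^sub>R x \<notin> annulus r R"
  proof
    assume "exp t *\<^sub>R x \<in> annulus r R"
    then have a: "r \<le> exp t * norm x" "exp t * norm x \<le> R" by (auto simp: annulus_def)
    have "exp (- T) * r \<le> exp (- t) * r" using assms by (intro mult_right_mono) auto
    also have "\<dots> \<le> norm x" using a(1) by (simp add: exp_minus field_simps)
    finally have 1: "exp (- T) * r \<le> norm x" .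
    have "norm x \<le> exp (- t) * R" using a(2) by (simp add: exp_minus field_simps)
    also have "\<dots> \<le> exp T * R" using assms by (intro mult_right_mono) auto
    finally show False using 1 assms(5) by (auto simp: annulus_def)
  qed
  then show ?thesis using assms(1) by (simp add: dilate_def)
qed

lemma dilate_bound:
  fixes F :: "'a::euclidean_space \<Rightarrow> real"
  assumes "\<And>x. \<bar>F x\<bar> \<le> C" "\<bar>t\<bar> \<le> T"
  shows "\<bar>dilate t F x\<bar> \<le> exp (real DIM('a) * T) * C"
proof -
  have "exp (real DIM('a) * t) \<le> exp (real DIM('a) * T)"
    using assms(2) by (simp add: mult_left_mono)
  then show ?thesis
    unfolding dilate_def abs_mult using assms(1)[of "exp t *\<^sub>R x"]
    by (intro mult_mono) (simp_all del: exp_le_cancel_iff)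
qed

lemma integral_mult_dilate:
  fixes u f :: "'a::euclidean_space \<Rightarrow> real"
  assumes [measurable]: "u \<in> borel_measurable borel" "f \<in> borel_measurable borel"
  shows "(LINT x|lborel. u x * dilate (- s) f x) = (LINT y|lborel. u (exp s *\<^sub>R y) * f y)"
proof -
  have "(LINT y|lborel. u (exp s *\<^sub>R y) * f y)
      = (LINT y|lborel. (\<lambda>x. u x * f (exp (- s) *\<^sub>R x)) (exp s *\<^sub>R y))"
    by (simp add: exp_minus)
  also have "\<dots> = exp (- (real DIM('a) * s)) * (LINT x|lborel. u x * f (exp (- s) *\<^sub>R x))"
    by (rule integral_dilation) measurable
  also have "\<dots> = (LINT x|lborel. u x * dilate (- s) f x)"
    unfolding dilate_def by (subst integral_mult_right_zero[symmetric]) (simp add: mult_ac)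
  finally show ?thesis ..
qed

text \<open>Continuous functions with compact support in the punctured space that are differentiable off the origin and have
a continuous \<open>div_field\<close>.  Unlike test functions they include products of a test function with a function of the norm that is only continuously differentiable.\<close>

definition C1c :: "('a::euclidean_space \<Rightarrow> real) \<Rightarrow> bool" where
  "C1c \<psi> \<longleftrightarrow> continuous_on UNIV \<psi> \<and> continuous_on UNIV (div_field \<psi>) \<and>
     (\<forall>x. x \<noteq> 0 \<longrightarrow> \<psi> differentiable at x) \<and>
     (\<exists>r R. 0 < r \<and> 0 < R \<and> (\<forall>x. x \<notin> annulus r R \<longrightarrow> \<psi> x = 0 \<and> div_field \<psi> x = 0))"

lemma C1c_test_function:
  assumes "\<psi> \<in> test_functions (UNIV - {0})" shows "C1c \<psi>"
proof -
  obtain r R where "0 < r" "r < R"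
    "\<And>x. x \<notin> annulus r R \<Longrightarrow> \<psi> x = 0" "\<And>i x. x \<notin> annulus r R \<Longrightarrow> partial_deriv i \<psi> x = 0"
    using test_functions_annulus[OF assms] by metis
  then show ?thesis
    unfolding C1c_def
    using test_continuous[OF assms] continuous_div_field[OF assms] test_differentiable[OF assms]
    by (intro conjI allI impI exI[of _ r] exI[of _ R]) (auto simp: div_field_eq_0)
qed

text \<open>Tonelli's criterion when the integrals over the second variable are bounded, and vanish for parameters outside \<open>{0..T}\<close>.\<close>

lemma integrable_pair_slab:
  fixes k :: "real \<Rightarrow> 'a::euclidean_space \<Rightarrow> real"
  assumes [measurable]: "case_prod k \<in> borel_measurable (lborel \<Otimes>\<^sub>M lborel)"
    and k: "\<And>\<tau>. integrable lborel (k \<tau>)"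
    and bd: "\<And>\<tau>. (LINT x|lborel. \<bar>k \<tau> x\<bar>) \<le> indicator {0..T} \<tau> * B"
  shows "integrable (lborel \<Otimes>\<^sub>M lborel) (case_prod k)"
proof (rule lborel_pair.Fubini_integrable)
  show "integrable lborel (\<lambda>\<tau>. LINT x|lborel. norm (case_prod k (\<tau>, x)))"
  proof (rule Bochner_Integration.integrable_bound[where f="\<lambda>\<tau>. indicator {0..T} \<tau> * B"])
    show "AE \<tau> in lborel. norm (LINT x|lborel. norm (case_prod k (\<tau>, x))) \<le> norm (indicator {0..T} \<tau> * B)"
    proof (rule AE_I2)
      fix \<tau> :: real
      have "0 \<le> (LINT x|lborel. \<bar>k \<tau> x\<bar>)" by (intro Bochner_Integration.integral_nonneg) auto
      with bd[of \<tau>] show "norm (LINT x|lborel. norm (case_prod k (\<tau>, x))) \<le> norm (indicator {0..T} \<tau> * B)"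
        by simp
    qed
    have "integrable lborel (indicator {0..T} :: real \<Rightarrow> real)"
      by (intro integrable_real_indicator) (auto simp: emeasure_lborel_Icc_eq)
    then show "integrable lborel (\<lambda>\<tau>. indicator {0..T} \<tau> * B)"
      by (rule integrable_mult_left)
  qed measurable
qed (use k in auto)

text \<open>The fundamental theorem of calculus for \<open>t \<mapsto> dilate t \<psi>\<close>, integrated against \<open>u\<close>.\<close>

lemma integral_dilate_diff:
  fixes u \<psi> :: "'a::euclidean_space \<Rightarrow> real"
  assumes u: "loc_int u" and \<psi>: "C1c \<psi>" and T: "0 \<le> T"
  shows "(LINT x|lborel. u x * (dilate (l * T) \<psi> x - \<psi> x)) =
    l * (LINT \<tau>|lborel. indicator {0..T} \<tau> * (LINT x|lborel. u x * dilate (l * \<tau>) (div_field \<psi>) x))"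
proof -
  define D where "D = div_field \<psi>"
  note [measurable] = loc_int_measurable[OF u]
  have cont: "continuous_on UNIV D" and diff: "\<And>x. x \<noteq> 0 \<Longrightarrow> \<psi> differentiable at x"
    using \<psi> by (auto simp: C1c_def D_def)
  then have [measurable]: "D \<in> borel_measurable borel" by (auto intro: borel_measurable_continuous_onI)
  obtain r R where r: "0 < r" "0 < R" and off: "\<And>x. x \<notin> annulus r R \<Longrightarrow> D x = 0"
    using \<psi> by (auto simp: C1c_def D_def)
  obtain C where C: "\<And>x. \<bar>D x\<bar> \<le> C"  using continuous_bounded_annulus[OF cont off] by blast
  define B where "B = exp (real DIM('a) * (\<bar>l\<bar> * T)) * C"
  define r' where "r' = exp (- (\<bar>l\<bar> * T)) * r"
  define R' where "R' = exp (\<bar>l\<bar> * T) * R"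
  have r': "0 < r'" using r by (simp add: r'_def)
  have lt: "\<bar>l * \<tau>\<bar> \<le> \<bar>l\<bar> * T" if "\<tau> \<in> {0..T}" for \<tau>
    using that by (auto simp: abs_mult intro: mult_left_mono)
  have off': "dilate (l * \<tau>) D x = 0" if "\<tau> \<in> {0..T}" "x \<notin> annulus r' R'" for \<tau> x
    using dilate_annulus[OF off lt[OF that(1)] r] that(2) by (simp add: r'_def R'_def)
  have bd: "\<bar>dilate (l * \<tau>) D x\<bar> \<le> B" if "\<tau> \<in> {0..T}" for \<tau> x
    using dilate_bound[OF C lt[OF that]] by (simp add: B_def)
  have B0: "0 \<le> B" using bd[of 0] T by (meson abs_ge_zero atLeastAtMost_iff order.trans order_refl)
  define k where "k = (\<lambda>\<tau> x. indicator {0..T} \<tau> * (u x * dilate (l * \<tau>) D x))"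
  define U where "U x = indicator (annulus r' R') x * u x" for x
  have U: "integrable lborel U"
    using u r' by (auto simp: loc_int_def U_def[abs_def])
  have kU: "\<bar>k \<tau> x\<bar> \<le> indicator {0..T} \<tau> * (B * \<bar>U x\<bar>)" for \<tau> x
  proof (cases "\<tau> \<in> {0..T} \<and> x \<in> annulus r' R'")
    case True
    then have "\<bar>k \<tau> x\<bar> = \<bar>dilate (l * \<tau>) D x\<bar> * \<bar>U x\<bar>" by (simp add: k_def U_def abs_mult)
    also have "\<dots> \<le> B * \<bar>U x\<bar>" using bd True by (intro mult_right_mono) auto
    finally show ?thesis using True by simp
  next
    case False
    then have "k \<tau> x = 0" using off' by (cases "\<tau> \<in> {0..T}") (auto simp: k_def)
    then show ?thesis using B0 by simp
  qed
  have [measurable]: "(\<lambda>(\<tau>, x). k \<tau> x) \<in> borel_measurable (lborel \<Otimes>\<^sub>M lborel)"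
    unfolding k_def dilate_def by measurable
  have [measurable]: "U \<in> borel_measurable borel" using U by auto
  have kx: "integrable lborel (k \<tau>)" for \<tau>
  proof (rule Bochner_Integration.integrable_bound[where f="\<lambda>x. indicator {0..T} \<tau> * (B * \<bar>U x\<bar>)"])
    show "AE x in lborel. norm (k \<tau> x) \<le> norm (indicator {0..T} \<tau> * (B * \<bar>U x\<bar>))"
      using kU by (intro AE_I2) (metis abs_ge_self order_trans real_norm_def)
    show "k \<tau> \<in> borel_measurable lborel" unfolding k_def by measurable
  qed (use U in auto)
  have int: "integrable (lborel \<Otimes>\<^sub>M lborel) (case_prod k)"
  proof (rule integrable_pair_slab[OF _ kx])
    fix \<tau> :: real
    have "(LINT x|lborel. \<bar>k \<tau> x\<bar>) \<le> (LINT x|lborel. indicator {0..T} \<tau> * (B * \<bar>U x\<bar>))"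
      using kx U kU by (intro integral_mono) auto
    then show "(LINT x|lborel. \<bar>k \<tau> x\<bar>) \<le> indicator {0..T} \<tau> * (LINT x|lborel. B * \<bar>U x\<bar>)" by simp
  qed simp
  have "(LINT x|lborel. u x * (dilate (l * T) \<psi> x - \<psi> x)) = (LINT x|lborel. l * (LINT \<tau>|lborel. k \<tau> x))"
  proof (rule integral_cong_AE)
    have "AE x in lborel. x \<noteq> (0::'a)" by (rule AE_lborel_singleton)
    then show "AE x in lborel. u x * (dilate (l * T) \<psi> x - \<psi> x) = l * (LINT \<tau>|lborel. k \<tau> x)"
    proof eventually_elim
      case (elim x)
      have "(LINT \<tau>|lborel. (l * dilate (l * \<tau>) D x) * indicator {0..T} \<tau>) = dilate (l * T) \<psi> x - dilate (l * 0) \<psi> x"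
      proof (rule integral_FTC_Icc_real[OF T])
        fix \<tau>
        show "((\<lambda>\<tau>. dilate (l * \<tau>) \<psi> x) has_real_derivative l * dilate (l * \<tau>) D x) (at \<tau>)"
          using has_derivative_dilation[OF diff elim, of l \<tau>] by (simp add: dilate_def D_def)
        have "continuous_on UNIV (\<lambda>\<tau>. l * dilate (l * \<tau>) D x)"
          unfolding dilate_def by (intro continuous_intros continuous_on_compose2[OF cont]) auto
        then show "isCont (\<lambda>\<tau>. l * dilate (l * \<tau>) D x) \<tau>"
          by (simp add: continuous_on_eq_continuous_at)
      qed
      then have "u x * (dilate (l * T) \<psi> x - \<psi> x) = u x * (LINT \<tau>|lborel. (l * dilate (l * \<tau>) D x) * indicator {0..T} \<tau>)"
        by (simp add: dilate_def)
      also have "\<dots> = (LINT \<tau>|lborel. l * k \<tau> x)"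
        by (subst integral_mult_right_zero[symmetric]) (simp add: k_def mult_ac)
      finally show ?case by simp
    qed
    have [measurable]: "\<psi> \<in> borel_measurable borel"
      using \<psi> by (auto simp: C1c_def intro: borel_measurable_continuous_onI)
    show "(\<lambda>x. u x * (dilate (l * T) \<psi> x - \<psi> x)) \<in> borel_measurable lborel" by measurable
    show "(\<lambda>x. l * (LINT \<tau>|lborel. k \<tau> x)) \<in> borel_measurable lborel" by measurable
  qed
  also have "\<dots> = l * (LINT x|lborel. LINT \<tau>|lborel. k \<tau> x)" by simp
  also have "(LINT x|lborel. LINT \<tau>|lborel. k \<tau> x) = (LINT \<tau>|lborel. LINT x|lborel. k \<tau> x)"
    by (rule lborel_pair.Fubini_integral[OF int])
  also have "\<dots> = (LINT \<tau>|lborel. indicator {0..T} \<tau> * (LINT x|lborel. u x * dilate (l * \<tau>) D x))"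
    unfolding k_def by simp
  finally show ?thesis by (simp add: D_def)
qed

lemma loc_int_1: "loc_int (\<lambda>x. 1)"
  unfolding loc_int_def using emeasure_compact_finite[OF compact_annulus]
  by (auto intro!: integrable_real_indicator)

lemma loc_int_diff:
  assumes "loc_int u" "loc_int v" shows "loc_int (\<lambda>x. u x - v x)"
  using assms by (auto simp: loc_int_def right_diff_distrib)

lemma loc_int_cmult:
  assumes "loc_int u" shows "loc_int (\<lambda>x. c * u x)"
  unfolding loc_int_def
proof (intro conjI allI impI)
  show "(\<lambda>x. c * u x) \<in> borel_measurable borel"
    using loc_int_measurable[OF assms] by measurable
  fix r R :: real assume "0 < r"
  then have "integrable lborel (\<lambda>x. c * (indicator (annulus r R) x * u x))"
    using assms by (intro integrable_mult_right) (auto simp: loc_int_def)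
  then show "integrable lborel (\<lambda>x. indicator (annulus r R) x * (c * u x))"
    by (simp only: mult.left_commute)
qed

lemma loc_int_dilation:
  fixes u :: "'a::euclidean_space \<Rightarrow> real"
  assumes u: "loc_int u" shows "loc_int (\<lambda>x. u (exp s *\<^sub>R x))"
  unfolding loc_int_def
proof (intro conjI allI impI)
  note [measurable] = loc_int_measurable[OF u]
  show "(\<lambda>x. u (exp s *\<^sub>R x)) \<in> borel_measurable borel" by measurable
  fix r R :: real assume "0 < r"
  then have "integrable lborel (\<lambda>x. indicator (annulus (exp s * r) (exp s * R)) x * u x)"
    using u by (simp add: loc_int_def)
  from integrable_dilation[OF this, of s]
  show "integrable lborel (\<lambda>x. indicator (annulus r R) x * u (exp s *\<^sub>R x))"
    by (simp add: annulus_def indicator_def)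
qed

text \<open>A divergence theorem, obtained from dilation invariance of the integral: it is \<open>integral_dilate_diff\<close> for
the constant function \<open>1\<close>.\<close>

lemma integral_div_field_eq_0:
  fixes \<psi> :: "'a::euclidean_space \<Rightarrow> real"
  assumes \<psi>: "C1c \<psi>"
  shows "(LINT x|lborel. div_field \<psi> x) = 0"
proof -
  obtain r R where r: "0 < r" and off: "\<And>x. x \<notin> annulus r R \<Longrightarrow> \<psi> x = 0"
    using \<psi> by (auto simp: C1c_def)
  have cont: "continuous_on UNIV \<psi>" "continuous_on UNIV (div_field \<psi>)" using \<psi> by (auto simp: C1c_def)
  then have [measurable]: "\<psi> \<in> borel_measurable borel" "div_field \<psi> \<in> borel_measurable borel"
    by (auto intro: borel_measurable_continuous_onI)
  have int: "integrable lborel \<psi>"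
    using loc_int_times_continuous[OF loc_int_1 cont(1) r off] by simp
  have inv: "(LINT x|lborel. dilate t f x) = (LINT x|lborel. f x)" if "f \<in> borel_measurable borel" for t and f :: "'a \<Rightarrow> real"
    using integral_mult_dilate[of "\<lambda>x. 1" f "- t"] that by simp
  have "integrable lborel (dilate 1 \<psi>)"
    unfolding dilate_def using integrable_dilation[OF int, of 1] by simp
  then have "0 = (LINT x|lborel. 1 * (dilate (1 * 1) \<psi> x - \<psi> x))"
    using int inv[of \<psi> 1] by simp
  also have "\<dots> = (LINT \<tau>|lborel. indicator {0..1::real} \<tau> * (LINT x|lborel. div_field \<psi> x))"
    using integral_dilate_diff[OF loc_int_1 \<psi>, of 1 1] inv[of "div_field \<psi>"] by simp
  also have "\<dots> = (LINT x|lborel. div_field \<psi> x)" by simp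
  finally show ?thesis ..
qed

text \<open>The substitute for the fundamental theorem of calculus on rays: if \<open>h\<close> represents \<open>\<rho> \<partial>\<^sub>\<rho> u\<close> weakly, then the
increment of \<open>u\<close> along almost every dilation orbit is the integral of \<open>h\<close> along it.\<close>

lemma dilation_increment:
  fixes u h :: "'a::euclidean_space \<Rightarrow> real"
  assumes u: "loc_int u" and h: "loc_int h" and T: "0 \<le> T"
    and weak: "\<And>\<psi>. \<psi> \<in> test_functions (UNIV - {0}) \<Longrightarrow>
      (LINT x|lborel. u x * div_field \<psi> x) = - (LINT x|lborel. h x * \<psi> x)"
  shows "AE y in lborel. u (exp (l * T) *\<^sub>R y) - u y =
    l * (LINT \<tau>|lborel. indicator {0..T} \<tau> * h (exp (l * \<tau>) *\<^sub>R y))"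
proof -
  note [measurable] = loc_int_measurable[OF u] loc_int_measurable[OF h]
  define k where "k = (\<lambda>\<tau> y. indicator {0..T} \<tau> * h (exp (l * \<tau>) *\<^sub>R y))"
  define G where "G y = (LINT \<tau>|lborel. k \<tau> y)" for y
  have [measurable]: "(\<lambda>(\<tau>, y). k \<tau> y) \<in> borel_measurable (lborel \<Otimes>\<^sub>M lborel)"
    unfolding k_def by measurable
  have int: "integrable (lborel \<Otimes>\<^sub>M lborel) (\<lambda>(\<tau>, y). k \<tau> y * F y)"
    if [measurable]: "F \<in> borel_measurable borel" and F: "\<And>x. x \<notin> annulus r R \<Longrightarrow> F x = 0"
      "\<And>x. \<bar>F x\<bar> \<le> C" and r: "0 < r" "0 < R" for F r R C
  proof -
    define S where "S = \<bar>l\<bar> * T"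
    define H where "H = (LINT x|lborel. \<bar>indicator (annulus (exp (- S) * r) (exp S * R)) x * h x\<bar>)"
    have C0: "0 \<le> C" using F(2)[of 0] by linarith
    have Hint: "integrable lborel (\<lambda>x. indicator (annulus (exp (- S) * r) (exp S * R)) x * h x)"
      using h r by (auto simp: loc_int_def)
    have kx: "integrable lborel (\<lambda>y. k \<tau> y * F y)" for \<tau>
    proof -
      have "integrable lborel (\<lambda>y. h (exp (l * \<tau>) *\<^sub>R y) * F y)"
        using F r by (intro loc_int_times_bounded[OF loc_int_dilation[OF h]]) auto
      then show ?thesis by (simp add: k_def mult.assoc)
    qed
    have bd: "(LINT y|lborel. \<bar>k \<tau> y * F y\<bar>) \<le> indicator {0..T} \<tau> * (exp (real DIM('a) * S) * C * H)" for \<tau>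
    proof (cases "\<tau> \<in> {0..T}")
      case True
      then have lt: "\<bar>- (l * \<tau>)\<bar> \<le> S" by (auto simp: S_def abs_mult intro: mult_left_mono)
      have "(LINT y|lborel. \<bar>k \<tau> y * F y\<bar>) = (LINT y|lborel. \<bar>h (exp (l * \<tau>) *\<^sub>R y)\<bar> * \<bar>F y\<bar>)"
        using True by (simp add: k_def abs_mult)
      also have "\<dots> = (LINT x|lborel. \<bar>h x\<bar> * dilate (- (l * \<tau>)) (\<lambda>y. \<bar>F y\<bar>) x)"
        by (rule integral_mult_dilate[symmetric]) measurable
      also have "\<dots> \<le> (LINT x|lborel. (exp (real DIM('a) * S) * C) * \<bar>indicator (annulus (exp (- S) * r) (exp S * R)) x * h x\<bar>)"
      proof (rule integral_mono')
        show "integrable lborel (\<lambda>x. (exp (real DIM('a) * S) * C) * \<bar>indicator (annulus (exp (- S) * r) (exp S * R)) x * h x\<bar>)"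
          using Hint by auto
        fix x :: 'a
        show "\<bar>h x\<bar> * dilate (- (l * \<tau>)) (\<lambda>y. \<bar>F y\<bar>) x \<le> (exp (real DIM('a) * S) * C) * \<bar>indicator (annulus (exp (- S) * r) (exp S * R)) x * h x\<bar>"
        proof (cases "x \<in> annulus (exp (- S) * r) (exp S * R)")
          case True
          have "dilate (- (l * \<tau>)) (\<lambda>y. \<bar>F y\<bar>) x \<le> exp (real DIM('a) * S) * C"
            using dilate_bound[of "\<lambda>y. \<bar>F y\<bar>" C, OF _ lt, of x] F(2) by (auto intro: order_trans[OF abs_ge_self])
          from mult_left_mono[OF this, of "\<bar>h x\<bar>"] True show ?thesis by (simp add: abs_mult mult_ac)
        next
          case False
          have "dilate (- (l * \<tau>)) (\<lambda>y. \<bar>F y\<bar>) x = 0"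
            using F(1) by (intro dilate_annulus[OF _ lt r False]) auto
          then show ?thesis using C0 by simp
        qed
        show "0 \<le> (exp (real DIM('a) * S) * C) * \<bar>indicator (annulus (exp (- S) * r) (exp S * R)) x * h x\<bar>"
          using C0 by simp
      qed
      finally show ?thesis using True by (simp add: H_def)
    qed (simp add: k_def)
    show ?thesis by (rule integrable_pair_slab[OF _ kx bd]) measurable
  qed
  have G: "loc_int G"
    unfolding loc_int_def
  proof (intro conjI allI impI)
    show "G \<in> borel_measurable borel" unfolding G_def by measurable
    fix r R :: real assume r: "0 < r"
    have "integrable (lborel \<Otimes>\<^sub>M lborel) (\<lambda>(\<tau>, y). k \<tau> y * indicator (annulus r (max r R)) y)"
      using r by (intro int[where C=1 and r=r and R="max r R"]) auto
    from lborel_pair.integrable_snd[OF this]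
    have "integrable lborel (\<lambda>y. G y * indicator (annulus r (max r R)) y)"
      by (simp add: G_def)
    from integrable_times_bounded[OF this, of "indicator (annulus r R)" 1]
    have "integrable lborel (\<lambda>y. G y * indicator (annulus r (max r R)) y * indicator (annulus r R) y)" by auto
    moreover have "indicator (annulus r (max r R)) y * indicator (annulus r R) y = (indicator (annulus r R) y :: real)" for y :: 'a
      by (auto simp: indicator_def annulus_def)
    ultimately have "integrable lborel (\<lambda>y. G y * indicator (annulus r R) y)"
      by (simp only: mult.assoc)
    then show "integrable lborel (\<lambda>y. indicator (annulus r R) y * G y)"
      by (simp add: mult.commute)
  qed
  define f where "f y = u (exp (l * T) *\<^sub>R y) - u y - l * G y" for y
  have f: "loc_int f"
    unfolding f_def[abs_def] by (intro loc_int_diff loc_int_cmult loc_int_dilation u G)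
  have "AE y in lborel. f y = 0"
  proof (rule AE_eq_0_if_test_integral_eq_0[OF f])
    fix \<psi> :: "'a \<Rightarrow> real" assume \<psi>: "\<psi> \<in> test_functions (UNIV - {0})"
    obtain r R where r: "0 < r" "r < R" and off: "\<And>x. x \<notin> annulus r R \<Longrightarrow> \<psi> x = 0"
      using test_functions_annulus[OF \<psi>] by metis
    obtain C where C: "\<And>x. \<bar>\<psi> x\<bar> \<le> C"  using continuous_bounded_annulus[OF test_continuous[OF \<psi>] off] by blast
    have [measurable]: "\<psi> \<in> borel_measurable borel"
      using test_continuous[OF \<psi>] by (rule borel_measurable_continuous_onI)
    have i: "integrable lborel (\<lambda>y. v y * \<psi> y)" if "loc_int v" for v
      by (rule loc_int_times_continuous[OF that test_continuous[OF \<psi>] r(1) off])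
    have i': "integrable lborel (\<lambda>x. u x * dilate (- (l * T)) \<psi> x)"
    proof (rule loc_int_times_bounded[OF u, where r="exp (- \<bar>l * T\<bar>) * r"
          and R="exp \<bar>l * T\<bar> * R" and C="exp (real DIM('a) * \<bar>l * T\<bar>) * C"])
      fix x :: 'a
      show "dilate (- (l * T)) \<psi> x = 0" if "x \<notin> annulus (exp (- \<bar>l * T\<bar>) * r) (exp \<bar>l * T\<bar> * R)"
        by (rule dilate_annulus[OF off _ _ _ that]) (use r in auto)
      show "\<bar>dilate (- (l * T)) \<psi> x\<bar> \<le> exp (real DIM('a) * \<bar>l * T\<bar>) * C"
        by (rule dilate_bound[OF C]) simp
    qed (use r in auto)
    have "(LINT y|lborel. (u (exp (l * T) *\<^sub>R y) - u y) * \<psi> y)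
        = (LINT x|lborel. u x * (dilate (- l * T) \<psi> x - \<psi> x))"
      using i[OF u] i[OF loc_int_dilation[OF u]] i' integral_mult_dilate[of u \<psi> "l * T"]
      by (simp add: left_diff_distrib right_diff_distrib)
    also have "\<dots> = - l * (LINT \<tau>|lborel. indicator {0..T} \<tau> * (LINT x|lborel. u x * dilate (- l * \<tau>) (div_field \<psi>) x))"
      by (rule integral_dilate_diff[OF u C1c_test_function[OF \<psi>] T])
    \<comment> \<open>Dilates of \<open>\<psi>\<close> are test functions, and dilation commutes with \<open>div_field\<close>.\<close>
    also have "\<dots> = l * (LINT \<tau>|lborel. indicator {0..T} \<tau> * (LINT x|lborel. h x * dilate (- (l * \<tau>)) \<psi> x))"
      using weak[OF test_functions_dilated[OF \<psi>]] by (simp add: div_field_dilate[OF \<psi>, symmetric])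
    also have "\<dots> = l * (LINT \<tau>|lborel. LINT y|lborel. k \<tau> y * \<psi> y)"
      by (simp add: integral_mult_dilate k_def mult.assoc)
    also have "(LINT \<tau>|lborel. LINT y|lborel. k \<tau> y * \<psi> y) = (LINT y|lborel. LINT \<tau>|lborel. k \<tau> y * \<psi> y)"
      using int[OF _ off C] r by (intro lborel_pair.Fubini_integral[symmetric]) auto
    also have "\<dots> = (LINT y|lborel. G y * \<psi> y)" by (simp add: G_def)
    finally have "(LINT y|lborel. (u (exp (l * T) *\<^sub>R y) - u y) * \<psi> y) = l * (LINT y|lborel. G y * \<psi> y)" .
    moreover have "integrable lborel (\<lambda>y. (u (exp (l * T) *\<^sub>R y) - u y) * \<psi> y)"
      using i[OF u] i[OF loc_int_dilation[OF u]] by (simp add: left_diff_distrib)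
    ultimately show "(LINT y|lborel. f y * \<psi> y) = 0"
      using i[OF G] by (simp add: f_def left_diff_distrib[of "u _ - u _"] mult.assoc)
  qed
  then show ?thesis by eventually_elim (simp add: f_def G_def k_def)
qed

section \<open>The distributional radial derivative\<close>

lemma L1_loc_integrable_times:
  fixes u F :: "'a::euclidean_space \<Rightarrow> real"
  assumes u: "u \<in> L1_loc (UNIV - {0})" and F: "continuous_on UNIV F"
    and r: "0 < r" and off: "\<And>x. x \<notin> annulus r R \<Longrightarrow> F x = 0"
  shows "integrable lebesgue (\<lambda>x. u x * F x)"
proof -
  obtain C where C: "\<And>x. \<bar>F x\<bar> \<le> C" using continuous_bounded_annulus[OF F off] by blast
  have "F \<in> borel_measurable lebesgue"
    using borel_measurable_continuous_onI[OF F] by (intro measurable_completion) auto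
  then have "integrable lebesgue (\<lambda>x. (indicator (annulus r R) x * u x) * F x)"
    by (intro integrable_times_bounded[OF L1_loc_annulus[OF u r] _ C])
  moreover have "(\<lambda>x. (indicator (annulus r R) x * u x) * F x) = (\<lambda>x. u x * F x)"
    using off by (fastforce simp: indicator_def)
  ultimately show ?thesis by simp
qed

text \<open>The factor \<open>norm x\<close> in the test function cancels the denominator in \<open>x / \<bar>x\<bar>\<close>.\<close>

lemma distr_radial_norm_mult:
  fixes u \<psi> :: "'a::euclidean_space \<Rightarrow> real"
  assumes u: "u \<in> L1_loc (UNIV - {0})" and \<psi>: "\<psi> \<in> test_functions (UNIV - {0})"
  shows "distr_radial (distr_of u) (\<lambda>x. norm x * \<psi> x) = - (LINT x|lebesgue. u x * div_field \<psi> x)"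
proof -
  obtain r R where r: "0 < r" and off: "\<And>x. x \<notin> annulus r R \<Longrightarrow> \<psi> x = 0"
    "\<And>i x. x \<notin> annulus r R \<Longrightarrow> partial_deriv i \<psi> x = 0"
    using test_functions_annulus[OF \<psi>] by metis
  have eq: "(\<lambda>x. (x \<bullet> i) / norm x * (norm x * \<psi> x)) = (\<lambda>x. (x \<bullet> i) * \<psi> x)" for i
    by (auto simp: fun_eq_iff)
  have pd: "partial_deriv i (\<lambda>x. (x \<bullet> i) * \<psi> x) x = (x \<bullet> i) * partial_deriv i \<psi> x + \<psi> x" if "i \<in> Basis" for i x
  proof -
    have "((\<lambda>x. (x \<bullet> i) * \<psi> x) has_derivative
        (\<lambda>h. (x \<bullet> i) * frechet_derivative \<psi> (at x) h + (h \<bullet> i) * \<psi> x)) (at x)"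
      by (intro has_derivative_mult has_derivative_inner_left has_derivative_ident
          has_derivative_frechet test_differentiable[OF \<psi>])
    from partial_deriv_eq[OF this, of i] that show ?thesis by (simp add: partial_deriv_def)
  qed
  have int: "integrable lebesgue (\<lambda>x. u x * ((x \<bullet> i) * partial_deriv i \<psi> x + \<psi> x))" if "i \<in> Basis" for i
    by (rule L1_loc_integrable_times[where R=R, OF u _ r])
       (use that off in \<open>auto intro!: continuous_intros test_continuous[OF \<psi>] test_continuous_partial[OF \<psi>]\<close>)
  have "distr_radial (distr_of u) (\<lambda>x. norm x * \<psi> x)
      = (\<Sum>i\<in>Basis. - (LINT x|lebesgue. u x * ((x \<bullet> i) * partial_deriv i \<psi> x + \<psi> x)))"
    unfolding distr_radial_def distr_mult_def distr_partial_def distr_of_def eq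
    by (intro sum.cong refl) (simp add: pd)
  also have "\<dots> = - (LINT x|lebesgue. (\<Sum>i\<in>Basis. u x * ((x \<bullet> i) * partial_deriv i \<psi> x + \<psi> x)))"
    by (subst Bochner_Integration.integral_sum[OF int]) (auto simp: sum_negf)
  also have "(\<lambda>x. \<Sum>i\<in>Basis. u x * ((x \<bullet> i) * partial_deriv i \<psi> x + \<psi> x)) = (\<lambda>x. u x * div_field \<psi> x)"
    by (auto simp: fun_eq_iff div_field_def sum_distrib_left[symmetric] sum.distrib)
  finally show ?thesis .
qed

text \<open>Multiplication by \<open>norm x\<close> permutes the test functions on the punctured space.\<close>

lemma has_radial_deriv_iff:
  fixes u g :: "'a::euclidean_space \<Rightarrow> real"
  assumes u: "u \<in> L1_loc (UNIV - {0})"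
  shows "has_radial_deriv u g \<longleftrightarrow> g \<in> L1_loc (UNIV - {0}) \<and>
    (\<forall>\<psi>\<in>test_functions (UNIV - {0}).
       (LINT x|lebesgue. u x * div_field \<psi> x) = - (LINT x|lebesgue. g x * (norm x * \<psi> x)))" (is "_ \<longleftrightarrow> ?R")
proof -
  have up: "(\<lambda>x. norm x * \<psi> x) \<in> test_functions (UNIV - {0})"
    if "\<psi> \<in> test_functions (UNIV - {0})" for \<psi> :: "'a \<Rightarrow> real"
    using test_functions_mult[OF that Ck_on_norm_powr[of _ 1]] by simp
  have down: "\<exists>\<psi>\<in>test_functions (UNIV - {0}). \<phi> = (\<lambda>x. norm x * \<psi> x)"
    if "\<phi> \<in> test_functions (UNIV - {0})" for \<phi> :: "'a \<Rightarrow> real"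
  proof (rule bexI)
    have "\<phi> 0 = 0"
      using that closure_subset[of "{x. \<phi> x \<noteq> 0}"] by (auto simp: test_functions_def)
    \<comment> \<open>At the origin both sides vanish; \<open>0 powr - 1\<close> is \<open>0\<close>.\<close>
    then show "\<phi> = (\<lambda>x. norm x * (norm x powr - 1 * \<phi> x))"
      by (auto simp: fun_eq_iff powr_minus field_simps)
    show "(\<lambda>x. norm x powr - 1 * \<phi> x) \<in> test_functions (UNIV - {0})"
      using test_functions_mult[OF that Ck_on_norm_powr] .
  qed
  show ?thesis
  proof
    assume L: "has_radial_deriv u g"
    show ?R
    proof (intro conjI ballI)
      fix \<psi> :: "'a \<Rightarrow> real" assume \<psi>: "\<psi> \<in> test_functions (UNIV - {0})"
      then have "distr_radial (distr_of u) (\<lambda>x. norm x * \<psi> x) = distr_of g (\<lambda>x. norm x * \<psi> x)"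
        using L up by (simp add: has_radial_deriv_def)
      then show "(LINT x|lebesgue. u x * div_field \<psi> x) = - (LINT x|lebesgue. g x * (norm x * \<psi> x))"
        by (simp add: distr_radial_norm_mult[OF u \<psi>] distr_of_def[of g])
    qed (use L in \<open>simp add: has_radial_deriv_def\<close>)
  next
    assume R: ?R
    have "distr_radial (distr_of u) \<phi> = distr_of g \<phi>" if \<phi>: "\<phi> \<in> test_functions (UNIV - {0})" for \<phi>
    proof -
      obtain \<psi> where \<psi>: "\<psi> \<in> test_functions (UNIV - {0})" "\<phi> = (\<lambda>x. norm x * \<psi> x)"
        using down[OF \<phi>] by blast
      then show ?thesis
        using R by (simp add: distr_radial_norm_mult[OF u \<psi>(1)] distr_of_def[of g])
    qed
    with R show "has_radial_deriv u g" by (simp add: has_radial_deriv_def)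
  qed
qed

lemma loc_int_norm_mult:
  fixes k :: "'a::euclidean_space \<Rightarrow> real"
  assumes k: "loc_int k" shows "loc_int (\<lambda>x. norm x * k x)"
  unfolding loc_int_def
proof (intro conjI allI impI)
  show "(\<lambda>x. norm x * k x) \<in> borel_measurable borel"
    using loc_int_measurable[OF k] by measurable
  fix r R :: real assume r: "0 < r"
  have "integrable lborel (\<lambda>x. k x * (indicator (annulus r R) x * norm x))"
    by (rule loc_int_times_bounded[OF k r, where C="\<bar>R\<bar>"]) (auto simp: indicator_def annulus_def)
  then show "integrable lborel (\<lambda>x. indicator (annulus r R) x * (norm x * k x))"
    by (simp add: mult_ac)
qed

lemma has_radial_deriv_representative:
  fixes u g :: "'a::euclidean_space \<Rightarrow> real"
  assumes u: "u \<in> L1_loc (UNIV - {0})" and ug: "has_radial_deriv u g"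
    and v: "loc_int v" "AE x in lborel. u x = v x" and k: "loc_int k" "AE x in lborel. g x = k x"
    and \<psi>: "\<psi> \<in> test_functions (UNIV - {0})"
  shows "(LINT x|lborel. v x * div_field \<psi> x) = - (LINT x|lborel. (norm x * k x) * \<psi> x)"
proof -
  have g: "g \<in> L1_loc (UNIV - {0})" using ug by (simp add: has_radial_deriv_def)
  have [measurable]: "\<psi> \<in> borel_measurable borel" "div_field \<psi> \<in> borel_measurable borel"
    using test_continuous[OF \<psi>] continuous_div_field[OF \<psi>]
    by (auto intro: borel_measurable_continuous_onI)
  have "(LINT x|lborel. v x * div_field \<psi> x) = (LINT x|lebesgue. u x * div_field \<psi> x)"
    using v u by (intro integral_lebesgue_representative[symmetric]) (auto simp: L1_loc_measurable loc_int_def)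
  also have "\<dots> = - (LINT x|lebesgue. g x * (norm x * \<psi> x))"
    using ug \<psi> by (simp add: has_radial_deriv_iff[OF u])
  also have "(LINT x|lebesgue. g x * (norm x * \<psi> x)) = (LINT x|lborel. k x * (norm x * \<psi> x))"
    using k g by (intro integral_lebesgue_representative) (auto simp: L1_loc_measurable loc_int_def)
  finally show ?thesis by (simp add: mult_ac)
qed

lemma has_radial_deriv_unique:
  fixes u g1 g2 :: "'a::euclidean_space \<Rightarrow> real"
  assumes u: "u \<in> L1_loc (UNIV - {0})" and g: "has_radial_deriv u g1" "has_radial_deriv u g2"
  shows "AE x in lborel. g1 x = g2 x"
proof -
  have L: "g1 \<in> L1_loc (UNIV - {0})" "g2 \<in> L1_loc (UNIV - {0})"
    using g by (auto simp: has_radial_deriv_def)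
  obtain v where v: "loc_int v" "AE x in lborel. u x = v x" by (rule L1_loc_borel_representative[OF u])
  obtain k1 where k1: "loc_int k1" "AE x in lborel. g1 x = k1 x" by (rule L1_loc_borel_representative[OF L(1)])
  obtain k2 where k2: "loc_int k2" "AE x in lborel. g2 x = k2 x" by (rule L1_loc_borel_representative[OF L(2)])
  have "AE x in lborel. norm x * k1 x - norm x * k2 x = 0"
  proof (rule AE_eq_0_if_test_integral_eq_0)
    show "loc_int (\<lambda>x. norm x * k1 x - norm x * k2 x)"
      by (intro loc_int_diff loc_int_norm_mult k1 k2)
    fix \<psi> :: "'a \<Rightarrow> real" assume \<psi>: "\<psi> \<in> test_functions (UNIV - {0})"
    obtain r R where r: "0 < r" and off: "\<And>x. x \<notin> annulus r R \<Longrightarrow> \<psi> x = 0"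
      using test_functions_annulus[OF \<psi>] by metis
    have i: "integrable lborel (\<lambda>x. (norm x * k x) * \<psi> x)" if "loc_int k" for k
      by (rule loc_int_times_continuous[OF loc_int_norm_mult[OF that] test_continuous[OF \<psi>] r off])
    have "(LINT x|lborel. (norm x * k1 x) * \<psi> x) = (LINT x|lborel. (norm x * k2 x) * \<psi> x)"
      using has_radial_deriv_representative[OF u g(1) v k1 \<psi>]
        has_radial_deriv_representative[OF u g(2) v k2 \<psi>] by simp
    then show "(LINT x|lborel. (norm x * k1 x - norm x * k2 x) * \<psi> x) = 0"
      using i[OF k1(1)] i[OF k2(1)] by (simp add: left_diff_distrib)
  qed
  with k1(2) k2(2) AE_lborel_singleton[of "0::'a"] show ?thesis
    by eventually_elim (auto simp: right_diff_distrib[symmetric])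
qed

lemma ennreal_abs_integral_le:
  fixes f :: "'b \<Rightarrow> real"
  shows "ennreal \<bar>LINT x|M. f x\<bar> \<le> (\<integral>\<^sup>+x. ennreal \<bar>f x\<bar> \<partial>M)"
proof (cases "integrable M f")
  case True
  then show ?thesis using integral_norm_bound_ennreal[OF True] by simp
qed (simp add: not_integrable_integral_eq)

text \<open>The integral of \<open>\<bar>a\<bar> * norm x * \<bar>k x\<bar>\<close> along the orbit of \<open>y\<close> up to time \<open>n\<close>.  It is taken in the extended
nonnegative reals, so that no integrability of \<open>k\<close> along orbits is required.\<close>

abbreviation orbit_variation :: "real \<Rightarrow> ('a::euclidean_space \<Rightarrow> real) \<Rightarrow> nat \<Rightarrow> 'a \<Rightarrow> ennreal" where
  "orbit_variation a k n y \<equiv> \<integral>\<^sup>+\<tau>. indicator {0..real n} \<tau> *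
     ennreal (\<bar>a\<bar> * (norm (exp (a * \<tau>) *\<^sub>R y) * \<bar>k (exp (a * \<tau>) *\<^sub>R y)\<bar>)) \<partial>lborel"

lemma radial_growth_bound:
  fixes u g v k :: "'a::euclidean_space \<Rightarrow> real"
  assumes u: "u \<in> L1_loc (UNIV - {0})" and ug: "has_radial_deriv u g"
    and v: "loc_int v" "AE x in lborel. u x = v x" and k: "loc_int k" "AE x in lborel. g x = k x"
  shows "AE y in lborel. \<forall>n::nat. ennreal \<bar>v y\<bar> \<le> ennreal \<bar>v (exp (a * real n) *\<^sub>R y)\<bar> +
    orbit_variation a k n y"
  unfolding AE_all_countable
proof
  fix n :: nat
  have "AE y in lborel. v (exp (a * real n) *\<^sub>R y) - v y =
    a * (LINT \<tau>|lborel. indicator {0..real n} \<tau> * (norm (exp (a * \<tau>) *\<^sub>R y) * k (exp (a * \<tau>) *\<^sub>R y)))"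
    by (rule dilation_increment[OF v(1) loc_int_norm_mult[OF k(1)]])
       (use has_radial_deriv_representative[OF u ug v k] in auto)
  then show "AE y in lborel. ennreal \<bar>v y\<bar> \<le> ennreal \<bar>v (exp (a * real n) *\<^sub>R y)\<bar> +
    orbit_variation a k n y"
  proof eventually_elim
    case (elim y)
    let ?f = "\<lambda>\<tau>. a * (indicator {0..real n} \<tau> * (norm (exp (a * \<tau>) *\<^sub>R y) * k (exp (a * \<tau>) *\<^sub>R y)))"
    have "v (exp (a * real n) *\<^sub>R y) - v y = (LINT \<tau>|lborel. ?f \<tau>)"
      using elim by simp
    then have "\<bar>v y\<bar> \<le> \<bar>v (exp (a * real n) *\<^sub>R y)\<bar> + \<bar>LINT \<tau>|lborel. ?f \<tau>\<bar>" by linarith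
    then have "ennreal \<bar>v y\<bar> \<le> ennreal \<bar>v (exp (a * real n) *\<^sub>R y)\<bar> + ennreal \<bar>LINT \<tau>|lborel. ?f \<tau>\<bar>"
      by (simp add: ennreal_plus[symmetric] ennreal_leI del: ennreal_plus)
    also have "ennreal \<bar>LINT \<tau>|lborel. ?f \<tau>\<bar> \<le> (\<integral>\<^sup>+\<tau>. ennreal \<bar>?f \<tau>\<bar> \<partial>lborel)"
      by (rule ennreal_abs_integral_le)
    also have "(\<integral>\<^sup>+\<tau>. ennreal \<bar>?f \<tau>\<bar> \<partial>lborel) = orbit_variation a k n y"
      by (intro nn_integral_cong) (auto simp: indicator_def abs_mult)
    finally show ?case by (simp add: add_left_mono)
  qed
qed

section \<open>Radial derivatives of radial functions\<close>

lemma continuous_on_UNIV_annulus: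
  fixes f :: "'a::euclidean_space \<Rightarrow> real"
  assumes "continuous_on (UNIV - {0}) f" "0 < r" "\<And>x. x \<notin> annulus r R \<Longrightarrow> f x = 0"
  shows "continuous_on UNIV f"
proof -
  have "continuous_on (ball 0 r) f \<longleftrightarrow> continuous_on (ball 0 r) (\<lambda>x::'a. 0 :: real)"
    using assms(3) by (intro continuous_on_cong) (auto simp: annulus_def)
  then have "continuous_on (ball 0 r) f" by simp
  then have "continuous_on ((UNIV - {0}) \<union> ball 0 r) f"
    using assms(1) by (intro continuous_on_open_Un) (auto simp: open_delete)
  moreover have "(UNIV - {0}) \<union> ball 0 r = (UNIV :: 'a set)" using assms(2) by auto
  ultimately show ?thesis by simp
qed

lemma L1_loc_continuous:
  fixes f :: "'a::euclidean_space \<Rightarrow> real"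
  assumes "continuous_on \<Omega> f" shows "f \<in> L1_loc \<Omega>"
  unfolding L1_loc_def
proof (intro CollectI allI impI)
  fix K assume K: "compact K \<and> K \<subseteq> \<Omega>"
  then have "integrable lborel (\<lambda>x. indicator K x *\<^sub>R f x)"
    using assms by (intro borel_integrable_compact) (auto intro: continuous_on_subset)
  then show "f absolutely_integrable_on K"
    unfolding set_integrable_def by (subst integrable_completion) auto
qed

text \<open>If \<open>\<psi>\<close> is a test function, \<open>\<Phi> x = F (norm x) * \<psi> x\<close> satisfies
\<open>div_field \<Phi> x = F (norm x) * div_field \<psi> x + norm x * F' (norm x) * \<psi> x\<close>, and \<open>div_field \<Phi>\<close> integrates to zero.\<close>

lemma has_radial_deriv_radial:
  fixes F F' :: "real \<Rightarrow> real"
  assumes D: "\<And>t. 0 < t \<Longrightarrow> (F has_real_derivative F' t) (at t)" and F': "continuous_on {0<..} F'"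
  shows "(\<lambda>x::'a::euclidean_space. F (norm x)) \<in> L1_loc (UNIV - {0})"
    and "has_radial_deriv (\<lambda>x::'a. F (norm x)) (\<lambda>x. F' (norm x))"
proof -
  have F: "continuous_on {0<..} F"
    using D by (meson DERIV_continuous continuous_at_imp_continuous_on greaterThan_iff)
  have cF: "continuous_on (UNIV - {0}) (\<lambda>x::'a. F (norm x))"
    by (rule continuous_on_compose2[OF F]) (auto intro: continuous_intros)
  have cF': "continuous_on (UNIV - {0}) (\<lambda>x::'a. F' (norm x))"
    by (rule continuous_on_compose2[OF F']) (auto intro: continuous_intros)
  show u: "(\<lambda>x::'a. F (norm x)) \<in> L1_loc (UNIV - {0})" using L1_loc_continuous[OF cF] .
  have g: "(\<lambda>x::'a. F' (norm x)) \<in> L1_loc (UNIV - {0})" using L1_loc_continuous[OF cF'] .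
  show "has_radial_deriv (\<lambda>x::'a. F (norm x)) (\<lambda>x. F' (norm x))"
    unfolding has_radial_deriv_iff[OF u]
  proof (intro conjI ballI g)
    fix \<psi> :: "'a \<Rightarrow> real" assume \<psi>: "\<psi> \<in> test_functions (UNIV - {0})"
    obtain r R where r: "0 < r" "r < R" and off: "\<And>x. x \<notin> annulus r R \<Longrightarrow> \<psi> x = 0"
      "\<And>i x. x \<notin> annulus r R \<Longrightarrow> partial_deriv i \<psi> x = 0"
      using test_functions_annulus[OF \<psi>] by metis
    have off': "div_field \<psi> x = 0" if "x \<notin> annulus r R" for x using off[OF that] by (intro div_field_eq_0)
    define \<Phi> where "\<Phi> x = F (norm x) * \<psi> x" for x
    define G where "G x = F (norm x) * div_field \<psi> x + F' (norm x) * (norm x * \<psi> x)" for x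
    have d: "(\<Phi> has_derivative (\<lambda>h. F (norm x) * frechet_derivative \<psi> (at x) h + (F' (norm x) * (h \<bullet> sgn x)) * \<psi> x)) (at x)"
      if "x \<noteq> 0" for x
    proof -
      have "((\<lambda>x. F (norm x)) has_derivative (\<lambda>h. F' (norm x) * (h \<bullet> sgn x))) (at x)"
        using has_derivative_compose[OF has_derivative_norm[OF that] D[unfolded has_field_derivative_def]] that
        by (simp add: inner_commute)
      from has_derivative_mult[OF this has_derivative_frechet[OF test_differentiable[OF \<psi>]]]
      show ?thesis unfolding \<Phi>_def .
    qed
    have div: "div_field \<Phi> x = G x" for x
    proof (cases "x = 0")
      case False
      have diff: "\<Phi> differentiable at x" using d[OF False] by (auto simp: differentiable_def)
      have "div_field \<Phi> x = frechet_derivative \<Phi> (at x) x + real DIM('a) * \<Phi> x"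
        by (simp add: div_field_def frechet_derivative_radial[OF diff])
      also have "frechet_derivative \<Phi> (at x) x = F (norm x) * frechet_derivative \<psi> (at x) x + (F' (norm x) * (x \<bullet> sgn x)) * \<psi> x"
        using frechet_derivative_at[OF d[OF False]] by metis
      also have "x \<bullet> sgn x = norm x"
        using False by (simp add: sgn_div_norm dot_square_norm power2_eq_square)
      finally show ?thesis
        by (simp add: G_def \<Phi>_def[of x] div_field_def frechet_derivative_radial[OF test_differentiable[OF \<psi>]] algebra_simps)
    next
      case True
      then have 0: "0 \<notin> annulus r R" using r by (simp add: annulus_def)
      have "((\<lambda>x. 0) has_derivative (\<lambda>h. 0)) (at (0::'a))" by simp
      then have "(\<Phi> has_derivative (\<lambda>h. 0)) (at 0)"
        by (rule has_derivative_transform_within_open[OF _ open_ball[of 0 r]])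
           (use r off in \<open>auto simp: \<Phi>_def annulus_def\<close>)
      then have "partial_deriv i \<Phi> 0 = 0" for i by (simp add: partial_deriv_eq)
      then show ?thesis using True off[OF 0] off'[OF 0] by (simp add: div_field_def \<Phi>_def G_def)
    qed
    have cG1: "continuous_on UNIV (\<lambda>x. F (norm x) * div_field \<psi> x)"
      by (rule continuous_on_UNIV_annulus[where R=R, OF _ r(1)])
         (use off' in \<open>auto intro!: continuous_intros cF continuous_on_subset[OF continuous_div_field[OF \<psi>]]\<close>)
    have cG2: "continuous_on UNIV (\<lambda>x. F' (norm x) * (norm x * \<psi> x))"
      by (rule continuous_on_UNIV_annulus[where R=R, OF _ r(1)])
         (use off in \<open>auto intro!: continuous_intros cF' continuous_on_subset[OF test_continuous[OF \<psi>]]\<close>)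
    have c\<Phi>: "continuous_on UNIV \<Phi>"
      unfolding \<Phi>_def by (rule continuous_on_UNIV_annulus[where R=R, OF _ r(1)])
         (use off in \<open>auto intro!: continuous_intros cF continuous_on_subset[OF test_continuous[OF \<psi>]]\<close>)
    have "C1c \<Phi>"
      unfolding C1c_def
    proof (intro conjI allI impI exI)
      show "continuous_on UNIV (div_field \<Phi>)"
        using continuous_on_add[OF cG1 cG2] by (simp add: div[abs_def] G_def[abs_def] cong: continuous_on_cong)
      show "\<Phi> differentiable at x" if "x \<noteq> 0" for x using d[OF that] by (auto simp: differentiable_def)
      fix x :: 'a assume "x \<notin> annulus r R"
      then show "\<Phi> x = 0" "div_field \<Phi> x = 0" using off off' by (auto simp: div G_def \<Phi>_def)
    qed (use r c\<Phi> in auto)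
    from integral_div_field_eq_0[OF this]
    have "(LINT x|lborel. G x) = 0" by (simp add: div)
    moreover have "integrable lborel (\<lambda>x. F (norm x) * div_field \<psi> x)"
      "integrable lborel (\<lambda>x. F' (norm x) * (norm x * \<psi> x))"
      using loc_int_times_continuous[OF loc_int_1 cG1 r(1), of R]
        loc_int_times_continuous[OF loc_int_1 cG2 r(1), of R] off off' by auto
    ultimately have "(LINT x|lborel. F (norm x) * div_field \<psi> x) = - (LINT x|lborel. F' (norm x) * (norm x * \<psi> x))"
      unfolding G_def by simp
    then show "(LINT x|lebesgue. F (norm x) * div_field \<psi> x) = - (LINT x|lebesgue. F' (norm x) * (norm x * \<psi> x))"
      using cG1 cG2 by (simp add: integral_completion borel_measurable_continuous_onI)
  qed
qed

section \<open>A Hardy inequality for integrals along dilation orbits\<close>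

lemma Young_powr:
  fixes x F p :: real
  assumes "0 \<le> x" "0 \<le> F" "1 \<le> p"
  shows "p * F powr (p - 1) * x \<le> x powr p + (p - 1) * F powr p"
proof (cases "x = 0 \<or> F = 0")
  case False
  then have pos: "0 < x" "0 < F" using assms by auto
  have "(x powr p) powr (1 / p) * (F powr p) powr (1 - 1 / p) \<le> 1 / p * x powr p + (1 - 1 / p) * F powr p"
    using assms pos by (intro Youngs_inequality_0) auto
  also have "(x powr p) powr (1 / p) = x" using assms pos by (simp add: powr_powr)
  also have "(F powr p) powr (1 - 1 / p) = F powr (p - 1)"
  proof -
    have "p * (1 - 1 / p) = p - 1" using assms by (simp add: field_simps)
    then show ?thesis by (simp add: powr_powr)
  qed
  finally have "p * (x * F powr (p - 1)) \<le> p * (1 / p * x powr p + (1 - 1 / p) * F powr p)"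
    using assms by (intro mult_left_mono) auto
  also have "\<dots> = x powr p + (p - 1) * F powr p"
    using assms by (simp add: field_simps)
  finally show ?thesis by (simp add: mult_ac)
qed (use assms in auto)

lemma nn_integral_exp_decay:
  assumes "0 < (\<delta>::real)"
  shows "(\<integral>\<^sup>+\<tau>. ennreal (exp (- (\<delta> * \<tau>))) * indicator {0..} \<tau> \<partial>lborel) = ennreal (1 / \<delta>)"
proof -
  have "(\<integral>\<^sup>+\<tau>. ennreal (exp (- (\<delta> * \<tau>))) * indicator {0..} \<tau> \<partial>lborel) = ennreal (0 - (- (1 / \<delta>) * exp (- (\<delta> * 0))))"
  proof (rule nn_integral_FTC_atLeast)
    show "((\<lambda>\<tau>. - (1 / \<delta>) * exp (- (\<delta> * \<tau>))) has_real_derivative exp (- (\<delta> * \<tau>))) (at \<tau>)" for \<tau>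
      using assms by (auto intro!: derivative_eq_intros)
    have "((\<lambda>\<tau>. - (1 / \<delta>) * exp (- (\<delta> * \<tau>))) \<longlongrightarrow> - (1 / \<delta>) * 0) at_top"
      using assms
      by (intro tendsto_intros filterlim_compose[OF exp_at_bot] filterlim_compose[OF filterlim_uminus_at_bot_at_top]
           filterlim_tendsto_pos_mult_at_top[OF tendsto_const] filterlim_ident)
    then show "((\<lambda>\<tau>. - (1 / \<delta>) * exp (- (\<delta> * \<tau>))) \<longlongrightarrow> 0) at_top" by simp
  qed auto
  then show ?thesis by simp
qed

text \<open>Jensen's inequality for the probability density \<open>w \<tau> = \<delta> * exp (- \<delta> * \<tau>)\<close> applied to \<open>k / w\<close>.  It follows by
integrating Young's inequality between \<open>k / w\<close> and \<open>v\<close> against \<open>w\<close>.\<close>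

lemma powr_le_nn_integral_exp_weight:
  fixes k :: "real \<Rightarrow> real"
  assumes [measurable]: "k \<in> borel_measurable borel" and k: "\<And>\<tau>. 0 \<le> k \<tau>"
    and v: "0 \<le> v" "ennreal v \<le> (\<integral>\<^sup>+\<tau>. ennreal (k \<tau>) * indicator {0..} \<tau> \<partial>lborel)"
    and \<delta>: "0 < \<delta>" and p: "1 \<le> p"
  shows "ennreal (v powr p) \<le> ennreal (\<delta> powr (1 - p)) *
    (\<integral>\<^sup>+\<tau>. ennreal (exp (\<delta> * (p - 1) * \<tau>) * k \<tau> powr p) * indicator {0..} \<tau> \<partial>lborel)"
proof -
  define w where "w \<tau> = \<delta> * exp (- (\<delta> * \<tau>))" for \<tau>
  have w: "0 < w \<tau>" for \<tau> using \<delta> by (simp add: w_def)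
  have young: "p * v powr (p - 1) * k \<tau> \<le> \<delta> powr (1 - p) * (exp (\<delta> * (p - 1) * \<tau>) * k \<tau> powr p) + (p - 1) * v powr p * w \<tau>" for \<tau>
  proof -
    have "p * v powr (p - 1) * (k \<tau> / w \<tau>) \<le> (k \<tau> / w \<tau>) powr p + (p - 1) * v powr p"
      using k[of \<tau>] w[of \<tau>] v p by (intro Young_powr) auto
    then have "(p * v powr (p - 1) * (k \<tau> / w \<tau>)) * w \<tau> \<le> ((k \<tau> / w \<tau>) powr p + (p - 1) * v powr p) * w \<tau>"
      using w[of \<tau>] by (intro mult_right_mono) auto
    moreover have "(k \<tau> / w \<tau>) powr p * w \<tau> = \<delta> powr (1 - p) * (exp (\<delta> * (p - 1) * \<tau>) * k \<tau> powr p)"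
    proof -
      have "(k \<tau> / w \<tau>) powr p * w \<tau> = k \<tau> powr p * (w \<tau> powr (1 - p))"
        using k[of \<tau>] w[of \<tau>] by (simp add: powr_divide powr_diff)
      also have "w \<tau> powr (1 - p) = \<delta> powr (1 - p) * exp (\<delta> * (p - 1) * \<tau>)"
        using \<delta> by (simp add: w_def powr_mult exp_powr_real algebra_simps)
      finally show ?thesis by simp
    qed
    ultimately show ?thesis using w[of \<tau>] by (simp add: algebra_simps)
  qed
  have [measurable]: "w \<in> borel_measurable borel" unfolding w_def by measurable
  define J where "J = ennreal (\<delta> powr (1 - p)) *
    (\<integral>\<^sup>+\<tau>. ennreal (exp (\<delta> * (p - 1) * \<tau>) * k \<tau> powr p) * indicator {0..} \<tau> \<partial>lborel)"
  have "ennreal (p * v powr p) = ennreal (p * v powr (p - 1)) * ennreal v"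
    using v p by (cases "v = 0") (auto simp: ennreal_mult[symmetric] powr_diff)
  also have "\<dots> \<le> ennreal (p * v powr (p - 1)) * (\<integral>\<^sup>+\<tau>. ennreal (k \<tau>) * indicator {0..} \<tau> \<partial>lborel)"
    using v by (intro mult_left_mono) auto
  also have "\<dots> = (\<integral>\<^sup>+\<tau>. ennreal (p * v powr (p - 1) * k \<tau>) * indicator {0..} \<tau> \<partial>lborel)"
    using k p by (subst nn_integral_cmult[symmetric]) (auto simp: ennreal_mult mult.assoc)
  also have "\<dots> \<le> (\<integral>\<^sup>+\<tau>. ennreal (\<delta> powr (1 - p)) * (ennreal (exp (\<delta> * (p - 1) * \<tau>) * k \<tau> powr p) * indicator {0..} \<tau>)
      + ennreal ((p - 1) * v powr p * \<delta>) * (ennreal (exp (- (\<delta> * \<tau>))) * indicator {0..} \<tau>) \<partial>lborel)"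
  proof (rule nn_integral_mono)
    fix \<tau> :: real
    have "ennreal (p * v powr (p - 1) * k \<tau>) \<le> ennreal (\<delta> powr (1 - p) * (exp (\<delta> * (p - 1) * \<tau>) * k \<tau> powr p) + (p - 1) * v powr p * w \<tau>)"
      using young by (rule ennreal_leI)
    also have "\<dots> = ennreal (\<delta> powr (1 - p)) * ennreal (exp (\<delta> * (p - 1) * \<tau>) * k \<tau> powr p) +
        ennreal ((p - 1) * v powr p * \<delta>) * ennreal (exp (- (\<delta> * \<tau>)))"
      using p \<delta> by (simp add: ennreal_mult[symmetric] ennreal_plus[symmetric] w_def mult_ac del: ennreal_plus)
    finally show "ennreal (p * v powr (p - 1) * k \<tau>) * indicator {0..} \<tau> \<le>
        ennreal (\<delta> powr (1 - p)) * (ennreal (exp (\<delta> * (p - 1) * \<tau>) * k \<tau> powr p) * indicator {0..} \<tau>)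
      + ennreal ((p - 1) * v powr p * \<delta>) * (ennreal (exp (- (\<delta> * \<tau>))) * indicator {0..} \<tau>)"
      by (auto simp: indicator_def)
  qed
  also have "\<dots> = J + ennreal ((p - 1) * v powr p * \<delta>) * ennreal (1 / \<delta>)"
    using nn_integral_exp_decay[OF \<delta>]
    by (subst nn_integral_add) (auto simp: nn_integral_cmult J_def)
  also have "ennreal ((p - 1) * v powr p * \<delta>) * ennreal (1 / \<delta>) = ennreal ((p - 1) * v powr p)"
    using \<delta> p by (subst ennreal_mult[symmetric]) auto
  finally have *: "ennreal (p * v powr p) \<le> J + ennreal ((p - 1) * v powr p)" .
  have "ennreal (v powr p) \<le> J"
  proof (cases J)
    case (real j)
    then have "p * v powr p \<le> j + (p - 1) * v powr p"
      using * p by (simp add: ennreal_plus[symmetric] del: ennreal_plus)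
    then have "v powr p \<le> j" by (simp add: algebra_simps)
    then show ?thesis using real by (simp add: ennreal_leI)
  qed simp
  then show ?thesis by (simp add: J_def)
qed

text \<open>The \<open>p\<close>-th power of the norm of \<open>L\<^sup>p(\<bar>x\<bar>\<^sup>d dx)\<close>, with values in the extended nonnegative reals.\<close>

definition Lp_mass :: "real \<Rightarrow> real \<Rightarrow> ('a::euclidean_space \<Rightarrow> real) \<Rightarrow> ennreal" where
  "Lp_mass d p u = (\<integral>\<^sup>+x. ennreal (norm x powr d * \<bar>u x\<bar> powr p) \<partial>lborel)"

text \<open>The integral of \<open>f\<close> along the forward orbit of \<open>y\<close>.\<close>

abbreviation orbit_integral :: "real \<Rightarrow> ('a::euclidean_space \<Rightarrow> real) \<Rightarrow> 'a \<Rightarrow> ennreal" where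
  "orbit_integral a f y \<equiv> \<integral>\<^sup>+\<tau>. ennreal (f (exp (a * \<tau>) *\<^sub>R y)) * indicator {0..} \<tau> \<partial>lborel"

text \<open>Hardy's inequality with its constant: a dilation by \<open>exp (a * \<tau>)\<close> multiplies the weighted integral by
\<open>exp (- a * (c + N) * \<tau>)\<close>, and \<open>\<delta> = a * (c + N) / p\<close> balances this against the weight in Jensen's inequality.\<close>

lemma Hardy_dilation:
  fixes v k :: "'a::euclidean_space \<Rightarrow> real"
  assumes [measurable]: "k \<in> borel_measurable borel" and k: "\<And>x. 0 \<le> k x"
    and v: "\<And>x. 0 \<le> v x"
      "AE y in lborel. ennreal (v y) \<le> orbit_integral a k y"
    and pos: "0 < a * (c + real DIM('a))" and p: "1 \<le> p"
  shows "Lp_mass c p v \<le> ennreal ((a * (c + real DIM('a)) / p) powr (- p)) * Lp_mass c p k"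
proof -
  define \<delta> where "\<delta> = a * (c + real DIM('a)) / p"
  have \<delta>: "0 < \<delta>" using pos p by (simp add: \<delta>_def)
  have "Lp_mass c p v \<le> (\<integral>\<^sup>+y. ennreal (norm y powr c) * (ennreal (\<delta> powr (1 - p)) *
    (\<integral>\<^sup>+\<tau>. ennreal (exp (\<delta> * (p - 1) * \<tau>) * k (exp (a * \<tau>) *\<^sub>R y) powr p) * indicator {0..} \<tau> \<partial>lborel)) \<partial>lborel)"
    unfolding Lp_mass_def
  proof (rule nn_integral_mono_AE)
    from v(2) show "AE y in lborel. ennreal (norm y powr c * \<bar>v y\<bar> powr p) \<le> ennreal (norm y powr c) * (ennreal (\<delta> powr (1 - p)) *
      (\<integral>\<^sup>+\<tau>. ennreal (exp (\<delta> * (p - 1) * \<tau>) * k (exp (a * \<tau>) *\<^sub>R y) powr p) * indicator {0..} \<tau> \<partial>lborel))"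
    proof eventually_elim
      case (elim y)
      have "ennreal (v y powr p) \<le> ennreal (\<delta> powr (1 - p)) *
      (\<integral>\<^sup>+\<tau>. ennreal (exp (\<delta> * (p - 1) * \<tau>) * k (exp (a * \<tau>) *\<^sub>R y) powr p) * indicator {0..} \<tau> \<partial>lborel)"
        by (rule powr_le_nn_integral_exp_weight[OF _ _ v(1) elim \<delta> p]) (use k in auto)
      then show ?case
        using v(1)[of y] by (simp add: ennreal_mult mult_left_mono)
    qed
  qed
  also have "\<dots> = ennreal (\<delta> powr (1 - p)) * (\<integral>\<^sup>+y. (\<integral>\<^sup>+\<tau>.
      ennreal (norm y powr c * (exp (\<delta> * (p - 1) * \<tau>) * k (exp (a * \<tau>) *\<^sub>R y) powr p)) * indicator {0..} \<tau> \<partial>lborel) \<partial>lborel)"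
    by (simp add: nn_integral_cmult[symmetric] ennreal_mult mult_ac)
  also have "(\<integral>\<^sup>+y. (\<integral>\<^sup>+\<tau>.
      ennreal (norm y powr c * (exp (\<delta> * (p - 1) * \<tau>) * k (exp (a * \<tau>) *\<^sub>R y) powr p)) * indicator {0..} \<tau> \<partial>lborel) \<partial>lborel)
     = (\<integral>\<^sup>+\<tau>. (\<integral>\<^sup>+y.
      ennreal (norm y powr c * (exp (\<delta> * (p - 1) * \<tau>) * k (exp (a * \<tau>) *\<^sub>R y) powr p)) * indicator {0..} \<tau> \<partial>lborel) \<partial>lborel)"
    by (rule lborel_pair.Fubini') measurable
  also have "\<dots> = (\<integral>\<^sup>+\<tau>. (ennreal (exp (- (\<delta> * \<tau>))) * indicator {0..} \<tau>) * Lp_mass c p k \<partial>lborel)"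
  proof (rule nn_integral_cong)
    fix \<tau> :: real
    have "(\<integral>\<^sup>+y. ennreal (norm y powr c * (exp (\<delta> * (p - 1) * \<tau>) * k (exp (a * \<tau>) *\<^sub>R y) powr p)) * indicator {0..} \<tau> \<partial>lborel)
      = (\<integral>\<^sup>+y. (ennreal (exp (\<delta> * (p - 1) * \<tau> - a * c * \<tau>)) * indicator {0..} \<tau>) *
          (\<lambda>x. ennreal (norm x powr c * \<bar>k x\<bar> powr p)) (exp (a * \<tau>) *\<^sub>R y) \<partial>lborel)"
    proof (rule nn_integral_cong)
      fix y :: 'a
      have "norm (exp (a * \<tau>) *\<^sub>R y) powr c = exp (a * c * \<tau>) * norm y powr c"
        by (simp add: powr_mult exp_powr_real mult_ac)
      then show "ennreal (norm y powr c * (exp (\<delta> * (p - 1) * \<tau>) * k (exp (a * \<tau>) *\<^sub>R y) powr p)) * indicator {0..} \<tau> =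
          (ennreal (exp (\<delta> * (p - 1) * \<tau> - a * c * \<tau>)) * indicator {0..} \<tau>) *
          (\<lambda>x. ennreal (norm x powr c * \<bar>k x\<bar> powr p)) (exp (a * \<tau>) *\<^sub>R y)"
        using k by (auto simp: indicator_def ennreal_mult[symmetric] exp_diff)
    qed
    also have "\<dots> = (ennreal (exp (\<delta> * (p - 1) * \<tau> - a * c * \<tau>)) * indicator {0..} \<tau>) *
        (ennreal (exp (- (real DIM('a) * (a * \<tau>)))) * Lp_mass c p k)"
      unfolding Lp_mass_def by (subst nn_integral_cmult, measurable) (subst nn_integral_dilation, auto)
    also have "\<dots> = (ennreal (exp (- (\<delta> * \<tau>))) * indicator {0..} \<tau>) * Lp_mass c p k"
    proof -
      have "\<delta> * p = a * (c + real DIM('a))" using p by (simp add: \<delta>_def)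
      then have "a * real DIM('a) = \<delta> * p - a * c" by (simp add: algebra_simps)
      then have "real DIM('a) * (a * \<tau>) = (\<delta> * p - a * c) * \<tau>" by (metis mult.assoc mult.commute)
      then have "exp (\<delta> * (p - 1) * \<tau> - a * c * \<tau>) * exp (- (real DIM('a) * (a * \<tau>))) = exp (- (\<delta> * \<tau>))"
        by (simp add: exp_add[symmetric] algebra_simps)
      then show ?thesis
        by (auto simp: indicator_def mult.assoc[symmetric] ennreal_mult[symmetric])
    qed
    finally show "(\<integral>\<^sup>+y. ennreal (norm y powr c * (exp (\<delta> * (p - 1) * \<tau>) * k (exp (a * \<tau>) *\<^sub>R y) powr p)) * indicator {0..} \<tau> \<partial>lborel)
      = (ennreal (exp (- (\<delta> * \<tau>))) * indicator {0..} \<tau>) * Lp_mass c p k" .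
  qed
  also have "\<dots> = ennreal (1 / \<delta>) * Lp_mass c p k"
    by (subst nn_integral_multc) (auto simp: nn_integral_exp_decay[OF \<delta>])
  also have "ennreal (\<delta> powr (1 - p)) * (ennreal (1 / \<delta>) * Lp_mass c p k) = ennreal (\<delta> powr (- p)) * Lp_mass c p k"
    using \<delta> by (simp add: mult.assoc[symmetric] ennreal_mult[symmetric] powr_diff powr_minus field_simps)
  finally show ?thesis by (simp add: \<delta>_def)
qed

section \<open>Integrals of powers of the norm\<close>

lemma nn_integral_norm_powr_annulus:
  assumes "0 < r"
  shows "(\<integral>\<^sup>+x. ennreal (norm x powr d) * indicator (annulus r R) (x::'a::euclidean_space) \<partial>lborel) < \<infinity>"
proof -
  have "continuous_on (annulus r R) (\<lambda>x::'a. norm x powr d)"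
    using assms by (intro continuous_intros) (auto simp: annulus_def)
  then have "integrable lborel (\<lambda>x::'a. indicator (annulus r R) x *\<^sub>R norm x powr d)"
    by (intro borel_integrable_compact compact_annulus)
  then have "(\<integral>\<^sup>+x. ennreal (norm (indicator (annulus r R) x *\<^sub>R norm (x::'a) powr d)) \<partial>lborel) < \<infinity>"
    by (simp add: integrable_iff_bounded)
  also have "(\<integral>\<^sup>+x. ennreal (norm (indicator (annulus r R) x *\<^sub>R norm (x::'a) powr d)) \<partial>lborel) =
     (\<integral>\<^sup>+x. ennreal (norm x powr d) * indicator (annulus r R) (x::'a::euclidean_space) \<partial>lborel)"
    by (intro nn_integral_cong) (auto simp: indicator_def)
  finally show ?thesis .
qed

text \<open>The punctured closed unit ball if \<open>m > 0\<close>, the complement of the open unit ball if \<open>m < 0\<close>.  Using \<open>norm x powr m\<close> in place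
of the norm treats the two ends, zero and infinity, at the same time.\<close>

definition inner_part :: "real \<Rightarrow> 'a::euclidean_space set" where
  "inner_part m = {x. x \<noteq> 0 \<and> norm x powr m \<le> 1}"

lemma inner_part_measurable [measurable]: "inner_part m \<in> sets borel"
  unfolding inner_part_def by measurable

text \<open>\<open>s\<close> is the time at which the orbit \<open>exp (m * \<tau>) *\<^sub>R y\<close> reaches the unit sphere.\<close>

lemma inner_part_time:
  assumes "m \<noteq> 0" "y \<in> inner_part m"
  obtains s where "0 \<le> s" "norm y powr m = exp (- (m\<^sup>2 * s))"
proof
  have y: "y \<noteq> 0" "norm y powr m \<le> 1" using assms(2) by (auto simp: inner_part_def)
  show "norm y powr m = exp (- (m\<^sup>2 * (- ln (norm y powr m) / m\<^sup>2)))"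
    using y assms(1) by (simp add: powr_def)
  show "0 \<le> - ln (norm y powr m) / m\<^sup>2"
    using y assms(1) by (simp add: divide_nonpos_pos ln_le_zero_iff del: ln_powr)
qed

lemma norm_powr_dilation:
  "norm (exp (m * \<tau>) *\<^sub>R x) powr m = exp (m\<^sup>2 * \<tau>) * norm x powr m"
  by (simp add: powr_mult exp_powr_real power2_eq_square mult_ac)

lemma shell_subset_annulus:
  assumes "m \<noteq> 0" "0 < s"
  obtains r R where "0 < r" "{x::'a::euclidean_space. x \<noteq> 0 \<and> s \<le> norm x powr m \<and> norm x powr m \<le> t} \<subseteq> annulus r R"
proof
  define r where "r = min (s powr (1 / m)) ((max s t) powr (1 / m))"
  define R where "R = max (s powr (1 / m)) ((max s t) powr (1 / m))"
  show "0 < r" using assms by (simp add: r_def)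
  show "{x::'a. x \<noteq> 0 \<and> s \<le> norm x powr m \<and> norm x powr m \<le> t} \<subseteq> annulus r R"
  proof
    fix x :: 'a assume "x \<in> {x. x \<noteq> 0 \<and> s \<le> norm x powr m \<and> norm x powr m \<le> t}"
    then have x: "x \<noteq> 0" "s \<le> norm x powr m" "norm x powr m \<le> max s t" by auto
    have eq: "norm x = (norm x powr m) powr (1 / m)" using assms x by (simp add: powr_powr)
    show "x \<in> annulus r R"
    proof (cases "0 < m")
      case True
      have "s powr (1 / m) \<le> norm x" "norm x \<le> max s t powr (1 / m)"
        using x assms True by (subst eq, intro powr_mono2, auto)+
      then show ?thesis by (auto simp: annulus_def r_def R_def)
    next
      case False
      then have "m < 0" using assms by auto
      then have "norm x \<le> s powr (1 / m)" "max s t powr (1 / m) \<le> norm x"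
        using x assms by (subst eq, intro powr_mono2', auto)+
      then show ?thesis by (auto simp: annulus_def r_def R_def)
    qed
  qed
qed

text \<open>The orbit of a point of \<open>inner_part m\<close> spends at least unit time in the shell \<open>A\<close>, so Hardy's inequality with
exponent \<open>1\<close> reduces the claim to the shell.\<close>

lemma nn_integral_norm_powr_inner_part:
  assumes m: "m \<noteq> 0" "0 < m * (d + real DIM('a))"
  shows "(\<integral>\<^sup>+x. ennreal (norm x powr d) * indicator (inner_part m) (x::'a::euclidean_space) \<partial>lborel) < \<infinity>"
proof -
  define A where "A = {x::'a. x \<noteq> 0 \<and> 1 \<le> norm x powr m \<and> norm x powr m \<le> exp (m\<^sup>2)}"
  have [measurable]: "A \<in> sets borel" unfolding A_def by measurable
  have eq: "Lp_mass d 1 (indicator S) = (\<integral>\<^sup>+x. ennreal (norm x powr d) * indicator S (x::'a) \<partial>lborel)" for S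
    unfolding Lp_mass_def by (intro nn_integral_cong) (auto simp: indicator_def)
  have "Lp_mass d 1 (indicator (inner_part m :: 'a set)) \<le> ennreal ((m * (d + real DIM('a)) / 1) powr (- 1)) * Lp_mass d 1 (indicator A)"
  proof (rule Hardy_dilation)
    show "AE y in lborel. ennreal (indicator (inner_part m) y)
        \<le> (\<integral>\<^sup>+\<tau>. ennreal (indicator A (exp (m * \<tau>) *\<^sub>R y)) * indicator {0..} \<tau> \<partial>lborel)"
    proof (rule AE_I2)
      fix y :: 'a
      show "ennreal (indicator (inner_part m) y)
        \<le> (\<integral>\<^sup>+\<tau>. ennreal (indicator A (exp (m * \<tau>) *\<^sub>R y)) * indicator {0..} \<tau> \<partial>lborel)"
      proof (cases "y \<in> inner_part m")
        case True
        then have y: "y \<noteq> 0" by (simp add: inner_part_def)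
        obtain s where s: "0 \<le> s" and R: "norm y powr m = exp (- (m\<^sup>2 * s))"
          by (rule inner_part_time[OF m(1) True])
        have "(1::ennreal) = emeasure lborel {s..s + 1}" by (simp add: emeasure_lborel_Icc_eq)
        also have "\<dots> = (\<integral>\<^sup>+\<tau>. indicator {s..s + 1} \<tau> \<partial>lborel)" by simp
        also have "\<dots> \<le> (\<integral>\<^sup>+\<tau>. ennreal (indicator A (exp (m * \<tau>) *\<^sub>R y)) * indicator {0..} \<tau> \<partial>lborel)"
        proof (intro nn_integral_mono)
          fix \<tau> :: real
          have "exp (m * \<tau>) *\<^sub>R y \<in> A" if "\<tau> \<in> {s..s + 1}"
          proof -
            have "norm (exp (m * \<tau>) *\<^sub>R y) powr m = exp (m\<^sup>2 * (\<tau> - s))"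
              unfolding norm_powr_dilation R by (simp add: exp_add[symmetric] algebra_simps)
            moreover have "0 \<le> m\<^sup>2 * (\<tau> - s)" "m\<^sup>2 * (\<tau> - s) \<le> m\<^sup>2"
              using that by (auto simp: mult_left_le)
            ultimately show ?thesis using y by (simp add: A_def)
          qed
          then show "indicator {s..s + 1} \<tau> \<le> ennreal (indicator A (exp (m * \<tau>) *\<^sub>R y)) * indicator {0..} \<tau>"
            using s by (auto simp: indicator_def)
        qed
        finally show ?thesis using True by simp
      qed simp
    qed
  qed (use m in auto)
  also have "\<dots> < \<infinity>"
  proof -
    obtain r R where r: "0 < r" "A \<subseteq> annulus r R"
      using shell_subset_annulus[of m 1 "exp (m\<^sup>2)"] m unfolding A_def by auto
    have "Lp_mass d 1 (indicator A) \<le> (\<integral>\<^sup>+x. ennreal (norm x powr d) * indicator (annulus r R) (x::'a) \<partial>lborel)"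
      unfolding eq using r by (intro nn_integral_mono) (auto simp: indicator_def)
    also have "\<dots> < \<infinity>" by (rule nn_integral_norm_powr_annulus[OF r(1)])
    finally show ?thesis by (simp add: ennreal_mult_less_top)
  qed
  finally show ?thesis by (simp add: eq)
qed

text \<open>By scaling, the integral \<open>I\<close> satisfies \<open>I = J + exp (- m * (d + N)) * I\<close>, where \<open>J > 0\<close> is the
integral over a shell; this is impossible for finite \<open>I\<close> when the factor is at least \<open>1\<close>.\<close>

lemma nn_integral_norm_powr_inner_part_infinite:
  assumes m: "m \<noteq> 0" "m * (d + real DIM('a)) \<le> 0"
  shows "(\<integral>\<^sup>+x. ennreal (norm x powr d) * indicator (inner_part m) (x::'a::euclidean_space) \<partial>lborel) = \<infinity>"
proof (rule ccontr)
  let ?I = "\<integral>\<^sup>+x. ennreal (norm x powr d) * indicator (inner_part m) (x::'a) \<partial>lborel"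
  assume fin: "?I \<noteq> \<infinity>"
  define A where "A = {x::'a. x \<noteq> 0 \<and> exp (- m\<^sup>2) < norm x powr m \<and> norm x powr m \<le> 1}"
  have [measurable]: "A \<in> sets borel" unfolding A_def by measurable
  let ?J = "\<integral>\<^sup>+x. ennreal (norm x powr d) * indicator A (x::'a) \<partial>lborel"
  have "?I = (\<integral>\<^sup>+x. ennreal (norm x powr d) * indicator A (x::'a) + ennreal (norm x powr d) * indicator (inner_part m) (exp m *\<^sub>R x) \<partial>lborel)"
  proof (intro nn_integral_cong)
    fix x :: 'a
    have "norm (exp m *\<^sub>R x) powr m = exp (m\<^sup>2) * norm x powr m"
      using norm_powr_dilation[of m 1 x] by simp
    then have "exp m *\<^sub>R x \<in> inner_part m \<longleftrightarrow> x \<noteq> 0 \<and> norm x powr m \<le> exp (- m\<^sup>2)"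
      by (simp add: inner_part_def exp_minus field_simps)
    moreover have "exp (- m\<^sup>2) \<le> 1" by simp
    ultimately have "x \<in> inner_part m \<longleftrightarrow> x \<in> A \<or> exp m *\<^sub>R x \<in> inner_part m"
      "\<not> (x \<in> A \<and> exp m *\<^sub>R x \<in> inner_part m)"
      unfolding A_def inner_part_def[of m] mem_Collect_eq by linarith+
    then show "ennreal (norm x powr d) * indicator (inner_part m) x =
       ennreal (norm x powr d) * indicator A x + ennreal (norm x powr d) * indicator (inner_part m) (exp m *\<^sub>R x)"
      by (auto simp: indicator_def)
  qed
  also have "\<dots> = ?J + (\<integral>\<^sup>+x. ennreal (norm x powr d) * indicator (inner_part m) (exp m *\<^sub>R (x::'a)) \<partial>lborel)"
    by (rule nn_integral_add) measurable
  also have "(\<integral>\<^sup>+x. ennreal (norm x powr d) * indicator (inner_part m) (exp m *\<^sub>R (x::'a)) \<partial>lborel)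
     = (\<integral>\<^sup>+x. ennreal (exp (- (m * d))) * (\<lambda>z. ennreal (norm z powr d) * indicator (inner_part m) z) (exp m *\<^sub>R (x::'a)) \<partial>lborel)"
    by (intro nn_integral_cong)
       (simp add: powr_mult exp_powr_real mult.assoc[symmetric] ennreal_mult[symmetric] exp_add[symmetric])
  also have "\<dots> = ennreal (exp (- (m * (d + real DIM('a))))) * ?I"
    by (subst nn_integral_cmult, measurable)
       (subst nn_integral_dilation, simp_all add: mult.assoc[symmetric] ennreal_mult[symmetric] exp_add[symmetric] algebra_simps)
  finally have I: "?I = ?J + ennreal (exp (- (m * (d + real DIM('a))))) * ?I" .
  have "1 * ?I \<le> ennreal (exp (- (m * (d + real DIM('a))))) * ?I"
    using m by (intro mult_right_mono) (auto simp: ennreal_1[symmetric] simp del: ennreal_1 intro!: ennreal_leI)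
  then have "?J + ?I \<le> ?J + ennreal (exp (- (m * (d + real DIM('a))))) * ?I"
    by (intro add_left_mono) simp
  then have "?I + ?J \<le> ?I + 0" by (simp add: I[symmetric] add.commute)
  then have "?J = 0" using fin by (subst (asm) ennreal_add_left_cancel_le) simp
  then have "AE x in lborel. ennreal (norm x powr d) * indicator A (x::'a) = 0"
    by (subst (asm) nn_integral_0_iff_AE) auto
  then have AE: "AE x in lborel. (x::'a) \<notin> A"
    by eventually_elim (auto simp: A_def indicator_def split: if_splits)
  define U where "U = {x::'a. min 1 (exp (- m)) < norm x \<and> norm x < max 1 (exp (- m))}"
  have "U \<subseteq> A"
  proof
    fix x assume "x \<in> U"
    then have x: "min 1 (exp (- m)) < norm x" "norm x < max 1 (exp (- m))" by (auto simp: U_def)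
    then have "0 < norm x" by (smt (verit) exp_gt_zero)
    then have 0: "x \<noteq> 0" by auto
    have e: "norm x powr m = exp (m * ln (norm x))" using 0 by (simp add: powr_def)
    have "- m\<^sup>2 < m * ln (norm x) \<and> m * ln (norm x) \<le> 0"
    proof (cases "0 < m")
      case True
      then have "exp (- m) < norm x" "norm x < 1" using x by (auto simp: min_def max_def split: if_splits)
      then have "- m < ln (norm x)" "ln (norm x) < 0"
        using \<open>0 < norm x\<close> ln_less_cancel_iff[of "exp (- m)" "norm x"] ln_less_cancel_iff[of "norm x" 1] by auto
      then have "m * (- m) < m * ln (norm x)" "m * ln (norm x) \<le> 0"
        using True mult_strict_left_mono[of "- m" "ln (norm x)" m] by (auto simp: mult_le_0_iff)
      then show ?thesis by (simp add: power2_eq_square)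
    next
      case False
      then have m0: "m < 0" using m by auto
      then have "norm x < exp (- m)" "1 < norm x" using x by (auto simp: min_def max_def split: if_splits)
      then have "ln (norm x) < - m" "0 < ln (norm x)"
        using \<open>0 < norm x\<close> ln_less_cancel_iff[of "norm x" "exp (- m)"] ln_less_cancel_iff[of 1 "norm x"] by auto
      then have "m * (- m) < m * ln (norm x)" "m * ln (norm x) \<le> 0"
        using m0 mult_strict_left_mono_neg[of "ln (norm x)" "- m" m] by (auto simp: mult_le_0_iff)
      then show ?thesis by (simp add: power2_eq_square)
    qed
    then show "x \<in> A" using 0 by (simp add: A_def e)
  qed
  have "open U" unfolding U_def by (intro open_Collect_conj open_Collect_less continuous_intros)
  moreover have "U \<noteq> {}"
  proof -
    obtain b :: 'a where b: "b \<in> Basis" using nonempty_Basis by blast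
    define t where "t = (min 1 (exp (- m)) + max 1 (exp (- m))) / 2"
    have "exp (- m) \<noteq> 1" using m by simp
    then have "min 1 (exp (- m)) < t" "t < max 1 (exp (- m))" "0 < t"
      by (auto simp: t_def min_def max_def add_pos_pos)
    then have "t *\<^sub>R b \<in> U" using b by (simp add: U_def)
    then show ?thesis by auto
  qed
  ultimately have "\<not> negligible U" by (rule open_not_negligible)
  moreover have "negligible U"
  proof -
    have "AE x in lebesgue. x \<notin> U" using AE_completion[OF AE] \<open>U \<subseteq> A\<close> by (auto elim: eventually_mono)
    then show ?thesis using \<open>open U\<close>
      by (simp add: negligible_iff_null_sets AE_iff_null_sets[symmetric] borel_open lborelD_Collect)
  qed
  ultimately show False by contradiction
qed

section \<open>Weighted estimates from the growth along orbits\<close>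

lemma Lp_mass_cong_AE:
  "AE x in lborel. u x = v x \<Longrightarrow> Lp_mass d p u = Lp_mass d p v"
  unfolding Lp_mass_def by (intro nn_integral_cong_AE) auto

lemma norm_powr_le_shell:
  fixes x :: "'a::real_normed_vector"
  assumes a: "a \<noteq> 0" and x: "x \<noteq> 0"
    and "(norm x powr a \<le> exp (a\<^sup>2) \<and> 0 \<le> a * e) \<or> (1 \<le> norm x powr a \<and> a * e \<le> 0)"
  shows "norm x powr e \<le> exp \<bar>a * e\<bar>"
proof -
  define l where "l = ln (norm x)"
  have R: "norm x powr e = exp (e * l)" "norm x powr a = exp (a * l)"
    using x by (simp_all add: powr_def l_def)
  have eq: "e * l = (a * e) * (a * l) / a\<^sup>2" using a by (simp add: power2_eq_square)
  consider "a * l \<le> a\<^sup>2" "0 \<le> a * e" | "0 \<le> a * l" "a * e \<le> 0" using assms(3) R by auto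
  then have "e * l \<le> \<bar>a * e\<bar>"
  proof cases
    case 1
    have "(a * e) * (a * l) / a\<^sup>2 \<le> (a * e) * a\<^sup>2 / a\<^sup>2"
      using 1 by (intro divide_right_mono mult_left_mono) auto
    then show ?thesis using a 1 by (simp only: eq) simp
  next
    case 2
    then have "(a * e) * (a * l) \<le> 0" by (simp only: mult_nonpos_nonneg)
    then have "(a * e) * (a * l) / a\<^sup>2 \<le> 0" by (intro divide_nonpos_nonneg) auto
    then show ?thesis unfolding eq by linarith
  qed
  then show ?thesis by (simp add: R)
qed

text \<open>What the estimates use of an element of the space: \<open>v\<close> and \<open>k\<close> are Borel representatives of the function and of its
radial derivative, \<open>M\<close> is its weighted supremum, and the growth along orbits is controlled by \<open>k\<close>.\<close>

locale radial_pair =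
  fixes a M :: real and v k :: "'a::euclidean_space \<Rightarrow> real"
  assumes a: "a \<noteq> 0" and v: "loc_int v" and k: "loc_int k" and M: "0 \<le> M"
    and bounded: "AE x in lborel. norm x powr a * \<bar>v x\<bar> \<le> M"
    and growth: "AE y in lborel. \<forall>n::nat. ennreal \<bar>v y\<bar> \<le> ennreal \<bar>v (exp (a * real n) *\<^sub>R y)\<bar> +
      orbit_variation a k n y"
begin

lemma measurable_representatives [measurable]: "v \<in> borel_measurable borel" "k \<in> borel_measurable borel"
  using v k by (auto dest: loc_int_measurable)

text \<open>The integrand along the orbits, \<open>\<bar>a * \<rho> \<partial>\<^sub>\<rho> u\<bar>\<close>.\<close>

definition K :: "'a \<Rightarrow> real" where
  "K x = \<bar>a\<bar> * (norm x * \<bar>k x\<bar>)"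

lemma measurable_K [measurable]: "K \<in> borel_measurable borel"
  unfolding K_def by measurable

lemma K_nonneg: "0 \<le> K x"
  by (simp add: K_def)

lemma bounded_orbit:
  "AE y in lborel. \<forall>n::nat. exp (a\<^sup>2 * real n) * norm y powr a * \<bar>v (exp (a * real n) *\<^sub>R y)\<bar> \<le> M"
  unfolding AE_all_countable
proof
  fix n :: nat
  from AE_dilation[OF bounded, of "a * real n"]
  show "AE y in lborel. exp (a\<^sup>2 * real n) * norm y powr a * \<bar>v (exp (a * real n) *\<^sub>R y)\<bar> \<le> M"
    by (simp only: norm_powr_dilation)
qed

lemma decay:
  "AE y in lborel. ennreal \<bar>v y\<bar> \<le> orbit_integral a K y"
  using growth bounded_orbit AE_lborel_singleton[of "0::'a"]
proof eventually_elim
  case (elim y)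
  let ?I = "orbit_integral a K y"
  have R: "0 < norm y powr a" using elim by simp
  show ?case
  proof (rule ennreal_le_epsilon)
    fix e :: real assume e: "0 < e"
    \<comment> \<open>A time at which the bound \<open>M * norm x powr (- a)\<close> has fallen below \<open>e\<close> on the orbit, as \<open>t \<le> exp t\<close>.\<close>
    obtain n :: nat where n: "M / (e * norm y powr a) / a\<^sup>2 \<le> real n"
      using real_arch_simple by blast
    have "M / (e * norm y powr a) \<le> a\<^sup>2 * real n"
      using n a by (subst (asm) pos_divide_le_eq) (auto simp: mult.commute)
    also have "\<dots> \<le> exp (a\<^sup>2 * real n)" by (smt (verit) exp_ge_add_one_self)
    finally have "M \<le> e * (exp (a\<^sup>2 * real n) * norm y powr a)"
      using e R by (simp add: field_simps)
    then have "exp (a\<^sup>2 * real n) * norm y powr a * \<bar>v (exp (a * real n) *\<^sub>R y)\<bar> \<le> exp (a\<^sup>2 * real n) * norm y powr a * e"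
      using elim(2)[rule_format, of n] by (simp add: mult_ac)
    then have le: "\<bar>v (exp (a * real n) *\<^sub>R y)\<bar> \<le> e"
      using R by (simp add: mult_le_cancel_left_pos)
    have "ennreal \<bar>v y\<bar> \<le> ennreal \<bar>v (exp (a * real n) *\<^sub>R y)\<bar> +
      orbit_variation a k n y"
      using elim(1) by blast
    also have "\<dots> \<le> ennreal e + ?I"
      using le by (intro add_mono ennreal_leI nn_integral_mono) (auto simp: K_def indicator_def)
    finally show "ennreal \<bar>v y\<bar> \<le> ?I + ennreal e" by (simp add: add.commute)
  qed
qed

text \<open>Once outside \<open>inner_part a\<close>, an orbit stays outside.\<close>

lemma decay_outer:
  "AE y in lborel. ennreal (indicator (- inner_part a) y * \<bar>v y\<bar>) \<le>
    orbit_integral a (\<lambda>x. K x * indicator {x. 1 \<le> norm x powr a} x) y"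
  using decay AE_lborel_singleton[of "0::'a"]
proof eventually_elim
  case (elim y)
  show ?case
  proof (cases "y \<in> inner_part a")
    case False
    then have R: "1 \<le> norm y powr a" using elim by (simp add: inner_part_def)
    have "1 \<le> norm (exp (a * \<tau>) *\<^sub>R y) powr a" if "0 \<le> \<tau>" for \<tau>
      unfolding norm_powr_dilation using mult_mono[of 1 "exp (a\<^sup>2 * \<tau>)" 1 "norm y powr a"] R that by simp
    then have "orbit_integral a K y =
      orbit_integral a (\<lambda>x. K x * indicator {x. 1 \<le> norm x powr a} x) y"
      by (intro nn_integral_cong) (auto simp: indicator_def)
    then show ?thesis using elim False by simp
  qed simp
qed

text \<open>An orbit that starts in \<open>inner_part a\<close> is followed up to the first integer time at which \<open>norm x powr a \<ge> 1\<close>;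
there \<open>\<bar>v\<bar> \<le> M\<close>.  Where \<open>\<bar>v y\<bar> > 2 * M\<close>, this term is absorbed.\<close>

lemma decay_inner:
  "AE y in lborel. ennreal (if y \<in> inner_part a \<and> 2 * M < \<bar>v y\<bar> then \<bar>v y\<bar> else 0) \<le>
    orbit_integral a (\<lambda>x. 2 * K x * indicator {x. x \<noteq> 0 \<and> norm x powr a \<le> exp (a\<^sup>2)} x) y"
  using growth bounded_orbit
proof eventually_elim
  case (elim y)
  define E where "E = {x::'a. x \<noteq> 0 \<and> norm x powr a \<le> exp (a\<^sup>2)}"
  have [measurable]: "E \<in> sets borel" unfolding E_def by measurable
  let ?I = "orbit_integral a (\<lambda>x. K x * indicator E x) y"
  show ?case
  proof (cases "y \<in> inner_part a \<and> 2 * M < \<bar>v y\<bar>")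
    case True
    then have y: "y \<noteq> 0" "y \<in> inner_part a" by (auto simp: inner_part_def)
    obtain s where s: "0 \<le> s" and R: "norm y powr a = exp (- (a\<^sup>2 * s))"
      by (rule inner_part_time[OF a y(2)])
    define n where "n = nat \<lceil>s\<rceil>"
    have n: "s \<le> real n" "real n \<le> s + 1" using s by (auto simp: n_def)
    have "1 \<le> exp (a\<^sup>2 * real n) * norm y powr a"
      using n by (simp add: R exp_add[symmetric] mult_left_mono)
    then have "1 * \<bar>v (exp (a * real n) *\<^sub>R y)\<bar> \<le> exp (a\<^sup>2 * real n) * norm y powr a * \<bar>v (exp (a * real n) *\<^sub>R y)\<bar>"
      by (intro mult_right_mono) auto
    then have le: "\<bar>v (exp (a * real n) *\<^sub>R y)\<bar> \<le> M" using elim(2)[rule_format, of n] by simp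
    have inE: "exp (a * \<tau>) *\<^sub>R y \<in> E" if "\<tau> \<in> {0..real n}" for \<tau>
    proof -
      have "a\<^sup>2 * \<tau> \<le> a\<^sup>2 * (s + 1)" using that n by (intro mult_left_mono) auto
      then have "norm (exp (a * \<tau>) *\<^sub>R y) powr a \<le> exp (a\<^sup>2)"
        unfolding norm_powr_dilation R by (simp add: exp_add[symmetric] algebra_simps)
      then show ?thesis using y by (simp add: E_def)
    qed
    have "ennreal \<bar>v y\<bar> \<le> ennreal \<bar>v (exp (a * real n) *\<^sub>R y)\<bar> +
      orbit_variation a k n y"
      using elim(1) by blast
    also have "\<dots> \<le> ennreal M + ?I"
    proof (intro add_mono ennreal_leI le nn_integral_mono)
      fix \<tau> :: real
      show "indicator {0..real n} \<tau> * ennreal (\<bar>a\<bar> * (norm (exp (a * \<tau>) *\<^sub>R y) * \<bar>k (exp (a * \<tau>) *\<^sub>R y)\<bar>))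
        \<le> ennreal (K (exp (a * \<tau>) *\<^sub>R y) * indicator E (exp (a * \<tau>) *\<^sub>R y)) * indicator {0..} \<tau>"
        using inE[of \<tau>] by (cases "\<tau> \<in> {0..real n}") (auto simp: K_def)
    qed
    finally have *: "ennreal \<bar>v y\<bar> \<le> ennreal M + ?I" .
    have "ennreal \<bar>v y\<bar> \<le> ennreal 2 * ?I"
    proof (cases ?I)
      case (real i)
      then have "\<bar>v y\<bar> \<le> M + i" using * M by (simp add: ennreal_plus[symmetric] del: ennreal_plus)
      then have "\<bar>v y\<bar> \<le> 2 * i" using True by linarith
      then show ?thesis using real by (simp add: ennreal_mult[symmetric] ennreal_leI del: ennreal_numeral)
    qed (simp add: ennreal_mult_top)
    also have "\<dots> = orbit_integral a (\<lambda>x. 2 * K x * indicator E x) y"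
      by (subst nn_integral_cmult[symmetric], measurable)
         (auto intro!: nn_integral_cong simp: indicator_def ennreal_mult K_nonneg)
    finally show ?thesis using True by (simp add: E_def)
  qed (auto simp: E_def)
qed

lemma Lp_mass_K_le:
  assumes E: "\<And>x. x \<in> E \<Longrightarrow> x \<noteq> 0 \<Longrightarrow> norm x powr (c + p - b) \<le> B" and s: "0 \<le> s" and p: "1 \<le> p" and B: "0 \<le> B"
  shows "Lp_mass c p (\<lambda>x. s * K x * indicator E x) \<le> ennreal ((s * \<bar>a\<bar>) powr p * B) * Lp_mass b p k"
proof -
  have "Lp_mass c p (\<lambda>x. s * K x * indicator E x) \<le> (\<integral>\<^sup>+x. ennreal ((s * \<bar>a\<bar>) powr p * B) * ennreal (norm x powr b * \<bar>k x\<bar> powr p) \<partial>lborel)"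
    unfolding Lp_mass_def
  proof (rule nn_integral_mono)
    fix x :: 'a
    have "norm x powr c * \<bar>s * K x * indicator E x\<bar> powr p \<le> (s * \<bar>a\<bar>) powr p * B * (norm x powr b * \<bar>k x\<bar> powr p)"
    proof (cases "x \<in> E \<and> x \<noteq> 0")
      case True
      have "\<bar>s * K x * indicator E x\<bar> powr p = (s * \<bar>a\<bar>) powr p * (norm x powr p * \<bar>k x\<bar> powr p)"
        using True s by (simp add: K_def abs_mult powr_mult)
      then have "norm x powr c * \<bar>s * K x * indicator E x\<bar> powr p =
          (s * \<bar>a\<bar>) powr p * (norm x powr (c + p - b) * (norm x powr b * \<bar>k x\<bar> powr p))"
        using True by (simp add: powr_add powr_diff)
      also have "\<dots> \<le> (s * \<bar>a\<bar>) powr p * (B * (norm x powr b * \<bar>k x\<bar> powr p))"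
        using True E by (intro mult_left_mono mult_right_mono) auto
      finally show ?thesis by (simp add: mult_ac)
    next
      case False
      then show ?thesis using B by (auto simp: indicator_def)
    qed
    then show "ennreal (norm x powr c * \<bar>s * K x * indicator E x\<bar> powr p)
        \<le> ennreal ((s * \<bar>a\<bar>) powr p * B) * ennreal (norm x powr b * \<bar>k x\<bar> powr p)"
      using B by (simp add: ennreal_mult[symmetric] ennreal_leI)
  qed
  also have "\<dots> = ennreal ((s * \<bar>a\<bar>) powr p * B) * Lp_mass b p k"
    unfolding Lp_mass_def by (rule nn_integral_cmult) measurable
  finally show ?thesis .
qed

lemma Hardy_global:
  assumes p: "1 \<le> p" and pos: "0 < a * (b - p + real DIM('a))"
  shows "Lp_mass (b - p) p v \<le> ennreal ((a * (b - p + real DIM('a)) / p) powr (- p) * \<bar>a\<bar> powr p) * Lp_mass b p k"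
proof -
  have "Lp_mass (b - p) p (\<lambda>x. \<bar>v x\<bar>) \<le> ennreal ((a * (b - p + real DIM('a)) / p) powr (- p)) * Lp_mass (b - p) p K"
    by (rule Hardy_dilation[OF measurable_K K_nonneg _ decay pos p]) simp
  also have "Lp_mass (b - p) p K \<le> ennreal ((1 * \<bar>a\<bar>) powr p * 1) * Lp_mass b p k"
    using Lp_mass_K_le[of UNIV "b - p" p b 1 1] p by simp
  finally show ?thesis
    by (simp add: Lp_mass_def ennreal_mult mult.assoc mult_left_mono)
qed

lemma Lp_mass_bounded_le:
  assumes p: "1 \<le> p" and [measurable]: "S \<in> sets borel"
  shows "Lp_mass c p (\<lambda>x. indicator S x * v x) \<le>
    ennreal (M powr p) * (\<integral>\<^sup>+x. ennreal (norm x powr (c - a * p)) * indicator S x \<partial>lborel)"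
proof -
  have "Lp_mass c p (\<lambda>x. indicator S x * v x) \<le>
    (\<integral>\<^sup>+x. ennreal (M powr p) * (ennreal (norm x powr (c - a * p)) * indicator S x) \<partial>lborel)"
    unfolding Lp_mass_def
  proof (rule nn_integral_mono_AE)
    show "AE x in lborel. ennreal (norm x powr c * \<bar>indicator S x * v x\<bar> powr p)
      \<le> ennreal (M powr p) * (ennreal (norm x powr (c - a * p)) * indicator S x)"
      using bounded AE_lborel_singleton[of "0::'a"]
    proof eventually_elim
      case (elim x)
      have "(norm x powr a * \<bar>v x\<bar>) powr p \<le> M powr p"
        using elim p by (intro powr_mono2) auto
      then have "norm x powr (c - a * p) * (norm x powr a * \<bar>v x\<bar>) powr p \<le> norm x powr (c - a * p) * M powr p"
        by (intro mult_left_mono) auto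
      moreover have "norm x powr (c - a * p) * (norm x powr a * \<bar>v x\<bar>) powr p = norm x powr c * \<bar>v x\<bar> powr p"
        using elim by (simp add: powr_mult powr_powr powr_diff)
      ultimately have "norm x powr c * \<bar>v x\<bar> powr p \<le> M powr p * norm x powr (c - a * p)" by (simp add: mult_ac)
      then have "ennreal (norm x powr c * \<bar>v x\<bar> powr p) \<le> ennreal (M powr p) * ennreal (norm x powr (c - a * p))"
        by (simp add: ennreal_mult[symmetric] ennreal_leI)
      then show ?case by (auto simp: indicator_def)
    qed
  qed
  also have "\<dots> = ennreal (M powr p) * (\<integral>\<^sup>+x. ennreal (norm x powr (c - a * p)) * indicator S x \<partial>lborel)"
    by (rule nn_integral_cmult) measurable
  finally show ?thesis .
qed

end

lemma ennreal_le_common_factor: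
  fixes C1 C2 :: ennreal
  assumes "C1 < \<infinity>" "C2 < \<infinity>"
  shows "\<exists>C>0. \<forall>X A B. X \<le> C1 * A + C2 * B \<longrightarrow> X \<le> ennreal C * (A + B)"
proof -
  obtain c1 c2 where c: "C1 = ennreal c1" "C2 = ennreal c2" "0 \<le> c1" "0 \<le> c2"
    using assms by (metis ennreal_enn2real enn2real_nonneg infinity_ennreal_def)
  show ?thesis
  proof (intro exI[of _ "c1 + c2 + 1"] conjI allI impI)
    fix X A B :: ennreal assume "X \<le> C1 * A + C2 * B"
    also have "\<dots> \<le> ennreal (c1 + c2 + 1) * A + ennreal (c1 + c2 + 1) * B"
      using c by (intro add_mono mult_right_mono) (auto intro!: ennreal_leI)
    finally show "X \<le> ennreal (c1 + c2 + 1) * (A + B)" by (simp add: distrib_left)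
  qed (use c in auto)
qed

text \<open>The embedding constant is chosen before the function.  If the first alternative of \<open>cond\<close> holds, the weighted supremum
suffices; otherwise \<open>norm x powr (c + p - b)\<close> is bounded on the region visited by the orbits.\<close>

lemma Lp_mass_inner_le:
  fixes a b c p :: real
  assumes p: "1 \<le> p" and pos: "0 < a * (c + real DIM('a))"
    and cond: "0 < a * (c - a * p + real DIM('a)) \<or> 0 \<le> a * (c + p - b)"
  shows "\<exists>C>0. \<forall>M (v :: 'a::euclidean_space \<Rightarrow> real) k. radial_pair a M v k \<longrightarrow>
    Lp_mass c p (\<lambda>x. indicator (inner_part a) x * v x) \<le> ennreal C * (ennreal (M powr p) + Lp_mass b p k)"
proof -
  have a: "a \<noteq> 0" using pos by auto
  define I where "I d = (\<integral>\<^sup>+x. ennreal (norm x powr d) * indicator (inner_part a) (x::'a) \<partial>lborel)" for d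
  show ?thesis
  proof (cases "0 < a * (c - a * p + real DIM('a))")
    case True
    then have "I (c - a * p) < \<infinity>"
      unfolding I_def using a by (intro nn_integral_norm_powr_inner_part) auto
    from ennreal_le_common_factor[OF this, of 0] obtain C where C: "0 < C"
      "\<And>X A B. X \<le> I (c - a * p) * A + 0 * B \<Longrightarrow> X \<le> ennreal C * (A + B)" by auto
    show ?thesis
    proof (intro exI[of _ C] conjI allI impI C)
      fix M and v k :: "'a \<Rightarrow> real" assume "radial_pair a M v k"
      from radial_pair.Lp_mass_bounded_le[OF this p, of "inner_part a" c]
      show "Lp_mass c p (\<lambda>x. indicator (inner_part a) x * v x) \<le> I (c - a * p) * ennreal (M powr p) + 0 * Lp_mass b p k"
        by (simp add: I_def mult.commute)
    qed
  next
    case False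
    then have e: "0 \<le> a * (c + p - b)" using cond by simp
    have fin: "I c < \<infinity>"
      unfolding I_def using a pos by (intro nn_integral_norm_powr_inner_part) auto
    define E where "E = {x::'a. x \<noteq> 0 \<and> norm x powr a \<le> exp (a\<^sup>2)}"
    have [measurable]: "E \<in> sets borel" unfolding E_def by measurable
    define D where "D = (a * (c + real DIM('a)) / p) powr (- p)"
    define D2 where "D2 = (2 * \<bar>a\<bar>) powr p * exp \<bar>a * (c + p - b)\<bar>"
    have shell: "norm x powr (c + p - b) \<le> exp \<bar>a * (c + p - b)\<bar>" if "x \<in> E" "x \<noteq> 0" for x
      using norm_powr_le_shell[OF a that(2), of "c + p - b"] that e by (simp add: E_def)
    have "ennreal (2 powr p) * I c < \<infinity>" using fin by (simp add: ennreal_mult_less_top)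
    moreover have "ennreal (D * D2) < \<infinity>" by simp
    ultimately obtain C where C: "0 < C"
      "\<And>X A B. X \<le> (ennreal (2 powr p) * I c) * A + ennreal (D * D2) * B \<Longrightarrow> X \<le> ennreal C * (A + B)"
      using ennreal_le_common_factor by meson
    show ?thesis
    proof (intro exI[of _ C] conjI allI impI C)
      fix M and v k :: "'a \<Rightarrow> real" assume rp: "radial_pair a M v k"
      interpret radial_pair a M v k by (rule rp)
      define w where "w y = (if y \<in> inner_part a \<and> 2 * M < \<bar>v y\<bar> then \<bar>v y\<bar> else 0)" for y
      have [measurable]: "w \<in> borel_measurable borel" unfolding w_def by measurable
      have "Lp_mass c p w \<le> ennreal ((a * (c + real DIM('a)) / p) powr (- p)) * Lp_mass c p (\<lambda>x. 2 * K x * indicator E x)"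
        by (rule Hardy_dilation[OF _ _ _ _ pos p])
           (use decay_inner in \<open>auto simp: w_def E_def K_nonneg\<close>)
      also have "Lp_mass c p (\<lambda>x. 2 * K x * indicator E x) \<le> ennreal D2 * Lp_mass b p k"
        unfolding D2_def
        by (rule Lp_mass_K_le[OF shell]) (use p in auto)
      finally have w: "Lp_mass c p w \<le> ennreal (D * D2) * Lp_mass b p k"
        by (simp add: D_def D2_def ennreal_mult mult.assoc mult_left_mono)
      have "Lp_mass c p (\<lambda>x. indicator (inner_part a) x * v x) \<le>
          (\<integral>\<^sup>+x. ennreal ((2 * M) powr p) * (ennreal (norm x powr c) * indicator (inner_part a) x) +
            ennreal (norm x powr c * \<bar>w x\<bar> powr p) \<partial>lborel)"
        unfolding Lp_mass_def
      proof (rule nn_integral_mono)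
        fix x
        have "norm x powr c * \<bar>v x\<bar> powr p \<le> (2 * M) powr p * norm x powr c" if "\<bar>v x\<bar> \<le> 2 * M"
        proof -
          have "\<bar>v x\<bar> powr p \<le> (2 * M) powr p" using that p by (intro powr_mono2) auto
          then show ?thesis by (metis mult.commute mult_left_mono powr_ge_zero)
        qed
        then show "ennreal (norm x powr c * \<bar>indicator (inner_part a) x * v x\<bar> powr p)
          \<le> ennreal ((2 * M) powr p) * (ennreal (norm x powr c) * indicator (inner_part a) x) +
            ennreal (norm x powr c * \<bar>w x\<bar> powr p)"
          by (cases "x \<in> inner_part a"; cases "2 * M < \<bar>v x\<bar>")
             (auto simp: w_def ennreal_mult[symmetric] intro!: ennreal_leI)
      qed
      also have "\<dots> = ennreal ((2 * M) powr p) * I c + Lp_mass c p w"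
        by (subst nn_integral_add) (auto simp: nn_integral_cmult I_def Lp_mass_def)
      also have "ennreal ((2 * M) powr p) = ennreal (2 powr p) * ennreal (M powr p)"
        using M by (simp add: powr_mult ennreal_mult)
      finally show "Lp_mass c p (\<lambda>x. indicator (inner_part a) x * v x) \<le> (ennreal (2 powr p) * I c) * ennreal (M powr p) + ennreal (D * D2) * Lp_mass b p k"
        using w by (simp add: mult_ac add_left_mono order_trans)
    qed
  qed
qed

lemma Lp_mass_outer_le:
  fixes a b c p :: real
  assumes p: "1 \<le> p" and pos: "0 < a * (c + real DIM('a))"
    and cond: "a * (c - a * p + real DIM('a)) < 0 \<or> a * (c + p - b) \<le> 0"
  shows "\<exists>C>0. \<forall>M (v :: 'a::euclidean_space \<Rightarrow> real) k. radial_pair a M v k \<longrightarrow>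
    Lp_mass c p (\<lambda>x. indicator (- inner_part a) x * v x) \<le> ennreal C * (ennreal (M powr p) + Lp_mass b p k)"
proof -
  have a: "a \<noteq> 0" using pos by auto
  show ?thesis
  proof (cases "a * (c - a * p + real DIM('a)) < 0")
    case True
    define J where "J = (\<integral>\<^sup>+x. ennreal (norm x powr (c - a * p)) * indicator (- inner_part a) (x::'a) \<partial>lborel)"
    have "J \<le> (\<integral>\<^sup>+x. ennreal (norm x powr (c - a * p)) * indicator (inner_part (- a)) (x::'a) \<partial>lborel)"
      unfolding J_def
    proof (intro nn_integral_mono)
      fix x :: 'a
      have "x \<in> inner_part (- a)" if "x \<notin> inner_part a" "x \<noteq> 0"
        using that by (simp add: inner_part_def powr_minus field_simps)
      then show "ennreal (norm x powr (c - a * p)) * indicator (- inner_part a) x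
          \<le> ennreal (norm x powr (c - a * p)) * indicator (inner_part (- a)) x"
        by (cases "x = 0") (auto simp: indicator_def)
    qed
    also have "\<dots> < \<infinity>"
      using a True by (intro nn_integral_norm_powr_inner_part) auto
    finally have "J < \<infinity>" .
    from ennreal_le_common_factor[OF this, of 0] obtain C where C: "0 < C"
      "\<And>X A B. X \<le> J * A + 0 * B \<Longrightarrow> X \<le> ennreal C * (A + B)" by auto
    show ?thesis
    proof (intro exI[of _ C] conjI allI impI C)
      fix M and v k :: "'a \<Rightarrow> real" assume "radial_pair a M v k"
      from radial_pair.Lp_mass_bounded_le[OF this p, of "- inner_part a" c]
      show "Lp_mass c p (\<lambda>x. indicator (- inner_part a) x * v x) \<le> J * ennreal (M powr p) + 0 * Lp_mass b p k"
        by (simp add: J_def mult.commute)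
    qed
  next
    case False
    then have e: "a * (c + p - b) \<le> 0" using cond by simp
    define E where "E = {x::'a. 1 \<le> norm x powr a}"
    have [measurable]: "E \<in> sets borel" unfolding E_def by measurable
    define D where "D = (a * (c + real DIM('a)) / p) powr (- p)"
    define D2 where "D2 = (1 * \<bar>a\<bar>) powr p * exp \<bar>a * (c + p - b)\<bar>"
    have shell: "norm x powr (c + p - b) \<le> exp \<bar>a * (c + p - b)\<bar>" if "x \<in> E" "x \<noteq> 0" for x
      using norm_powr_le_shell[OF a that(2), of "c + p - b"] that e by (simp add: E_def)
    have "ennreal (D * D2) < \<infinity>" by simp
    from ennreal_le_common_factor[OF _ this, of 0] obtain C where C: "0 < C"
      "\<And>X A B. X \<le> 0 * A + ennreal (D * D2) * B \<Longrightarrow> X \<le> ennreal C * (A + B)" by auto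
    show ?thesis
    proof (intro exI[of _ C] conjI allI impI C)
      fix M and v k :: "'a \<Rightarrow> real" assume rp: "radial_pair a M v k"
      interpret radial_pair a M v k by (rule rp)
      have "Lp_mass c p (\<lambda>y. indicator (- inner_part a) y * \<bar>v y\<bar>) \<le>
          ennreal ((a * (c + real DIM('a)) / p) powr (- p)) * Lp_mass c p (\<lambda>x. K x * indicator E x)"
        by (rule Hardy_dilation[OF _ _ _ _ pos p])
           (use decay_outer in \<open>auto simp: E_def K_nonneg\<close>)
      also have "Lp_mass c p (\<lambda>x. K x * indicator E x) = Lp_mass c p (\<lambda>x. 1 * K x * indicator E x)" by simp
      also have "\<dots> \<le> ennreal D2 * Lp_mass b p k"
        unfolding D2_def
        by (rule Lp_mass_K_le[OF shell]) (use p in auto)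
      finally have "Lp_mass c p (\<lambda>y. indicator (- inner_part a) y * \<bar>v y\<bar>) \<le> ennreal (D * D2) * Lp_mass b p k"
        by (simp add: D_def D2_def ennreal_mult mult.assoc mult_left_mono)
      moreover have "Lp_mass c p (\<lambda>y. indicator (- inner_part a) y * \<bar>v y\<bar>) = Lp_mass c p (\<lambda>x. indicator (- inner_part a) x * v x)"
        unfolding Lp_mass_def by (intro nn_integral_cong) (simp add: abs_mult)
      ultimately show "Lp_mass c p (\<lambda>x. indicator (- inner_part a) x * v x) \<le> 0 * ennreal (M powr p) + ennreal (D * D2) * Lp_mass b p k"
        by simp
    qed
  qed
qed

lemma Lp_mass_le:
  fixes a b c p :: real
  assumes p: "1 \<le> p" and pos: "0 < a * (c + real DIM('a))"
    and cond: "c = b - p \<or> (b - p - c) * (a * p - real DIM('a) - c) < 0"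
  shows "\<exists>C>0. \<forall>M (v :: 'a::euclidean_space \<Rightarrow> real) k. radial_pair a M v k \<longrightarrow>
    Lp_mass c p v \<le> ennreal C * (ennreal (M powr p) + Lp_mass b p k)"
proof -
  have "(0 < a * (c - a * p + real DIM('a)) \<or> 0 \<le> a * (c + p - b)) \<and>
      (a * (c - a * p + real DIM('a)) < 0 \<or> a * (c + p - b) \<le> 0)"
  proof (cases "c = b - p")
    case False
    have a: "a \<noteq> 0" using pos by auto
    have "(b - p - c) * (a * p - real DIM('a) - c) < 0" using cond False by simp
    then have "(c + p - b) < 0 \<and> 0 < (c - a * p + real DIM('a)) \<or> (c + p - b) > 0 \<and> 0 > (c - a * p + real DIM('a))"
      by (auto simp: mult_less_0_iff)
    then show ?thesis using a
      by (cases "0 < a") (auto simp: zero_less_mult_iff zero_le_mult_iff mult_less_0_iff mult_le_0_iff)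
  qed auto
  then have cond1: "0 < a * (c - a * p + real DIM('a)) \<or> 0 \<le> a * (c + p - b)"
    and cond2: "a * (c - a * p + real DIM('a)) < 0 \<or> a * (c + p - b) \<le> 0" by blast+
  from Lp_mass_inner_le[OF p pos cond1] obtain C1 where C1: "0 < C1"
    "\<forall>M (v :: 'a \<Rightarrow> real) k. radial_pair a M v k \<longrightarrow>
      Lp_mass c p (\<lambda>x. indicator (inner_part a) x * v x) \<le> ennreal C1 * (ennreal (M powr p) + Lp_mass b p k)" by (elim exE conjE)
  from Lp_mass_outer_le[OF p pos cond2] obtain C2 where C2: "0 < C2"
    "\<forall>M (v :: 'a \<Rightarrow> real) k. radial_pair a M v k \<longrightarrow>
      Lp_mass c p (\<lambda>x. indicator (- inner_part a) x * v x) \<le> ennreal C2 * (ennreal (M powr p) + Lp_mass b p k)"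
    by (elim exE conjE)
  show ?thesis
  proof (intro exI[of _ "C1 + C2"] conjI allI impI)
    fix M and v k :: "'a \<Rightarrow> real" assume rp: "radial_pair a M v k"
    interpret radial_pair a M v k by (rule rp)
    have "Lp_mass c p v = (\<integral>\<^sup>+x. ennreal (norm x powr c * \<bar>indicator (inner_part a) x * v x\<bar> powr p) +
        ennreal (norm x powr c * \<bar>indicator (- inner_part a) x * v x\<bar> powr p) \<partial>lborel)"
      unfolding Lp_mass_def by (intro nn_integral_cong) (auto simp: indicator_def)
    also have "\<dots> = Lp_mass c p (\<lambda>x. indicator (inner_part a) x * v x) + Lp_mass c p (\<lambda>x. indicator (- inner_part a) x * v x)"
      unfolding Lp_mass_def by (rule nn_integral_add) measurable
    also have "\<dots> \<le> ennreal C1 * (ennreal (M powr p) + Lp_mass b p k) + ennreal C2 * (ennreal (M powr p) + Lp_mass b p k)"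
      by (intro add_mono C1(2)[rule_format, OF rp] C2(2)[rule_format, OF rp])
    also have "\<dots> = ennreal (C1 + C2) * (ennreal (M powr p) + Lp_mass b p k)"
      using C1(1) C2(1) by (simp add: distrib_right[symmetric] ennreal_plus[symmetric] del: ennreal_plus)
    finally show "Lp_mass c p v \<le> ennreal (C1 + C2) * (ennreal (M powr p) + Lp_mass b p k)" .
  qed (use C1 C2 in simp)
qed

section \<open>The embedding and the Hardy inequality\<close>

lemma abs_weight_powr:
  assumes "0 < p"
  shows "\<bar>norm x powr (d / p) * y\<bar> powr p = norm x powr d * \<bar>y\<bar> powr p"
  using assms by (simp add: abs_mult powr_mult powr_powr)

lemma weight_measurable:
  fixes u :: "'a::euclidean_space \<Rightarrow> real"
  assumes u: "u \<in> borel_measurable lebesgue"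
  shows "(\<lambda>x. norm x powr s * u x) \<in> borel_measurable lebesgue"
    and "(\<lambda>x. norm x powr d * \<bar>u x\<bar> powr p) \<in> borel_measurable lebesgue"
proof -
  have w: "(\<lambda>x::'a. norm x powr s) \<in> borel_measurable lebesgue" for s
    by (rule measurable_completion) measurable
  show "(\<lambda>x. norm x powr s * u x) \<in> borel_measurable lebesgue"
    by (intro borel_measurable_times w u)
  have "(\<lambda>y::real. \<bar>y\<bar> powr p) \<in> borel_measurable borel" by measurable
  from measurable_compose[OF u this]
  show "(\<lambda>x. norm x powr d * \<bar>u x\<bar> powr p) \<in> borel_measurable lebesgue"
    by (intro borel_measurable_times w)
qed

lemma weighted_Lp_iff_Lp_mass:
  fixes u :: "'a::euclidean_space \<Rightarrow> real"
  assumes u: "u \<in> borel_measurable lebesgue" and p: "1 \<le> p"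
  shows "u \<in> weighted_Lp d p \<longleftrightarrow> Lp_mass d p u < \<infinity>"
proof -
  have "0 < p" using p by simp
  then have "u \<in> weighted_Lp d p \<longleftrightarrow> integrable lebesgue (\<lambda>x. norm x powr d * \<bar>u x\<bar> powr p)"
    unfolding weighted_Lp_def Lp_def mem_Collect_eq abs_weight_powr[OF \<open>0 < p\<close>]
    using weight_measurable(1)[OF u, of "d / p"] u by blast
  also have "\<dots> \<longleftrightarrow> (\<integral>\<^sup>+x. ennreal (norm (norm x powr d * \<bar>u x\<bar> powr p)) \<partial>lebesgue) < \<infinity>"
    unfolding integrable_iff_bounded using weight_measurable(2)[OF u] by blast
  also have "(\<integral>\<^sup>+x. ennreal (norm (norm x powr d * \<bar>u x\<bar> powr p)) \<partial>lebesgue) = Lp_mass d p u"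
    unfolding Lp_mass_def nn_integral_completion by (intro nn_integral_cong) (simp add: abs_mult)
  finally show ?thesis .
qed

lemma weighted_Lp_norm_eq_Lp_mass:
  fixes u :: "'a::euclidean_space \<Rightarrow> real"
  assumes u: "u \<in> borel_measurable lebesgue" and p: "1 \<le> p"
  shows "weighted_Lp_norm d p u = enn2real (Lp_mass d p u) powr (1 / p)"
proof -
  have "0 < p" using p by simp
  have "(LINT x|lebesgue. norm x powr d * \<bar>u x\<bar> powr p)
      = enn2real (\<integral>\<^sup>+x. ennreal (norm x powr d * \<bar>u x\<bar> powr p) \<partial>lebesgue)"
    by (rule integral_eq_nn_integral[OF weight_measurable(2)[OF u]]) simp
  then show ?thesis
    unfolding weighted_Lp_norm_def Lp_norm_def abs_weight_powr[OF \<open>0 < p\<close>] Lp_mass_def nn_integral_completion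
    by simp
qed

lemma Linf_norm_bound:
  fixes f :: "'a::euclidean_space \<Rightarrow> real"
  assumes "f \<in> Linf"
  shows "AE x in lborel. \<bar>f x\<bar> \<le> Linf_norm f" and "0 \<le> Linf_norm f"
proof -
  have f: "f \<in> borel_measurable lebesgue" using assms by (simp add: Linf_def)
  obtain C where C: "AE x in lebesgue. \<bar>f x\<bar> \<le> C" using assms by (auto simp: Linf_def)
  \<comment> \<open>\<open>real_of_ereal\<close> sends infinite values to \<open>0\<close>, so the essential supremum has to be shown finite.\<close>
  define e where "e = esssup lebesgue (\<lambda>x. ereal \<bar>f x\<bar>)"
  have "e \<le> ereal C" unfolding e_def using f C by (intro esssup_I) auto
  moreover have AE: "AE x in lebesgue. ereal \<bar>f x\<bar> \<le> e" unfolding e_def by (rule esssup_AE)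
  have "0 \<le> e"
  proof (rule ccontr)
    assume "\<not> 0 \<le> e"
    with AE have "AE x in (lebesgue :: 'a measure). False"
      by (elim eventually_mono) (meson abs_ge_zero dual_order.trans ereal_less_eq(5))
    then have "emeasure (lebesgue :: 'a measure) (space lebesgue) = 0"
      using AE_iff_measurable[of "space lebesgue" "lebesgue :: 'a measure" "\<lambda>x. False"] by simp
    then show False by simp
  qed
  ultimately have e: "e = ereal (Linf_norm f)" and "0 \<le> Linf_norm f"
    unfolding Linf_norm_def e_def[symmetric] by (cases e; simp)+
  then show "0 \<le> Linf_norm f" by simp
  show "AE x in lborel. \<bar>f x\<bar> \<le> Linf_norm f" using AE by (simp add: AE_completion_iff e)
qed

text \<open>\<open>radial_deriv u\<close> is some function representing the derivative; by uniqueness it has the same weighted norm as the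
one provided by membership in the space.\<close>

lemma W_tilde_representative:
  fixes u :: "'a::euclidean_space \<Rightarrow> real"
  assumes u: "u \<in> W_tilde a b p" and a: "a \<noteq> 0" and p: "1 \<le> p"
  obtains v k where "AE x in lborel. u x = v x" "AE x in lborel. radial_deriv u x = k x"
    "radial_pair a (Linf_norm (\<lambda>x. norm x powr a * u x)) v k"
    "radial_deriv u \<in> borel_measurable lebesgue" "Lp_mass b p (radial_deriv u) < \<infinity>"
proof -
  let ?M = "Linf_norm (\<lambda>x. norm x powr a * u x)"
  have L: "u \<in> L1_loc (UNIV - {0})" and inf: "(\<lambda>x. norm x powr a * u x) \<in> Linf"
    using u by (auto simp: W_tilde_def)
  obtain g where g: "g \<in> weighted_Lp b p" "has_radial_deriv u g" using u by (auto simp: W_tilde_def)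
  have rd: "has_radial_deriv u (radial_deriv u)"
    using someI[of "has_radial_deriv u", OF g(2)] by (simp add: radial_deriv_def)
  then have Lg: "radial_deriv u \<in> L1_loc (UNIV - {0})" "g \<in> L1_loc (UNIV - {0})"
    using g by (auto simp: has_radial_deriv_def)
  have "Lp_mass b p (radial_deriv u) = Lp_mass b p g"
    by (rule Lp_mass_cong_AE[OF has_radial_deriv_unique[OF L rd g(2)]])
  also have "\<dots> < \<infinity>" using g weighted_Lp_iff_Lp_mass[OF L1_loc_measurable[OF Lg(2)] p] by simp
  finally have fin: "Lp_mass b p (radial_deriv u) < \<infinity>" .
  obtain v where v: "loc_int v" "AE x in lborel. u x = v x" by (rule L1_loc_borel_representative[OF L])
  obtain k where k: "loc_int k" "AE x in lborel. radial_deriv u x = k x"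
    by (rule L1_loc_borel_representative[OF Lg(1)])
  have "AE x in lborel. norm x powr a * \<bar>v x\<bar> \<le> ?M"
    using Linf_norm_bound(1)[OF inf] v(2) by eventually_elim (simp add: abs_mult)
  then have "radial_pair a ?M v k"
    using a v k Linf_norm_bound(2)[OF inf] radial_growth_bound[OF L rd v k, of a]
    by (intro radial_pair.intro) auto
  then show thesis using that v k L1_loc_measurable[OF Lg(1)] fin by blast
qed

lemma weighted_Lp_norm_nonneg: "0 \<le> weighted_Lp_norm d p u"
  by (simp add: weighted_Lp_norm_def Lp_norm_def)

lemma W_tilde_embedded:
  fixes a b c p :: real
  assumes p: "1 \<le> p" and pos: "0 < a * (c + real DIM('a))"
    and cond: "c = b - p \<or> (b - p - c) * (a * p - real DIM('a) - c) < 0"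
  shows "continuously_embedded (W_tilde a b p :: ('a::euclidean_space \<Rightarrow> real) set) (W_tilde_norm a b p)
    (weighted_Lp c p) (weighted_Lp_norm c p)"
proof -
  have a: "a \<noteq> 0" using pos by auto
  obtain C where C: "0 < C" "\<forall>M (v :: 'a \<Rightarrow> real) k. radial_pair a M v k \<longrightarrow>
      Lp_mass c p v \<le> ennreal C * (ennreal (M powr p) + Lp_mass b p k)"
    using Lp_mass_le[OF p pos cond] by (elim exE conjE)
  have *: "u \<in> weighted_Lp c p \<and> weighted_Lp_norm c p u \<le> (2 * C) powr (1 / p) * W_tilde_norm a b p u"
    if u: "u \<in> W_tilde a b p" for u :: "'a \<Rightarrow> real"
  proof -
    define M where "M = Linf_norm (\<lambda>x. norm x powr a * u x)"
    define G where "G = weighted_Lp_norm b p (radial_deriv u)"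
    obtain v k where v: "AE x in lborel. u x = v x" and k: "AE x in lborel. radial_deriv u x = k x"
      and rp: "radial_pair a M v k"
      and rd: "radial_deriv u \<in> borel_measurable lebesgue" "Lp_mass b p (radial_deriv u) < \<infinity>"
      unfolding M_def by (rule W_tilde_representative[OF u a p])
    have um: "u \<in> borel_measurable lebesgue" using u by (auto simp: W_tilde_def intro: L1_loc_measurable)
    have M: "0 \<le> M" using rp by (simp add: radial_pair_def)
    have G: "0 \<le> G" by (simp add: G_def weighted_Lp_norm_nonneg)
    have Gp: "Lp_mass b p (radial_deriv u) = ennreal (G powr p)"
      unfolding G_def weighted_Lp_norm_eq_Lp_mass[OF rd(1) p] using rd(2) p by (simp add: powr_powr)
    have "Lp_mass c p u = Lp_mass c p v" by (rule Lp_mass_cong_AE[OF v])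
    also have "\<dots> \<le> ennreal C * (ennreal (M powr p) + Lp_mass b p k)" using C(2) rp by blast
    also have "Lp_mass b p k = ennreal (G powr p)" using Lp_mass_cong_AE[OF k] Gp by metis
    also have "ennreal C * (ennreal (M powr p) + ennreal (G powr p)) = ennreal (C * (M powr p + G powr p))"
      using C(1) by (simp add: ennreal_mult ennreal_plus[symmetric] del: ennreal_plus)
    also have "\<dots> \<le> ennreal (2 * C * (M + G) powr p)"
    proof (rule ennreal_leI)
      have "M powr p \<le> (M + G) powr p" "G powr p \<le> (M + G) powr p"
        using M G p by (auto intro!: powr_mono2)
      then have "C * (M powr p + G powr p) \<le> C * (2 * (M + G) powr p)"
        using C(1) by (intro mult_left_mono) auto
      then show "C * (M powr p + G powr p) \<le> 2 * C * (M + G) powr p" by simp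
    qed
    finally have le: "Lp_mass c p u \<le> ennreal (2 * C * (M + G) powr p)" .
    then have fin: "Lp_mass c p u < \<infinity>" by (simp add: order_le_less_trans)
    have "enn2real (Lp_mass c p u) \<le> 2 * C * (M + G) powr p"
      using le C(1) by (intro enn2real_leI) auto
    then have "enn2real (Lp_mass c p u) powr (1 / p) \<le> (2 * C * (M + G) powr p) powr (1 / p)"
      using p by (intro powr_mono2) auto
    also have "\<dots> = (2 * C) powr (1 / p) * (M + G)"
      using C(1) M G p by (simp add: powr_mult powr_powr)
    finally show ?thesis
      using fin by (simp add: weighted_Lp_iff_Lp_mass[OF um p] weighted_Lp_norm_eq_Lp_mass[OF um p] W_tilde_norm_def M_def G_def)
  qed
  show ?thesis
    unfolding continuously_embedded_def
    using * C(1) by (intro conjI subsetI exI[of _ "(2 * C) powr (1 / p)"] ballI) auto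
qed

lemma W_tilde_Hardy:
  fixes a b p :: real
  assumes p: "1 \<le> p" and pos: "0 < a * (b - p + real DIM('a))"
  shows "\<exists>C>0. \<forall>u\<in>(W_tilde a b p :: ('a::euclidean_space \<Rightarrow> real) set).
    weighted_Lp_norm (b - p) p u \<le> C * weighted_Lp_norm b p (radial_deriv u)"
proof -
  have a: "a \<noteq> 0" using pos by auto
  define C where "C = (a * (b - p + real DIM('a)) / p) powr (- p) * \<bar>a\<bar> powr p"
  have "0 < a * (b - p + real DIM('a)) / p" using pos p by (intro divide_pos_pos) auto
  then have "0 < (a * (b - p + real DIM('a)) / p) powr (- p)" by (simp only: powr_gt_zero)
  then have C: "0 < C" using a unfolding C_def by (intro mult_pos_pos) auto
  show ?thesis
  proof (intro exI[of _ "C powr (1 / p)"] conjI ballI)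
    fix u :: "'a \<Rightarrow> real" assume u: "u \<in> W_tilde a b p"
    obtain v k where v: "AE x in lborel. u x = v x" and k: "AE x in lborel. radial_deriv u x = k x"
      and rp: "radial_pair a (Linf_norm (\<lambda>x. norm x powr a * u x)) v k"
      and rd: "radial_deriv u \<in> borel_measurable lebesgue" "Lp_mass b p (radial_deriv u) < \<infinity>"
      by (rule W_tilde_representative[OF u a p])
    have um: "u \<in> borel_measurable lebesgue" using u by (auto simp: W_tilde_def intro: L1_loc_measurable)
    have "Lp_mass (b - p) p u \<le> ennreal C * Lp_mass b p (radial_deriv u)"
      using radial_pair.Hardy_global[OF rp p pos] Lp_mass_cong_AE[OF v] Lp_mass_cong_AE[OF k]
      unfolding C_def by metis
    then have "enn2real (Lp_mass (b - p) p u) \<le> enn2real (ennreal C * Lp_mass b p (radial_deriv u))"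
      using rd(2) by (intro enn2real_mono) (auto simp: ennreal_mult_less_top)
    also have "\<dots> = C * enn2real (Lp_mass b p (radial_deriv u))"
      using C by (simp add: enn2real_mult)
    finally have "enn2real (Lp_mass (b - p) p u) powr (1 / p) \<le> (C * enn2real (Lp_mass b p (radial_deriv u))) powr (1 / p)"
      using p by (intro powr_mono2) auto
    then show "weighted_Lp_norm (b - p) p u \<le> C powr (1 / p) * weighted_Lp_norm b p (radial_deriv u)"
      using C by (simp add: weighted_Lp_norm_eq_Lp_mass[OF um p] weighted_Lp_norm_eq_Lp_mass[OF rd(1) p] powr_mult)
  qed (use C in auto)
qed

section \<open>Necessity of the exponent conditions\<close>

lemma powr_le_1_by_sign:
  fixes r m s :: real
  assumes "m \<noteq> 0" "0 < r" "(r powr m \<le> 1 \<and> 0 \<le> m * s) \<or> (1 \<le> r powr m \<and> m * s \<le> 0)"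
  shows "r powr s \<le> 1"
proof -
  have "(m * ln r \<le> 0 \<and> 0 \<le> m * s) \<or> (0 \<le> m * ln r \<and> m * s \<le> 0)"
    using assms by (auto simp: powr_def)
  then have "(m * s) * (m * ln r) \<le> 0"
    by (metis mult_nonneg_nonpos mult_nonpos_nonneg)
  then have "m\<^sup>2 * (s * ln r) \<le> 0" by (simp add: power2_eq_square mult_ac)
  then have "s * ln r \<le> 0" using assms(1) by (simp add: mult_le_0_iff)
  then show ?thesis using assms(2) by (simp add: powr_def)
qed

lemma Lp_mass_finite_two_powers:
  fixes f :: "'a::euclidean_space \<Rightarrow> real"
  assumes m: "m \<noteq> 0" and p: "1 \<le> p" and C: "0 \<le> C"
    and in0: "\<And>x. x \<noteq> 0 \<Longrightarrow> norm x powr m \<le> 1 \<Longrightarrow> \<bar>f x\<bar> \<le> C * norm x powr s0"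
    and out: "\<And>x. x \<noteq> 0 \<Longrightarrow> 1 \<le> norm x powr m \<Longrightarrow> \<bar>f x\<bar> \<le> C * norm x powr s1"
    and exps: "0 < m * (d + p * s0 + real DIM('a))" "m * (d + p * s1 + real DIM('a)) < 0"
  shows "Lp_mass d p f < \<infinity>"
proof -
  have pw: "norm x powr d * \<bar>f x\<bar> powr p \<le> C powr p * norm x powr (d + p * s)"
    if "\<bar>f x\<bar> \<le> C * norm x powr s" for x s
  proof -
    have "\<bar>f x\<bar> powr p \<le> (C * norm x powr s) powr p" using that p by (intro powr_mono2) auto
    then have "norm x powr d * \<bar>f x\<bar> powr p \<le> norm x powr d * (C * norm x powr s) powr p"
      by (intro mult_left_mono) auto
    also have "\<dots> = C powr p * norm x powr (d + p * s)"
      using C by (simp add: powr_mult powr_powr powr_add mult_ac)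
    finally show ?thesis .
  qed
  have "Lp_mass d p f \<le> (\<integral>\<^sup>+x. ennreal (C powr p) * (ennreal (norm x powr (d + p * s0)) * indicator (inner_part m) x) +
     ennreal (C powr p) * (ennreal (norm x powr (d + p * s1)) * indicator (inner_part (- m)) (x::'a)) \<partial>lborel)"
    unfolding Lp_mass_def
  proof (rule nn_integral_mono)
    fix x :: 'a
    show "ennreal (norm x powr d * \<bar>f x\<bar> powr p) \<le>
      ennreal (C powr p) * (ennreal (norm x powr (d + p * s0)) * indicator (inner_part m) x) +
      ennreal (C powr p) * (ennreal (norm x powr (d + p * s1)) * indicator (inner_part (- m)) x)"
    proof (cases "x = 0")
      case False
      consider "x \<in> inner_part m" "norm x powr m \<le> 1" | "x \<in> inner_part (- m)" "1 \<le> norm x powr m"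
        using False by (fastforce simp: inner_part_def powr_minus field_simps)
      then show ?thesis
      proof cases
        case 1
        then have "ennreal (norm x powr d * \<bar>f x\<bar> powr p) \<le> ennreal (C powr p) * ennreal (norm x powr (d + p * s0))"
          using pw[OF in0] False by (simp add: ennreal_mult[symmetric] ennreal_leI)
        with 1 show ?thesis by (simp add: add_increasing2)
      next
        case 2
        then have "ennreal (norm x powr d * \<bar>f x\<bar> powr p) \<le> ennreal (C powr p) * ennreal (norm x powr (d + p * s1))"
          using pw[OF out] False by (simp add: ennreal_mult[symmetric] ennreal_leI)
        with 2 show ?thesis by (simp add: add_increasing)
      qed
    qed simp
  qed
  also have "\<dots> = ennreal (C powr p) * (\<integral>\<^sup>+x. ennreal (norm x powr (d + p * s0)) * indicator (inner_part m) (x::'a) \<partial>lborel) +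
     ennreal (C powr p) * (\<integral>\<^sup>+x. ennreal (norm x powr (d + p * s1)) * indicator (inner_part (- m)) (x::'a) \<partial>lborel)"
    by (subst nn_integral_add) (auto simp: nn_integral_cmult)
  also have "\<dots> < \<infinity>"
    using nn_integral_norm_powr_inner_part[OF m exps(1)]
      nn_integral_norm_powr_inner_part[of "- m" "d + p * s1", where ?'a='a] m exps(2)
    by (simp add: ennreal_mult_less_top)
  finally show ?thesis .
qed

text \<open>The function is \<open>norm x powr \<mu> * (1 + norm x powr m) powr (- k)\<close>.  It behaves like \<open>norm x powr \<mu>\<close> where
\<open>norm x powr m \<le> 1\<close>, which decides the divergence of its integral, and a large \<open>k\<close> makes all quantities finite where
\<open>norm x powr m \<ge> 1\<close>.  For \<open>\<mu> = 0\<close> the leading term of the derivative cancels, which gains the factor \<open>norm x powr m\<close>.\<close>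

lemma not_embedded_if_exponents:
  fixes a b c p m \<mu> :: real
  assumes p: "1 \<le> p" and m: "m \<noteq> 0"
    and A: "0 \<le> m * (a + \<mu>)" and Cc: "m * (c + p * \<mu> + real DIM('a)) \<le> 0"
    and B: "0 < m * (b + p * (\<mu> - 1) + real DIM('a)) \<or> (\<mu> = 0 \<and> 0 < m * (b + p * (m - 1) + real DIM('a)))"
  shows "\<not> (W_tilde a b p :: ('a::euclidean_space \<Rightarrow> real) set) \<subseteq> weighted_Lp c p"
proof
  assume sub: "(W_tilde a b p :: ('a \<Rightarrow> real) set) \<subseteq> weighted_Lp c p"
  define X where "X = m * (a + \<mu>)"
  define Y where "Y = m * (b + p * (\<mu> - 1) + real DIM('a))"
  \<comment> \<open>Large enough for \<open>kX\<close> and \<open>kY\<close>, which control the function and its derivative where \<open>norm x powr m \<ge> 1\<close>.\<close>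
  define k where "k = (\<bar>X\<bar> + \<bar>Y\<bar> + 1) / m\<^sup>2"
  have m2: "0 < m\<^sup>2" using m by simp
  have k: "0 < k" using m2 by (simp add: k_def add_nonneg_pos)
  have mk: "m * (m * k) = \<bar>X\<bar> + \<bar>Y\<bar> + 1" using m by (simp add: k_def power2_eq_square)
  have kX: "m * (a + \<mu> - m * k) \<le> 0" 
    using mk by (simp add: X_def[symmetric] right_diff_distrib[of m "a + \<mu>"])
  have kY: "m * (b + p * (\<mu> - 1 - m * k) + real DIM('a)) < 0"
  proof -
    define Z where "Z = \<bar>X\<bar> + \<bar>Y\<bar> + 1"
    have "m * (b + p * (\<mu> - 1 - m * k) + real DIM('a)) = Y - p * (m * (m * k))"
      by (simp add: Y_def algebra_simps)
    then have eq: "m * (b + p * (\<mu> - 1 - m * k) + real DIM('a)) = Y - p * Z"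
      unfolding mk Z_def .
    have "Y < Z" "0 \<le> Z" by (auto simp: Z_def)
    moreover have "1 * Z \<le> p * Z" using p \<open>0 \<le> Z\<close> by (rule mult_right_mono)
    ultimately show ?thesis unfolding eq by linarith
  qed
  let ?W = "\<lambda>r. (1 + r powr m) powr (- k)" and ?q = "\<lambda>r::real. r powr m / (1 + r powr m)"
  define F where "F r = r powr \<mu> * ?W r" for r :: real
  define F' where "F' r = r powr (\<mu> - 1) * ?W r * (\<mu> - k * m * ?q r)" for r :: real
  have D: "(F has_real_derivative F' r) (at r)" if r: "0 < r" for r
  proof -
    have q: "0 < 1 + r powr m" by (simp add: add_pos_nonneg)
    have d1: "((\<lambda>r. r powr \<mu>) has_real_derivative \<mu> * r powr (\<mu> - 1)) (at r)"
      by (rule has_real_derivative_powr[OF r])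
    have "((\<lambda>r. 1 + r powr m) has_real_derivative 0 + m * r powr (m - 1)) (at r)"
      by (intro derivative_intros has_real_derivative_powr r)
    from DERIV_chain2[OF has_real_derivative_powr[OF q] this]
    have d2: "((\<lambda>r. ?W r) has_real_derivative
        (- k) * (1 + r powr m) powr (- k - 1) * (0 + m * r powr (m - 1))) (at r)" .
    have "((\<lambda>r. r powr \<mu> * ?W r) has_real_derivative
       \<mu> * r powr (\<mu> - 1) * ?W r +
       (- k) * (1 + r powr m) powr (- k - 1) * (0 + m * r powr (m - 1)) * r powr \<mu>) (at r)"
      by (rule DERIV_mult'[OF d1 d2, THEN DERIV_cong]) (simp add: algebra_simps)
    moreover have "\<mu> * r powr (\<mu> - 1) * ?W r +
       (- k) * (1 + r powr m) powr (- k - 1) * (0 + m * r powr (m - 1)) * r powr \<mu> = F' r"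
    proof -
      have e: "r powr (\<mu> - 1) = r powr \<mu> / r" "r powr (m - 1) = r powr m / r"
        "(1 + r powr m) powr (- k - 1) = ?W r / (1 + r powr m)"
        using r q by (simp_all add: powr_diff)
      show ?thesis unfolding F'_def e by (simp add: divide_inverse algebra_simps)
    qed
    ultimately show ?thesis by (simp add: F_def[abs_def])
  qed
  have cF': "continuous_on {0<..} F'"
    unfolding F'_def by (intro continuous_intros) (auto simp: add_nonneg_eq_0_iff)
  define u :: "'a \<Rightarrow> real" where "u x = F (norm x)" for x
  define g :: "'a \<Rightarrow> real" where "g x = F' (norm x)" for x
  have uL: "u \<in> L1_loc (UNIV - {0})" and ug: "has_radial_deriv u g"
    unfolding u_def g_def by (rule has_radial_deriv_radial[OF D cF']; assumption)+
  have q1: "?W r \<le> 1" for r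
    using k powr_mono2'[of "- k" 1 "1 + r powr m"] by simp
  have q2: "?W r \<le> r powr (- (m * k))" if "0 < r" for r
  proof -
    have "?W r \<le> (r powr m) powr (- k)"
      using that k by (intro powr_mono2') auto
    then show ?thesis by (simp add: powr_powr)
  qed
  have frac: "0 \<le> ?q r" "?q r \<le> 1" "?q r \<le> r powr m" for r
    by (auto simp: divide_le_eq add_pos_nonneg algebra_simps)
  have "u \<in> W_tilde a b p"
  proof -
    have um: "(\<lambda>x. norm x powr a * u x) \<in> borel_measurable lebesgue"
      by (rule weight_measurable(1)[OF L1_loc_measurable[OF uL]])
    have "\<bar>norm x powr a * u x\<bar> \<le> 1" for x
    proof (cases "x = 0")
      case False
      then have r: "0 < norm x" by simp
      have nn: "0 \<le> norm x powr a * u x" by (simp add: u_def F_def)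
      show ?thesis
      proof (cases "norm x powr m \<le> 1")
        case True
        have "norm x powr (a + \<mu>) * ?W (norm x) \<le> 1 * 1"
          by (intro mult_mono q1 powr_le_1_by_sign[OF m r]) (use True A in auto)
        then show ?thesis using nn r by (simp add: u_def F_def powr_add mult.assoc)
      next
        case F: False
        have "norm x powr (a + \<mu>) * ?W (norm x) \<le> norm x powr (a + \<mu>) * norm x powr (- (m * k))"
          by (intro mult_left_mono q2 r) auto
        also have "\<dots> = norm x powr (a + \<mu> - m * k)" by (simp add: powr_add[symmetric])
        also have "\<dots> \<le> 1" by (rule powr_le_1_by_sign[OF m r]) (use F kX in auto)
        finally show ?thesis using nn r by (simp add: u_def F_def powr_add mult.assoc)
      qed
    qed simp
    then have "AE x in lebesgue. \<bar>norm x powr a * u x\<bar> \<le> 1" by (rule AE_I2)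
    with um have "(\<lambda>x. norm x powr a * u x) \<in> Linf"
      unfolding Linf_def mem_Collect_eq by blast
    moreover have "g \<in> weighted_Lp b p"
    proof -
      have gm: "g \<in> borel_measurable lebesgue"
        using ug by (auto simp: has_radial_deriv_def intro: L1_loc_measurable)
      define C where "C = \<bar>\<mu>\<bar> + k * \<bar>m\<bar>"
      have C: "0 \<le> C" using k by (simp add: C_def)
      have base: "\<bar>g x\<bar> \<le> C * (norm x powr (\<mu> - 1) * ?W (norm x))" for x
      proof -
        have "\<bar>k * m * ?q (norm x)\<bar> \<le> k * \<bar>m\<bar>"
        proof -
          have "\<bar>k * m * t\<bar> \<le> k * \<bar>m\<bar>" if "0 \<le> t" "t \<le> 1" for t
            using that k mult_left_mono[of t 1 "k * \<bar>m\<bar>"] by (simp add: abs_mult)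
          then show ?thesis using frac by blast
        qed
        then have "\<bar>\<mu> - k * m * ?q (norm x)\<bar> \<le> C"
          unfolding C_def by linarith
        then have "(norm x powr (\<mu> - 1) * ?W (norm x)) * \<bar>\<mu> - k * m * ?q (norm x)\<bar>
            \<le> (norm x powr (\<mu> - 1) * ?W (norm x)) * C"
          by (intro mult_left_mono) auto
        then show ?thesis by (simp add: g_def F'_def abs_mult mult_ac)
      qed
      have out: "\<bar>g x\<bar> \<le> C * norm x powr (\<mu> - 1 - m * k)" if "x \<noteq> 0" for x
      proof -
        have "norm x powr (\<mu> - 1) * ?W (norm x) \<le> norm x powr (\<mu> - 1) * norm x powr (- (m * k))"
          using that by (intro mult_left_mono q2) auto
        also have "\<dots> = norm x powr (\<mu> - 1 - m * k)" by (simp add: powr_add[symmetric])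
        finally show ?thesis using base[of x] C by (meson mult_left_mono order_trans)
      qed
      have "Lp_mass b p g < \<infinity>"
      proof (cases "0 < m * (b + p * (\<mu> - 1) + real DIM('a))")
        case True
        have in0: "\<bar>g x\<bar> \<le> C * norm x powr (\<mu> - 1)" for x
        proof -
          have "norm x powr (\<mu> - 1) * ?W (norm x) \<le> norm x powr (\<mu> - 1) * 1"
            by (intro mult_left_mono q1) auto
          then show ?thesis using base[of x] C by (metis mult.right_neutral mult_left_mono order_trans)
        qed
        show ?thesis
          by (rule Lp_mass_finite_two_powers[OF m p C in0 out True kY])
      next
        case False
        then have \<mu>: "\<mu> = 0" and pos: "0 < m * (b + p * (m - 1) + real DIM('a))" using B by auto
        have in0: "\<bar>g x\<bar> \<le> C * norm x powr (m - 1)" if "x \<noteq> 0" for x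
        proof -
          have "\<bar>g x\<bar> = norm x powr (- 1) * ?W (norm x) * (C * ?q (norm x))"
            using \<mu> k frac[of "norm x"] by (simp add: g_def F'_def C_def abs_mult)
          also have "\<dots> \<le> norm x powr (- 1) * 1 * (C * norm x powr m)"
            using frac[of "norm x"] C by (intro mult_mono mult_left_mono q1) auto
          also have "\<dots> = C * norm x powr (m - 1)" using that by (simp add: powr_diff powr_minus_divide)
          finally show ?thesis .
        qed
        show ?thesis
          by (rule Lp_mass_finite_two_powers[OF m p C in0 out pos kY])
      qed
      then show ?thesis using weighted_Lp_iff_Lp_mass[OF gm p] by simp
    qed
    ultimately show ?thesis using uL ug by (auto simp: W_tilde_def)
  qed
  moreover have "u \<notin> weighted_Lp c p"
  proof -
    define K where "K = 2 powr (- k * p)"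
    have "(\<integral>\<^sup>+x. ennreal K * (ennreal (norm x powr (c + p * \<mu>)) * indicator (inner_part m) (x::'a)) \<partial>lborel) \<le> Lp_mass c p u"
      unfolding Lp_mass_def
    proof (rule nn_integral_mono)
      fix x :: 'a
      show "ennreal K * (ennreal (norm x powr (c + p * \<mu>)) * indicator (inner_part m) x) \<le> ennreal (norm x powr c * \<bar>u x\<bar> powr p)"
      proof (cases "x \<in> inner_part m")
        case True
        then have x: "x \<noteq> 0" "norm x powr m \<le> 1" by (auto simp: inner_part_def)
        have "2 powr (- k) \<le> ?W (norm x)"
          using x k by (intro powr_mono2') (auto simp: add_pos_nonneg)
        then have "norm x powr \<mu> * 2 powr (- k) \<le> u x" by (simp add: u_def F_def mult_left_mono)
        then have "(norm x powr \<mu> * 2 powr (- k)) powr p \<le> \<bar>u x\<bar> powr p"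
          using p by (intro powr_mono2) auto
        then have "norm x powr c * (norm x powr \<mu> * 2 powr (- k)) powr p \<le> norm x powr c * \<bar>u x\<bar> powr p"
          by (intro mult_left_mono) auto
        moreover have "norm x powr c * (norm x powr \<mu> * 2 powr (- k)) powr p = K * norm x powr (c + p * \<mu>)"
          by (simp add: K_def powr_mult powr_powr powr_add mult_ac)
        ultimately show ?thesis using True by (simp add: ennreal_mult[symmetric] ennreal_leI K_def)
      qed simp
    qed
    moreover have "(\<integral>\<^sup>+x. ennreal K * (ennreal (norm x powr (c + p * \<mu>)) * indicator (inner_part m) (x::'a)) \<partial>lborel) = \<infinity>"
      using nn_integral_norm_powr_inner_part_infinite[OF m Cc]
      by (simp add: nn_integral_cmult K_def ennreal_mult_top)
    ultimately have "Lp_mass c p u = \<infinity>" by (simp add: top_unique)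
    then show ?thesis using weighted_Lp_iff_Lp_mass[OF L1_loc_measurable[OF uL] p] by simp
  qed
  ultimately show False using sub by blast
qed

text \<open>The inclusion of sets alone forces the conditions on the exponents; the norm inequality is not needed.\<close>

lemma W_tilde_subset_imp:
  fixes a b c p :: real
  assumes p: "1 \<le> p" and sub: "(W_tilde a b p :: ('a::euclidean_space \<Rightarrow> real) set) \<subseteq> weighted_Lp c p"
  shows "0 < a * (c + real DIM('a))" "c = b - p \<or> (b - p - c) * (a * p - real DIM('a) - c) < 0"
proof -
  show "0 < a * (c + real DIM('a))"
  proof (rule ccontr)
    assume neg: "\<not> 0 < a * (c + real DIM('a))"
    define \<beta> where "\<beta> = b - p + real DIM('a)"
    \<comment> \<open>The sign selects an end at which constants satisfy the supremum bound but are not \<open>p\<close>-integrable.\<close>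
    obtain \<sigma> :: real where \<sigma>: "\<bar>\<sigma>\<bar> = 1" "0 \<le> \<sigma> * a" "\<sigma> * (c + real DIM('a)) \<le> 0"
    proof (cases "0 < a \<or> (a = 0 \<and> c + real DIM('a) \<le> 0)")
      case True
      then show thesis using neg by (intro that[of 1]) (auto simp: zero_less_mult_iff)
    next
      case False
      then show thesis using neg by (intro that[of "- 1"]) (auto simp: zero_less_mult_iff)
    qed
    \<comment> \<open>\<open>n\<close> is so large that the derivative of \<open>(1 + norm x powr m) powr (- k)\<close> is \<open>p\<close>-integrable at that end.\<close>
    define n where "n = \<bar>\<beta>\<bar> + 1"
    define m where "m = \<sigma> * n"
    have n: "1 \<le> n" by (simp add: n_def)
    have \<sigma>2: "\<sigma> * \<sigma> = 1" using \<sigma>(1) by (auto simp: abs_if split: if_splits)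
    have m0: "m \<noteq> 0" using \<sigma>(1) n by (auto simp: m_def)
    have "m * (b + p * (m - 1) + real DIM('a)) = n * (\<sigma> * \<beta> + p * n)"
      using \<sigma>2 by (simp add: m_def \<beta>_def algebra_simps)
    moreover have "0 < \<sigma> * \<beta> + p * n"
    proof -
      have "- \<bar>\<beta>\<bar> \<le> \<sigma> * \<beta>" using \<sigma>(1) by (metis abs_ge_minus_self abs_mult minus_le_iff mult_1)
      moreover have "1 * n \<le> p * n" using p n by (intro mult_right_mono) auto
      ultimately show ?thesis by (simp add: n_def)
    qed
    ultimately have B: "0 < m * (b + p * (m - 1) + real DIM('a))" using n by simp
    have A: "0 \<le> m * (a + 0)" using mult_nonneg_nonneg[OF _ \<sigma>(2), of n] n by (simp add: m_def mult_ac)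
    have C: "m * (c + p * 0 + real DIM('a)) \<le> 0"
      using mult_nonneg_nonpos[OF _ \<sigma>(3), of n] n by (simp add: m_def mult_ac)
    show False using not_embedded_if_exponents[OF p m0 A C] B sub by blast
  qed
  show "c = b - p \<or> (b - p - c) * (a * p - real DIM('a) - c) < 0"
  proof (rule ccontr)
    assume neg: "\<not> (c = b - p \<or> (b - p - c) * (a * p - real DIM('a) - c) < 0)"
    \<comment> \<open>\<open>\<mu>\<close> is the exponent of logarithmic divergence; the sign of \<open>m\<close> selects the end where the derivative is \<open>p\<close>-integrable.\<close>
    define m where "m = b - p - c"
    define \<mu> where "\<mu> = - (c + real DIM('a)) / p"
    have m0: "m \<noteq> 0" using neg by (simp add: m_def)
    have p\<mu>: "p * \<mu> = - (c + real DIM('a))" using p by (simp add: \<mu>_def)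
    have "p * (m * (a + \<mu>)) = m * (a * p + p * \<mu>)" by (simp add: algebra_simps)
    also have "\<dots> = m * (a * p - real DIM('a) - c)"
      unfolding p\<mu> by (simp add: algebra_simps)
    also have "0 \<le> m * (a * p - real DIM('a) - c)" using neg by (simp add: m_def)
    finally have A: "0 \<le> m * (a + \<mu>)" using p by (simp add: zero_le_mult_iff)
    have C: "m * (c + p * \<mu> + real DIM('a)) \<le> 0" by (simp add: p\<mu>)
    have "b + p * (\<mu> - 1) + real DIM('a) = m" by (simp add: right_diff_distrib p\<mu> m_def)
    then have B: "0 < m * (b + p * (\<mu> - 1) + real DIM('a))" using m0 by (auto simp: zero_less_mult_iff)
    show False using not_embedded_if_exponents[OF p m0 A C] B sub by blast
  qed
qed

section \<open>The characterization\<close>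

lemma exponent_conditions_iff:
  fixes a b c p N :: real
  assumes p: "1 \<le> p"
  shows "(0 < a * (c + N) \<and> (c = b - p \<or> (b - p - c) * (a * p - N - c) < 0)) \<longleftrightarrow>
     a \<noteq> 0 \<and>
          ((a * p - N \<noteq> b - p \<and>
            ((a * p - N \<ge> - N \<and> b - p \<ge> - N) \<or> (a * p - N \<le> - N \<and> b - p \<le> - N)) \<and>
            c \<in> open_interval (a * p - N) (b - p))
           \<or>
           (((a * p - N < - N \<and> b - p > - N) \<or> (a * p - N > - N \<and> b - p < - N)) \<and>
            c \<in> open_interval (a * p - N) (- N))
           \<or>
           (a * (b - p + N) > 0 \<and> c = b - p))"
proof -
  define A where "A = a * p - N"
  define B where "B = b - p"
  have sgn: "0 < a \<longleftrightarrow> - N < A" "a < 0 \<longleftrightarrow> A < - N" "a = 0 \<longleftrightarrow> A = - N"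
    using p by (auto simp: A_def zero_less_mult_iff mult_less_0_iff)
  have between: "(B - c) * (A - c) < 0 \<longleftrightarrow> c \<in> open_interval A B"
    by (auto simp: mult_less_0_iff open_interval_def)
  show ?thesis
    unfolding A_def[symmetric] B_def[symmetric] between
    by (auto simp: zero_less_mult_iff open_interval_def sgn min_def max_def split: if_splits)
qed

theorem theorem4p2:
  fixes a b c p :: real
  assumes "1 \<le> p"
  shows "(continuously_embedded
            (W_tilde a b p :: ('a::euclidean_space \<Rightarrow> real) set) (W_tilde_norm a b p)
            (weighted_Lp c p) (weighted_Lp_norm c p)
          \<longleftrightarrow>
          a \<noteq> 0 \<and>
          ((a * p - real DIM('a) \<noteq> b - p \<and>
            ((a * p - real DIM('a) \<ge> - real DIM('a) \<and> b - p \<ge> - real DIM('a)) \<or>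
             (a * p - real DIM('a) \<le> - real DIM('a) \<and> b - p \<le> - real DIM('a))) \<and>
            c \<in> open_interval (a * p - real DIM('a)) (b - p))
           \<or>
           (((a * p - real DIM('a) < - real DIM('a) \<and> b - p > - real DIM('a)) \<or>
             (a * p - real DIM('a) > - real DIM('a) \<and> b - p < - real DIM('a))) \<and>
            c \<in> open_interval (a * p - real DIM('a)) (- real DIM('a)))
           \<or>
           (a * (b - p + real DIM('a)) > 0 \<and> c = b - p)))
         \<and>
         (a * (b - p + real DIM('a)) > 0 \<and> c = b - p \<longrightarrow>
          (\<exists>C>0. \<forall>u\<in>(W_tilde a b p :: ('a \<Rightarrow> real) set).
             weighted_Lp_norm (b - p) p u \<le> C * weighted_Lp_norm b p (radial_deriv u)))"
proof -
  let ?W = "W_tilde a b p :: ('a \<Rightarrow> real) set"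
  let ?E = "continuously_embedded ?W (W_tilde_norm a b p) (weighted_Lp c p) (weighted_Lp_norm c p)"
  let ?C = "0 < a * (c + real DIM('a)) \<and> (c = b - p \<or> (b - p - c) * (a * p - real DIM('a) - c) < 0)"
  have "?E \<longleftrightarrow> ?C"
  proof
    assume ?E
    then have "?W \<subseteq> weighted_Lp c p" by (simp add: continuously_embedded_def)
    from W_tilde_subset_imp[OF assms this] show ?C by (rule conjI)
  next
    assume ?C
    then show ?E by (elim conjE) (rule W_tilde_embedded[OF assms])
  qed
  note iff = trans[OF this exponent_conditions_iff[OF assms]]
  show ?thesis
  proof (rule conjI[OF iff], rule impI)
    assume "a * (b - p + real DIM('a)) > 0 \<and> c = b - p"
    then show "\<exists>C>0. \<forall>u\<in>(W_tilde a b p :: ('a \<Rightarrow> real) set).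
             weighted_Lp_norm (b - p) p u \<le> C * weighted_Lp_norm b p (radial_deriv u)"
      by (intro W_tilde_Hardy[OF assms]) simp
  qed
qed

end
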